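(* Suppose $\Omega=(0,1)$ and $g$ is an odd function, and set $h^{-1}(s)=g(\sqrt s)\sqrt s$ for $s\ge0$. Let $a,b$ be two smooth non-negative functions on $\Omega$ with $\|b\|_\infty\le\frac{1-\delta}{\lambda^2}$ for some $\delta>0$, and suppose Assumption (A2) holds. Suppose in addition that $\omega=\{a>0\}$ and $\mathcal O=\{b>0\}$ satisfy the GCC and that Assumption (A1) holds. Let $U_0=(u_0,v_0,u_1,v_1)\in (H^1_0(\Omega)\cap H^2(\Omega))^2\times(H^1_0(\Omega))^2$ and let $(u,v)$ be the solution of the coupled system (S). Then there exists $T_0>0$ such that $$E_{u,v}(t)\ge\left(\frac{\psi(t)}{4\sqrt{E_{\partial_tu,\partial_tv}(0)}}\right)^2,\qquad t\ge T_0,$$ where $\psi$ is a solution of $$\frac{d\psi}{dt}+\|a\|_{L^\infty}\,\psi\,(h^{-1})'(\psi)=0,\qquad 0<\psi(0)\le4\sqrt{E_{\partial_tu,\partial_tv}(0)\,E_{u,v}(T_0)} .$$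
   Context: $\Gamma=\partial\Omega$, $\Delta$ is the Laplacian on $\Omega$, $\lambda$ the Poincaré constant of $\Omega$ ($\|w\|_{L^2}\le\lambda\|\nabla w\|_{L^2}$ for $w\in H^1_0(\Omega)$). The function $g:\mathbb R\to\mathbb R$ is continuous, monotone increasing, $g(0)=0$, and for some positive numbers $M_0,m,M,M_1$: $g(y)y\le M_0y^2$ for $|y|<1$; $my^2\le g(y)y\le My^2$ for $|y|\ge1$; $\|g'\|_{L^\infty}\le M_1$. System (S): $\partial_t^2u-\Delta u+b(x)v+a(x)g(\partial_tu)=0$ and $\partial_t^2v-\Delta v+b(x)u=0$ in $(0,\infty)\times\Omega$, $u=v=0$ on $(0,\infty)\times\Gamma$, $(u,\partial_tu)(0)=(u_0,u_1)$, $(v,\partial_tv)(0)=(v_0,v_1)$. For $U_0$ as in the claim there is a unique solution with $(u,v,\partial_tu,\partial_tv)$ continuous on $\mathbb R_+$ with values in $(H^1_0\cap H^2)^2\times(H^1_0)^2$. Energy: $E_{u,v}(t)=\frac12\int_\Omega(|\nabla u|^2+|\nabla v|^2+|\partial_tu|^2+|\partial_tv|^2)\,dx+\int_\Omega b\,uv\,dx$ at time $t$; $E_{\partial_tu,\partial_tv}$ is the same expression with $(u,v)$ replaced by $(\partial_tu,\partial_tv)$. GCC: for $\omega\subset\Omega$ and $T>0$, $(\omega,T)$ satisfies the GCC if every geodesic traveling at speed one in $\Omega$ (in the sense of Bardos–Lebeau–Rauch) meets $\omega$ in a time $t<T$; $\omega$ satisfies the GCC if $(\omega,T)$ does for some $T>0$.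 Assumption (A1): there exists $T_*>0$ such that the only $(u_1,u_2)$ with $u_1\in H^1((0,T_* )\times\Omega)$, $u_2\in L^2((0,T_* )\times\Omega)$, $\partial_t^2u_1-\Delta u_1+bu_2=0$, $\partial_t^2u_2-\Delta u_2+bu_1=0$ in $(0,T_* )\times\Omega$, $u_1=u_2=0$ on $(0,T_* )\times\Gamma$ and $a(x)u_1=0$ on $(0,T_* )\times\Omega$ is $u_1=u_2=0$. Assumption (A2) (for the function $h^{-1}$ of the claim): there is $0<r_0\le1$ such that $h^{-1}\in C^3((0,r_0])$ is strictly convex; $\lim_{s\to0}h^{-1}(s)=\lim_{s\to0}(h^{-1})'(s)=\lim_{s\to0}s(h^{-1})''(s)=\lim_{s\to0}s^2(h^{-1})'''(s)=0$; and there exist $\beta>1$ and $\alpha_0\ge0$ such that $\lim_{s\to\infty}s\,(h^{-1})'(1/s^\beta)=\alpha_0$, and for all $s\in(0,r_0]$: $(h^{-1})'(s)\le\beta s(h^{-1})''(s)$ and $(\beta^2-\beta)s(h^{-1})''(s)+\beta^2s^2(h^{-1})'''(s)\ge0$. Moreover, if $\beta s(h^{-1})''(s)-(h^{-1})'(s)>0$ for all $s\in(0,r_0]$, then there exists $\alpha_1>0$ such that for all $s\in(0,r_0]$ $$\frac{(h^{-1})'(s)\big((\beta^2-\beta)s(h^{-1})''(s)+\beta^2s^2(h^{-1})'''(s)\big)}{\beta s(h^{-1})''(s)-(h^{-1})'(s)}\le\alpha_1 .$$ *)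

theory Defs
  imports "HOL-Analysis.Analysis" "HOL-Probability.Essential_Supremum"
begin

section \<open>Smooth functions, Lebesgue and Sobolev spaces\<close>

text \<open>Elements of \<open>L\<^sup>2\<close> and of Sobolev spaces are represented by functions; all notions below
  are invariant under modification on null sets of the open set \<open>\<Omega>\<close>.\<close>

definition pd :: "'a::euclidean_space \<Rightarrow> ('a \<Rightarrow> real) \<Rightarrow> 'a \<Rightarrow> real" where
  "pd i f x = frechet_derivative f (at x) i"

text \<open>Only meant for open \<open>S\<close>.\<close>
primrec Ck_on :: "nat \<Rightarrow> 'a::euclidean_space set \<Rightarrow> ('a \<Rightarrow> real) \<Rightarrow> bool" where
  "Ck_on 0 S f \<longleftrightarrow> continuous_on S f"
| "Ck_on (Suc k) S f \<longleftrightarrow> f differentiable_on S \<and> (\<forall>i\<in>Basis. Ck_on k S (pd i f))"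

definition smooth_on :: "'a::euclidean_space set \<Rightarrow> ('a \<Rightarrow> real) \<Rightarrow> bool" where
  "smooth_on S f \<longleftrightarrow> (\<forall>k. Ck_on k S f)"

definition test_fun :: "'a::euclidean_space set \<Rightarrow> ('a \<Rightarrow> real) \<Rightarrow> bool" where
  "test_fun \<Omega> \<phi> \<longleftrightarrow> smooth_on UNIV \<phi> \<and> (\<exists>K. compact K \<and> K \<subseteq> \<Omega> \<and> (\<forall>x. x \<notin> K \<longrightarrow> \<phi> x = 0))"

definition Linf_norm :: "'a::euclidean_space set \<Rightarrow> ('a \<Rightarrow> real) \<Rightarrow> ereal" where
  "Linf_norm \<Omega> f = esssup (lebesgue_on \<Omega>) (\<lambda>x. ereal \<bar>f x\<bar>)"

definition in_L2 :: "'a::euclidean_space set \<Rightarrow> ('a \<Rightarrow> real) \<Rightarrow> bool" where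
  "in_L2 \<Omega> f \<longleftrightarrow>
     f \<in> borel_measurable (lebesgue_on \<Omega>) \<and> integrable (lebesgue_on \<Omega>) (\<lambda>x. (f x)\<^sup>2)"

definition L2norm :: "'a::euclidean_space set \<Rightarrow> ('a \<Rightarrow> real) \<Rightarrow> real" where
  "L2norm \<Omega> f = sqrt (LINT x|lebesgue_on \<Omega>. (f x)\<^sup>2)"

definition locally_integrable :: "'a::euclidean_space set \<Rightarrow> ('a \<Rightarrow> real) \<Rightarrow> bool" where
  "locally_integrable \<Omega> f \<longleftrightarrow> (\<forall>K. compact K \<and> K \<subseteq> \<Omega> \<longrightarrow> integrable (lebesgue_on K) f)"

definition weak_deriv ::
  "'a::euclidean_space set \<Rightarrow> 'a \<Rightarrow> ('a \<Rightarrow> real) \<Rightarrow> ('a \<Rightarrow> real) \<Rightarrow> bool" where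
  "weak_deriv \<Omega> i f h \<longleftrightarrow> locally_integrable \<Omega> f \<and> locally_integrable \<Omega> h \<and>
     (\<forall>\<phi>. test_fun \<Omega> \<phi> \<longrightarrow>
        (LINT x|lebesgue_on \<Omega>. f x * pd i \<phi> x) = - (LINT x|lebesgue_on \<Omega>. h x * \<phi> x))"

text \<open>A representative of the weak partial derivative, which is unique almost everywhere.\<close>
definition wderiv :: "'a::euclidean_space set \<Rightarrow> 'a \<Rightarrow> ('a \<Rightarrow> real) \<Rightarrow> 'a \<Rightarrow> real" where
  "wderiv \<Omega> i f = (SOME h. weak_deriv \<Omega> i f h)"

definition grad_sq :: "'a::euclidean_space set \<Rightarrow> ('a \<Rightarrow> real) \<Rightarrow> 'a \<Rightarrow> real" where
  "grad_sq \<Omega> w x = (\<Sum>i\<in>Basis. (wderiv \<Omega> i w x)\<^sup>2)"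

definition laplacian :: "'a::euclidean_space set \<Rightarrow> ('a \<Rightarrow> real) \<Rightarrow> 'a \<Rightarrow> real" where
  "laplacian \<Omega> w x = (\<Sum>i\<in>Basis. wderiv \<Omega> i (wderiv \<Omega> i w) x)"

definition in_H1 :: "'a::euclidean_space set \<Rightarrow> ('a \<Rightarrow> real) \<Rightarrow> bool" where
  "in_H1 \<Omega> w \<longleftrightarrow> in_L2 \<Omega> w \<and> (\<forall>i\<in>Basis. \<exists>h. in_L2 \<Omega> h \<and> weak_deriv \<Omega> i w h)"

definition in_H2 :: "'a::euclidean_space set \<Rightarrow> ('a \<Rightarrow> real) \<Rightarrow> bool" where
  "in_H2 \<Omega> w \<longleftrightarrow> in_H1 \<Omega> w \<and> (\<forall>i\<in>Basis. in_H1 \<Omega> (wderiv \<Omega> i w))"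

definition H1norm :: "'a::euclidean_space set \<Rightarrow> ('a \<Rightarrow> real) \<Rightarrow> real" where
  "H1norm \<Omega> w = sqrt ((L2norm \<Omega> w)\<^sup>2 + (\<Sum>i\<in>Basis. (L2norm \<Omega> (wderiv \<Omega> i w))\<^sup>2))"

definition H2norm :: "'a::euclidean_space set \<Rightarrow> ('a \<Rightarrow> real) \<Rightarrow> real" where
  "H2norm \<Omega> w = sqrt ((L2norm \<Omega> w)\<^sup>2 + (\<Sum>i\<in>Basis. (H1norm \<Omega> (wderiv \<Omega> i w))\<^sup>2))"

definition in_H10 :: "'a::euclidean_space set \<Rightarrow> ('a \<Rightarrow> real) \<Rightarrow> bool" where
  "in_H10 \<Omega> w \<longleftrightarrow> in_H1 \<Omega> w \<and>
     (\<exists>\<phi>. (\<forall>n. test_fun \<Omega> (\<phi> n)) \<and> (\<lambda>n::nat. H1norm \<Omega> (\<lambda>x. \<phi> n x - w x)) \<longlonglongrightarrow> 0)"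

definition poincare_constant :: "'a::euclidean_space set \<Rightarrow> real \<Rightarrow> bool" where
  "poincare_constant \<Omega> c \<longleftrightarrow>
     (\<forall>w. in_H10 \<Omega> w \<longrightarrow> L2norm \<Omega> w \<le> c * sqrt (LINT x|lebesgue_on \<Omega>. grad_sq \<Omega> w x))"


section \<open>The coupled system and its energy\<close>

text \<open>A function \<open>u(t,x)\<close> is viewed as the curve \<open>t \<mapsto> u t\<close>, \<open>t \<ge> 0\<close>, in a function space.
  Time derivatives are strong derivatives in \<open>L\<^sup>2(\<Omega>)\<close>, one-sided at \<open>t = 0\<close>.\<close>

definition has_tderiv ::
  "'a::euclidean_space set \<Rightarrow> (real \<Rightarrow> 'a \<Rightarrow> real) \<Rightarrow> ('a \<Rightarrow> real) \<Rightarrow> real \<Rightarrow> bool" where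
  "has_tderiv \<Omega> u w t \<longleftrightarrow> in_L2 \<Omega> w \<and> (\<forall>s\<ge>0. in_L2 \<Omega> (u s)) \<and>
     ((\<lambda>s. L2norm \<Omega> (\<lambda>x. (u s x - u t x) / (s - t) - w x)) \<longlongrightarrow> 0) (at t within {0..})"

definition tderiv ::
  "'a::euclidean_space set \<Rightarrow> (real \<Rightarrow> 'a \<Rightarrow> real) \<Rightarrow> real \<Rightarrow> 'a \<Rightarrow> real" where
  "tderiv \<Omega> u t = (SOME w. has_tderiv \<Omega> u w t)"

definition tdifferentiable ::
  "'a::euclidean_space set \<Rightarrow> (real \<Rightarrow> 'a \<Rightarrow> real) \<Rightarrow> bool" where
  "tdifferentiable \<Omega> u \<longleftrightarrow> (\<forall>t\<ge>0. \<exists>w. has_tderiv \<Omega> u w t)"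

definition continuous_into_H10 ::
  "'a::euclidean_space set \<Rightarrow> (real \<Rightarrow> 'a \<Rightarrow> real) \<Rightarrow> bool" where
  "continuous_into_H10 \<Omega> u \<longleftrightarrow> (\<forall>t\<ge>0. in_H10 \<Omega> (u t) \<and>
     ((\<lambda>s. H1norm \<Omega> (\<lambda>x. u s x - u t x)) \<longlongrightarrow> 0) (at t within {0..}))"

definition continuous_into_H10_H2 ::
  "'a::euclidean_space set \<Rightarrow> (real \<Rightarrow> 'a \<Rightarrow> real) \<Rightarrow> bool" where
  "continuous_into_H10_H2 \<Omega> u \<longleftrightarrow> (\<forall>t\<ge>0. in_H10 \<Omega> (u t) \<and> in_H2 \<Omega> (u t) \<and>
     ((\<lambda>s. H2norm \<Omega> (\<lambda>x. u s x - u t x)) \<longlongrightarrow> 0) (at t within {0..}))"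

text \<open>The Dirichlet condition is contained in the membership in \<open>H\<^sup>1\<^sub>0\<close>. By the equations,
  the second time derivatives of a solution of this regularity are continuous into \<open>L\<^sup>2\<close>, so
  they exist in the strong sense used here.\<close>
definition coupled_solution ::
  "'a::euclidean_space set \<Rightarrow> (real \<Rightarrow> real) \<Rightarrow> ('a \<Rightarrow> real) \<Rightarrow> ('a \<Rightarrow> real) \<Rightarrow>
   ('a \<Rightarrow> real) \<Rightarrow> ('a \<Rightarrow> real) \<Rightarrow> ('a \<Rightarrow> real) \<Rightarrow> ('a \<Rightarrow> real) \<Rightarrow>
   (real \<Rightarrow> 'a \<Rightarrow> real) \<Rightarrow> (real \<Rightarrow> 'a \<Rightarrow> real) \<Rightarrow> bool" where
  "coupled_solution \<Omega> g a b u0 v0 u1 v1 u v \<longleftrightarrow>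
     continuous_into_H10_H2 \<Omega> u \<and> continuous_into_H10_H2 \<Omega> v \<and>
     tdifferentiable \<Omega> u \<and> tdifferentiable \<Omega> v \<and>
     continuous_into_H10 \<Omega> (tderiv \<Omega> u) \<and> continuous_into_H10 \<Omega> (tderiv \<Omega> v) \<and>
     tdifferentiable \<Omega> (tderiv \<Omega> u) \<and> tdifferentiable \<Omega> (tderiv \<Omega> v) \<and>
     (\<forall>t\<ge>0. AE x in lebesgue_on \<Omega>.
        tderiv \<Omega> (tderiv \<Omega> u) t x - laplacian \<Omega> (u t) x + b x * v t x
          + a x * g (tderiv \<Omega> u t x) = 0) \<and>
     (\<forall>t\<ge>0. AE x in lebesgue_on \<Omega>.
        tderiv \<Omega> (tderiv \<Omega> v) t x - laplacian \<Omega> (v t) x + b x * u t x = 0) \<and>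
     (AE x in lebesgue_on \<Omega>. u 0 x = u0 x) \<and> (AE x in lebesgue_on \<Omega>. tderiv \<Omega> u 0 x = u1 x) \<and>
     (AE x in lebesgue_on \<Omega>. v 0 x = v0 x) \<and> (AE x in lebesgue_on \<Omega>. tderiv \<Omega> v 0 x = v1 x)"

definition energy ::
  "'a::euclidean_space set \<Rightarrow> ('a \<Rightarrow> real) \<Rightarrow>
   (real \<Rightarrow> 'a \<Rightarrow> real) \<Rightarrow> (real \<Rightarrow> 'a \<Rightarrow> real) \<Rightarrow> real \<Rightarrow> real" where
  "energy \<Omega> b u v t =
     1/2 * (LINT x|lebesgue_on \<Omega>. grad_sq \<Omega> (u t) x + grad_sq \<Omega> (v t) x
              + (tderiv \<Omega> u t x)\<^sup>2 + (tderiv \<Omega> v t x)\<^sup>2)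
     + (LINT x|lebesgue_on \<Omega>. b x * u t x * v t x)"


section \<open>Geometric control in the interval (0,1)\<close>

text \<open>Generalized geodesics of \<open>(0,1)\<close> at speed one: straight motion inside, and reflection at
  the boundary points; every ray hits the boundary transversally, so that there is no gliding.\<close>
definition interval_geodesic :: "(real \<Rightarrow> real) \<Rightarrow> bool" where
  "interval_geodesic \<gamma> \<longleftrightarrow> (\<forall>t\<ge>0. 0 \<le> \<gamma> t \<and> \<gamma> t \<le> 1 \<and>
     (0 < \<gamma> t \<and> \<gamma> t < 1 \<longrightarrow>
        (\<exists>\<sigma>\<in>{-1, 1}. \<exists>\<epsilon>>0. \<forall>s\<ge>0. \<bar>s - t\<bar> < \<epsilon> \<longrightarrow> \<gamma> s = \<gamma> t + \<sigma> * (s - t))) \<and>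
     (\<gamma> t = 0 \<or> \<gamma> t = 1 \<longrightarrow>
        (\<exists>\<epsilon>>0. \<forall>s\<ge>0. \<bar>s - t\<bar> < \<epsilon> \<longrightarrow> \<bar>\<gamma> s - \<gamma> t\<bar> = \<bar>s - t\<bar>)))"

definition interval_GCC :: "real set \<Rightarrow> bool" where
  "interval_GCC \<omega> \<longleftrightarrow> (\<exists>T>0. \<forall>\<gamma>. interval_geodesic \<gamma> \<longrightarrow> (\<exists>t. 0 \<le> t \<and> t < T \<and> \<gamma> t \<in> \<omega>))"


section \<open>Unique continuation assumption\<close>

definition dalembert :: "(real \<times> 'a::euclidean_space \<Rightarrow> real) \<Rightarrow> real \<times> 'a \<Rightarrow> real" where
  "dalembert \<phi> z = pd (1, 0) (pd (1, 0) \<phi>) z - (\<Sum>i\<in>Basis. pd (0, i) (pd (0, i) \<phi>) z)"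

text \<open>Weak solutions of \<open>\<partial>\<^sub>t\<^sup>2w - \<Delta>w + f = 0\<close> in \<open>(0,T) \<times> \<Omega>\<close>, without boundary condition.\<close>
definition wave_distr ::
  "'a::euclidean_space set \<Rightarrow> real \<Rightarrow> (real \<times> 'a \<Rightarrow> real) \<Rightarrow> (real \<times> 'a \<Rightarrow> real) \<Rightarrow> bool" where
  "wave_distr \<Omega> T w f \<longleftrightarrow> (\<forall>\<phi>. test_fun ({0<..<T} \<times> \<Omega>) \<phi> \<longrightarrow>
     (LINT z|lebesgue_on ({0<..<T} \<times> \<Omega>). w z * dalembert \<phi> z + f z * \<phi> z) = 0)"

text \<open>The same equation together with \<open>w = 0\<close> on \<open>(0,T) \<times> \<partial>\<Omega>\<close>, for \<open>w\<close> only in \<open>L\<^sup>2\<close>: since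
  such \<open>w\<close> has no trace in the sense of Sobolev spaces, the boundary condition is understood by
  transposition, the test functions being smooth up to the lateral boundary and vanishing on it.\<close>
definition wave_dirichlet_transposition ::
  "'a::euclidean_space set \<Rightarrow> real \<Rightarrow> (real \<times> 'a \<Rightarrow> real) \<Rightarrow> (real \<times> 'a \<Rightarrow> real) \<Rightarrow> bool" where
  "wave_dirichlet_transposition \<Omega> T w f \<longleftrightarrow>
     (\<forall>\<phi>. test_fun ({0<..<T} \<times> UNIV) \<phi> \<and> (\<forall>t. \<forall>x\<in>frontier \<Omega>. \<phi> (t, x) = 0) \<longrightarrow>
       (LINT z|lebesgue_on ({0<..<T} \<times> \<Omega>). w z * dalembert \<phi> z + f z * \<phi> z) = 0)"

text \<open>For \<open>u1\<close> in \<open>H\<^sup>1((0,T) \<times> \<Omega>)\<close>, vanishing of the lateral trace is expressed by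
  \<open>u1(t,\<cdot>) \<in> H\<^sup>1\<^sub>0(\<Omega>)\<close> for almost every \<open>t\<close>.\<close>
definition unique_continuation ::
  "'a::euclidean_space set \<Rightarrow> ('a \<Rightarrow> real) \<Rightarrow> ('a \<Rightarrow> real) \<Rightarrow> bool" where
  "unique_continuation \<Omega> a b \<longleftrightarrow> (\<exists>T>0. \<forall>u1 u2.
     in_H1 ({0<..<T} \<times> \<Omega>) u1 \<and> in_L2 ({0<..<T} \<times> \<Omega>) u2 \<and>
     wave_distr \<Omega> T u1 (\<lambda>(t, x). b x * u2 (t, x)) \<and>
     (AE t in lebesgue_on {0<..<T}. in_H10 \<Omega> (\<lambda>x. u1 (t, x))) \<and>
     wave_dirichlet_transposition \<Omega> T u2 (\<lambda>(t, x). b x * u1 (t, x)) \<and>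
     (AE (t, x) in lebesgue_on ({0<..<T} \<times> \<Omega>). a x * u1 (t, x) = 0)
     \<longrightarrow> (AE z in lebesgue_on ({0<..<T} \<times> \<Omega>). u1 z = 0 \<and> u2 z = 0))"


section \<open>The damping profile\<close>

text \<open>This is the function written \<open>h\<^sup>-\<^sup>1\<close> in the literature.\<close>
definition hinv :: "(real \<Rightarrow> real) \<Rightarrow> real \<Rightarrow> real" where
  "hinv g s = g (sqrt s) * sqrt s"

definition strictly_convex_on :: "real set \<Rightarrow> (real \<Rightarrow> real) \<Rightarrow> bool" where
  "strictly_convex_on S f \<longleftrightarrow> convex S \<and> (\<forall>x\<in>S. \<forall>y\<in>S. \<forall>\<theta>. x \<noteq> y \<and> 0 < \<theta> \<and> \<theta> < 1 \<longrightarrow>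
     f ((1 - \<theta>) * x + \<theta> * y) < (1 - \<theta>) * f x + \<theta> * f y)"

text \<open>Here \<open>k\<close> plays the role of \<open>h\<^sup>-\<^sup>1\<close> and \<open>d1\<close>, \<open>d2\<close>, \<open>d3\<close> are its successive derivatives,
  which are determined on \<open>(0,r0]\<close> and one-sided at \<open>r0\<close>.\<close>
definition profile_assumption :: "(real \<Rightarrow> real) \<Rightarrow> bool" where
  "profile_assumption k \<longleftrightarrow> (\<exists>r0 d1 d2 d3. 0 < r0 \<and> r0 \<le> 1 \<and>
     (\<forall>s\<in>{0<..r0}. (k has_real_derivative d1 s) (at s within {0<..r0}) \<and>
        (d1 has_real_derivative d2 s) (at s within {0<..r0}) \<and>
        (d2 has_real_derivative d3 s) (at s within {0<..r0})) \<and>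
     continuous_on {0<..r0} d3 \<and>
     strictly_convex_on {0<..r0} k \<and>
     (k \<longlongrightarrow> 0) (at_right 0) \<and> (d1 \<longlongrightarrow> 0) (at_right 0) \<and>
     ((\<lambda>s. s * d2 s) \<longlongrightarrow> 0) (at_right 0) \<and> ((\<lambda>s. s\<^sup>2 * d3 s) \<longlongrightarrow> 0) (at_right 0) \<and>
     (\<exists>\<beta> \<alpha>0. \<beta> > 1 \<and> \<alpha>0 \<ge> 0 \<and>
        ((\<lambda>s. s * d1 (1 / s powr \<beta>)) \<longlongrightarrow> \<alpha>0) at_top \<and>
        (\<forall>s\<in>{0<..r0}. d1 s \<le> \<beta> * s * d2 s \<and>
           (\<beta>\<^sup>2 - \<beta>) * s * d2 s + \<beta>\<^sup>2 * s\<^sup>2 * d3 s \<ge> 0) \<and>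
        ((\<forall>s\<in>{0<..r0}. \<beta> * s * d2 s - d1 s > 0) \<longrightarrow>
           (\<exists>\<alpha>1>0. \<forall>s\<in>{0<..r0}.
              d1 s * ((\<beta>\<^sup>2 - \<beta>) * s * d2 s + \<beta>\<^sup>2 * s\<^sup>2 * d3 s) / (\<beta> * s * d2 s - d1 s) \<le> \<alpha>1))))"

text \<open>Solutions on \<open>[0,\<infinity>)\<close> of \<open>\<psi>' + A \<psi> k'(\<psi>) = 0\<close>, where \<open>k\<close> is considered on \<open>[0,\<infinity>)\<close> and has
  to be differentiable at the values taken by \<open>\<psi>\<close>.\<close>
definition comparison_solution :: "real \<Rightarrow> (real \<Rightarrow> real) \<Rightarrow> (real \<Rightarrow> real) \<Rightarrow> bool" where
  "comparison_solution A k \<psi> \<longleftrightarrow> (\<forall>t\<ge>0. \<psi> t \<ge> 0 \<and>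
     (\<exists>d. (k has_real_derivative d) (at (\<psi> t) within {0..}) \<and>
          (\<psi> has_real_derivative - (A * \<psi> t * d)) (at t within {0..})))"

end

theory Submission
  imports Defs
begin

text \<open>
  Write \<open>E\<close> for the energy, \<open>p\<close> and \<open>q\<close> for the velocities, \<open>E1\<close> for the initial energy of
  \<open>(p,q)\<close>, \<open>k = hinv g\<close> and \<open>A = \<parallel>a\<parallel>\<close>. The energy is dissipated at the rate
  \<open>\<integral> a g(p) p = \<integral> a k(p\<^sup>2)\<close> (lemma \<open>energy_deriv\<close>). In one space dimension the velocity is bounded
  pointwise, \<open>p\<^sup>2 \<le> \<parallel>p\<parallel> \<parallel>D p\<parallel>\<close>, where \<open>\<parallel>p\<parallel>\<close> is controlled by \<open>E\<close> and \<open>\<parallel>D p\<parallel>\<close> by the energy of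
  \<open>(p,q)\<close>. If this gives \<open>p\<^sup>2 \<le> \<phi>\<close> with \<open>\<phi> = 4 sqrt (E1 E)\<close>, then convexity of \<open>k\<close> yields
  \<open>k(p\<^sup>2) \<le> p\<^sup>2 k'(\<phi>)\<close>, hence \<open>E' \<ge> - 2 A E k'(\<phi>)\<close>, that is, \<open>\<phi>' \<ge> - A \<phi> k'(\<phi>)\<close>: the function
  \<open>\<phi>\<close> is a supersolution of the equation for \<open>\<psi>\<close>, and \<open>\<psi> \<le> \<phi>\<close> is the claim.

  This requires \<open>\<phi>\<close> to be so small that it lies where \<open>k\<close> is convex and that the coupling term in the
  energy of \<open>(p,q)\<close> is negligible. The energy is nonincreasing, so there are two cases. If it tends to
  zero, then \<open>\<phi>\<close> is eventually small (\<open>comparison_decaying\<close>). Otherwise \<open>\<phi>\<close> stays above some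
  \<open>c > 0\<close>, whereas, if \<open>A > 0\<close>, a solution \<open>\<psi>\<close> decreases at a rate bounded away from zero as long as
  \<open>\<psi> \<ge> c\<close>; so \<open>\<psi> \<le> c \<le> \<phi>\<close> after a time that can be chosen uniformly in \<open>\<psi>\<close>
  (\<open>comparison_not_decaying\<close>).

  The analytic core is that the energy of \<open>(p,q)\<close> does not exceed \<open>E1\<close>
  (\<open>velocity_energy_le_initial\<close>). As \<open>(p,q)\<close> is not regular enough for the energy identity, the
  identity is applied to the difference quotients \<open>(u(t+h) - u(t)) / h\<close>, whose energy is
  nonincreasing because \<open>g\<close> is monotone, and \<open>h\<close> tends to zero. The gradients of the difference
  quotients converge by a mean value argument in duality (\<open>dquot_gradient_bound\<close>).
\<close>

section \<open>The inner product of \<open>L\<^sup>2\<close>\<close>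

definition ip :: "'a::euclidean_space set \<Rightarrow> ('a \<Rightarrow> real) \<Rightarrow> ('a \<Rightarrow> real) \<Rightarrow> real" where
  "ip \<Omega> f g = (LINT x|lebesgue_on \<Omega>. f x * g x)"

lemma in_L2_measurable: "in_L2 \<Omega> f \<Longrightarrow> f \<in> borel_measurable (lebesgue_on \<Omega>)"
  by (simp add: in_L2_def)

lemma in_L2_mult_integrable:
  assumes "in_L2 \<Omega> f" "in_L2 \<Omega> g"
  shows "integrable (lebesgue_on \<Omega>) (\<lambda>x. f x * g x)"
proof (rule Bochner_Integration.integrable_bound)
  show "integrable (lebesgue_on \<Omega>) (\<lambda>x. (f x)\<^sup>2 + (g x)\<^sup>2)"
    using assms by (auto simp: in_L2_def)
  show "(\<lambda>x. f x * g x) \<in> borel_measurable (lebesgue_on \<Omega>)"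
    using assms by (auto simp: in_L2_def)
  have "\<bar>p * q\<bar> \<le> p\<^sup>2 + q\<^sup>2" for p q :: real
  proof -
    have "2 * \<bar>p\<bar> * \<bar>q\<bar> \<le> p\<^sup>2 + q\<^sup>2"
      using sum_squares_bound[of "\<bar>p\<bar>" "\<bar>q\<bar>"] by simp
    moreover have "0 \<le> \<bar>p\<bar> * \<bar>q\<bar>" by simp
    ultimately show ?thesis unfolding abs_mult by linarith
  qed
  then show "AE x in lebesgue_on \<Omega>. norm (f x * g x) \<le> norm ((f x)\<^sup>2 + (g x)\<^sup>2)"
    by (auto simp: abs_mult)
qed

lemma in_L2_add:
  assumes "in_L2 \<Omega> f" "in_L2 \<Omega> g"
  shows "in_L2 \<Omega> (\<lambda>x. f x + g x)"
proof -
  have "integrable (lebesgue_on \<Omega>) (\<lambda>x. (f x)\<^sup>2 + (g x)\<^sup>2 + 2 * (f x * g x))"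
    using assms in_L2_mult_integrable[OF assms] by (auto simp: in_L2_def)
  then show ?thesis
    using assms by (auto simp: in_L2_def power2_sum algebra_simps)
qed

lemma in_L2_scale: "in_L2 \<Omega> f \<Longrightarrow> in_L2 \<Omega> (\<lambda>x. c * f x)"
  by (auto simp: in_L2_def power_mult_distrib)

lemma in_L2_divide: "in_L2 \<Omega> f \<Longrightarrow> in_L2 \<Omega> (\<lambda>x. f x / c)"
  using in_L2_scale[of \<Omega> f "1 / c"] by simp

lemma in_L2_uminus: "in_L2 \<Omega> f \<Longrightarrow> in_L2 \<Omega> (\<lambda>x. - f x)"
  using in_L2_scale[of \<Omega> f "-1"] by simp

lemma in_L2_diff: "in_L2 \<Omega> f \<Longrightarrow> in_L2 \<Omega> g \<Longrightarrow> in_L2 \<Omega> (\<lambda>x. f x - g x)"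
  using in_L2_add[of \<Omega> f "\<lambda>x. - g x"] in_L2_uminus[of \<Omega> g] by simp

lemma in_L2_zero: "in_L2 \<Omega> (\<lambda>x. 0)"
  by (simp add: in_L2_def)

lemmas in_L2_intros = in_L2_add in_L2_scale in_L2_divide in_L2_uminus in_L2_diff in_L2_zero

lemma in_L2_cong_AE:
  assumes "in_L2 \<Omega> f" "g \<in> borel_measurable (lebesgue_on \<Omega>)"
    and "AE x in lebesgue_on \<Omega>. f x = g x"
  shows "in_L2 \<Omega> g"
proof -
  have "integrable (lebesgue_on \<Omega>) (\<lambda>x. (f x)\<^sup>2) = integrable (lebesgue_on \<Omega>) (\<lambda>x. (g x)\<^sup>2)"
    using assms by (intro integrable_cong_AE) (auto simp: in_L2_def)
  then show ?thesis using assms by (simp add: in_L2_def)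
qed

lemma ip_cong_AE:
  assumes "in_L2 \<Omega> f" "in_L2 \<Omega> g" "in_L2 \<Omega> f'" "in_L2 \<Omega> g'"
    and "AE x in lebesgue_on \<Omega>. f x = f' x" "AE x in lebesgue_on \<Omega>. g x = g' x"
  shows "ip \<Omega> f g = ip \<Omega> f' g'"
  unfolding ip_def using assms by (intro integral_cong_AE) (auto simp: in_L2_def)

lemma L2norm_cong_AE:
  assumes "in_L2 \<Omega> f" "in_L2 \<Omega> g" "AE x in lebesgue_on \<Omega>. f x = g x"
  shows "L2norm \<Omega> f = L2norm \<Omega> g"
  using ip_cong_AE[of \<Omega> f f g g] assms by (simp add: L2norm_def ip_def power2_eq_square)

lemma ip_commute: "ip \<Omega> f g = ip \<Omega> g f"
  by (simp add: ip_def mult.commute)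

lemma ip_add_left:
  "in_L2 \<Omega> f \<Longrightarrow> in_L2 \<Omega> g \<Longrightarrow> in_L2 \<Omega> h \<Longrightarrow> ip \<Omega> (\<lambda>x. f x + g x) h = ip \<Omega> f h + ip \<Omega> g h"
  by (simp add: ip_def distrib_right in_L2_mult_integrable)

lemma ip_diff_left:
  "in_L2 \<Omega> f \<Longrightarrow> in_L2 \<Omega> g \<Longrightarrow> in_L2 \<Omega> h \<Longrightarrow> ip \<Omega> (\<lambda>x. f x - g x) h = ip \<Omega> f h - ip \<Omega> g h"
  by (simp add: ip_def left_diff_distrib in_L2_mult_integrable)

lemma ip_scale_left: "ip \<Omega> (\<lambda>x. c * f x) h = c * ip \<Omega> f h"
  by (simp add: ip_def mult.assoc)

lemma ip_divide_left: "ip \<Omega> (\<lambda>x. f x / c) h = ip \<Omega> f h / c"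
  using ip_scale_left[of \<Omega> "1/c" f h] by simp

lemma ip_uminus_left: "ip \<Omega> (\<lambda>x. - f x) h = - ip \<Omega> f h"
  using ip_scale_left[of \<Omega> "-1" f h] by simp

lemmas ip_left = ip_add_left ip_diff_left ip_scale_left ip_divide_left ip_uminus_left

lemma ip_add_right:
  "in_L2 \<Omega> f \<Longrightarrow> in_L2 \<Omega> g \<Longrightarrow> in_L2 \<Omega> h \<Longrightarrow> ip \<Omega> h (\<lambda>x. f x + g x) = ip \<Omega> h f + ip \<Omega> h g"
  by (simp add: ip_commute[of _ h] ip_left)

lemma ip_diff_right:
  "in_L2 \<Omega> f \<Longrightarrow> in_L2 \<Omega> g \<Longrightarrow> in_L2 \<Omega> h \<Longrightarrow> ip \<Omega> h (\<lambda>x. f x - g x) = ip \<Omega> h f - ip \<Omega> h g"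
  by (simp add: ip_commute[of _ h] ip_left)

lemma ip_scale_right: "ip \<Omega> h (\<lambda>x. c * f x) = c * ip \<Omega> h f"
  by (simp add: ip_commute[of _ h] ip_left)

lemma ip_divide_right: "ip \<Omega> h (\<lambda>x. f x / c) = ip \<Omega> h f / c"
  by (simp add: ip_commute[of _ h] ip_left)

lemma ip_uminus_right: "ip \<Omega> h (\<lambda>x. - f x) = - ip \<Omega> h f"
  by (simp add: ip_commute[of _ h] ip_left)

lemmas ip_right = ip_add_right ip_diff_right ip_scale_right ip_divide_right ip_uminus_right

lemma ip_self_nonneg: "0 \<le> ip \<Omega> f f"
  by (simp add: ip_def)

lemma L2norm_sq: "(L2norm \<Omega> f)\<^sup>2 = ip \<Omega> f f"
  by (simp add: L2norm_def ip_def power2_eq_square[symmetric])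

lemma L2norm_nonneg: "0 \<le> L2norm \<Omega> f"
  by (simp add: L2norm_def)

lemma L2norm_zero: "L2norm \<Omega> (\<lambda>x. 0) = 0"
  by (simp add: L2norm_def)

lemma L2norm_scale: "L2norm \<Omega> (\<lambda>x. c * f x) = \<bar>c\<bar> * L2norm \<Omega> f"
  by (simp add: L2norm_def power_mult_distrib real_sqrt_mult)

lemma L2norm_divide: "L2norm \<Omega> (\<lambda>x. f x / c) = L2norm \<Omega> f / \<bar>c\<bar>"
  using L2norm_scale[of \<Omega> "1/c" f] by simp

lemma L2norm_minus_commute: "L2norm \<Omega> (\<lambda>x. f x - g x) = L2norm \<Omega> (\<lambda>x. g x - f x)"
  by (simp add: L2norm_def power2_commute)

text \<open>The discriminant of the nonnegative polynomial \<open>s \<mapsto> \<parallel>f - s g\<parallel>\<^sup>2\<close> is not positive; if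
  \<open>\<parallel>g\<parallel> = 0\<close> this polynomial is affine and has to be constant.\<close>

lemma ip_Cauchy_Schwarz:
  assumes f: "in_L2 \<Omega> f" and g: "in_L2 \<Omega> g"
  shows "\<bar>ip \<Omega> f g\<bar> \<le> L2norm \<Omega> f * L2norm \<Omega> g"
proof -
  have pos: "0 \<le> ip \<Omega> f f - 2 * s * ip \<Omega> f g + s\<^sup>2 * ip \<Omega> g g" for s
  proof -
    have "ip \<Omega> (\<lambda>x. f x - s * g x) (\<lambda>x. f x - s * g x)
        = ip \<Omega> f f - 2 * s * ip \<Omega> f g + s\<^sup>2 * ip \<Omega> g g"
      using f g by (simp add: ip_left ip_right in_L2_intros ip_commute[of _ g f] algebra_simps
          power2_eq_square)
    then show ?thesis using ip_self_nonneg by metis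
  qed
  have "(ip \<Omega> f g)\<^sup>2 \<le> ip \<Omega> f f * ip \<Omega> g g"
  proof (cases "ip \<Omega> g g = 0")
    case True
    have "ip \<Omega> f g = 0"
    proof (rule ccontr)
      assume ne: "ip \<Omega> f g \<noteq> 0"
      show False
        using pos[of "(ip \<Omega> f f + 1) / (2 * ip \<Omega> f g)"] True ne by (simp add: field_simps)
    qed
    then show ?thesis using True by simp
  next
    case False
    then have g0: "ip \<Omega> g g > 0" using ip_self_nonneg[of \<Omega> g] by simp
    have "0 \<le> ip \<Omega> f f - (ip \<Omega> f g)\<^sup>2 / ip \<Omega> g g"
      using pos[of "ip \<Omega> f g / ip \<Omega> g g"] g0 by (simp add: power2_eq_square field_simps)
    then show ?thesis using g0 by (simp add: field_simps)
  qed
  then have "\<bar>ip \<Omega> f g\<bar>\<^sup>2 \<le> (L2norm \<Omega> f * L2norm \<Omega> g)\<^sup>2"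
    by (simp add: power_mult_distrib L2norm_sq)
  then show ?thesis
    by (rule power2_le_imp_le) (simp add: L2norm_nonneg)
qed

lemma L2norm_triangle:
  assumes f: "in_L2 \<Omega> f" and g: "in_L2 \<Omega> g"
  shows "L2norm \<Omega> (\<lambda>x. f x + g x) \<le> L2norm \<Omega> f + L2norm \<Omega> g"
proof (rule power2_le_imp_le)
  have "(L2norm \<Omega> (\<lambda>x. f x + g x))\<^sup>2 = ip \<Omega> f f + 2 * ip \<Omega> f g + ip \<Omega> g g"
    unfolding L2norm_sq using f g
    by (simp add: ip_left ip_right in_L2_intros ip_commute[of _ g f])
  also have "\<dots> \<le> ip \<Omega> f f + 2 * (L2norm \<Omega> f * L2norm \<Omega> g) + ip \<Omega> g g"
    using ip_Cauchy_Schwarz[OF f g] by simp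
  also have "\<dots> = (L2norm \<Omega> f + L2norm \<Omega> g)\<^sup>2"
    by (simp add: power2_sum L2norm_sq)
  finally show "(L2norm \<Omega> (\<lambda>x. f x + g x))\<^sup>2 \<le> (L2norm \<Omega> f + L2norm \<Omega> g)\<^sup>2" .
qed (simp add: L2norm_nonneg)

lemma L2norm_triangle_diff:
  assumes "in_L2 \<Omega> f" "in_L2 \<Omega> g" "in_L2 \<Omega> h"
  shows "L2norm \<Omega> (\<lambda>x. f x - h x) \<le> L2norm \<Omega> (\<lambda>x. f x - g x) + L2norm \<Omega> (\<lambda>x. g x - h x)"
  using L2norm_triangle[of \<Omega> "\<lambda>x. f x - g x" "\<lambda>x. g x - h x"] assms
  by (simp add: in_L2_intros)

lemma L2norm_diff_lower:
  assumes "in_L2 \<Omega> f" "in_L2 \<Omega> g"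
  shows "\<bar>L2norm \<Omega> f - L2norm \<Omega> g\<bar> \<le> L2norm \<Omega> (\<lambda>x. f x - g x)"
  using L2norm_triangle_diff[of \<Omega> f g "\<lambda>x. 0"] L2norm_triangle_diff[of \<Omega> g f "\<lambda>x. 0"] assms
  by (simp add: in_L2_intros L2norm_minus_commute[of \<Omega> g f])

lemma L2norm_eq_0_AE:
  assumes f: "in_L2 \<Omega> f" and "L2norm \<Omega> f = 0"
  shows "AE x in lebesgue_on \<Omega>. f x = 0"
proof -
  have "(LINT x|lebesgue_on \<Omega>. (f x)\<^sup>2) = 0"
    using assms by (simp add: L2norm_def)
  then have "AE x in lebesgue_on \<Omega>. (f x)\<^sup>2 = 0"
    using f integral_nonneg_eq_0_iff_AE[of "lebesgue_on \<Omega>" "\<lambda>x. (f x)\<^sup>2"] by (simp add: in_L2_def)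
  then show ?thesis by simp
qed

lemma L2norm_mono_AE:
  assumes g: "in_L2 \<Omega> g" and f: "f \<in> borel_measurable (lebesgue_on \<Omega>)"
    and le: "AE x in lebesgue_on \<Omega>. \<bar>f x\<bar> \<le> \<bar>g x\<bar>"
  shows "in_L2 \<Omega> f" "L2norm \<Omega> f \<le> L2norm \<Omega> g"
proof -
  have sq: "AE x in lebesgue_on \<Omega>. (f x)\<^sup>2 \<le> (g x)\<^sup>2"
    using le by eventually_elim (simp add: abs_le_square_iff)
  have "integrable (lebesgue_on \<Omega>) (\<lambda>x. (f x)\<^sup>2)"
  proof (rule Bochner_Integration.integrable_bound)
    show "integrable (lebesgue_on \<Omega>) (\<lambda>x. (g x)\<^sup>2)" using g by (simp add: in_L2_def)
    show "(\<lambda>x. (f x)\<^sup>2) \<in> borel_measurable (lebesgue_on \<Omega>)" using f by simp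
    show "AE x in lebesgue_on \<Omega>. norm ((f x)\<^sup>2) \<le> norm ((g x)\<^sup>2)"
      using sq by eventually_elim simp
  qed
  then show L: "in_L2 \<Omega> f" using f by (simp add: in_L2_def)
  show "L2norm \<Omega> f \<le> L2norm \<Omega> g"
    unfolding L2norm_def
  proof (rule real_sqrt_le_mono, rule integral_mono_AE)
    show "integrable (lebesgue_on \<Omega>) (\<lambda>x. (f x)\<^sup>2)" using L by (simp add: in_L2_def)
    show "integrable (lebesgue_on \<Omega>) (\<lambda>x. (g x)\<^sup>2)" using g by (simp add: in_L2_def)
  qed (rule sq)
qed

lemma L2norm_bounded_mult:
  assumes f: "in_L2 \<Omega> f" and b: "b \<in> borel_measurable (lebesgue_on \<Omega>)"
    and bB: "AE x in lebesgue_on \<Omega>. \<bar>b x\<bar> \<le> B" and B: "0 \<le> B"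
  shows "in_L2 \<Omega> (\<lambda>x. b x * f x)" "L2norm \<Omega> (\<lambda>x. b x * f x) \<le> B * L2norm \<Omega> f"
proof -
  have m: "(\<lambda>x. b x * f x) \<in> borel_measurable (lebesgue_on \<Omega>)"
    using f b by (auto simp: in_L2_def)
  have "AE x in lebesgue_on \<Omega>. \<bar>b x * f x\<bar> \<le> \<bar>B * f x\<bar>"
    using bB by eventually_elim (use B in \<open>simp add: abs_mult mult_right_mono\<close>)
  note 1 = L2norm_mono_AE[OF in_L2_scale[OF f] m this]
  show "in_L2 \<Omega> (\<lambda>x. b x * f x)" by (rule 1(1))
  show "L2norm \<Omega> (\<lambda>x. b x * f x) \<le> B * L2norm \<Omega> f"
    using 1(2) B by (simp add: L2norm_scale)
qed

lemma ip_tendsto: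
  assumes FG: "\<forall>\<^sub>F s in N. in_L2 \<Omega> (F s)" "\<forall>\<^sub>F s in N. in_L2 \<Omega> (G s)"
    and fg: "in_L2 \<Omega> f" "in_L2 \<Omega> g"
    and limF: "((\<lambda>s. L2norm \<Omega> (\<lambda>x. F s x - f x)) \<longlongrightarrow> 0) N"
    and limG: "((\<lambda>s. L2norm \<Omega> (\<lambda>x. G s x - g x)) \<longlongrightarrow> 0) N"
  shows "((\<lambda>s. ip \<Omega> (F s) (G s)) \<longlongrightarrow> ip \<Omega> f g) N"
proof -
  define e where "e = (\<lambda>s. L2norm \<Omega> (\<lambda>x. F s x - f x) * L2norm \<Omega> (\<lambda>x. G s x - g x)
       + L2norm \<Omega> f * L2norm \<Omega> (\<lambda>x. G s x - g x) + L2norm \<Omega> (\<lambda>x. F s x - f x) * L2norm \<Omega> g)"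
  have bound: "norm (ip \<Omega> (F s) (G s) - ip \<Omega> f g) \<le> e s" if F: "in_L2 \<Omega> (F s)" and G: "in_L2 \<Omega> (G s)" for s
  proof -
    have "ip \<Omega> (F s) (G s) - ip \<Omega> f g
        = ip \<Omega> (\<lambda>x. F s x - f x) (\<lambda>x. G s x - g x) + ip \<Omega> f (\<lambda>x. G s x - g x)
          + ip \<Omega> (\<lambda>x. F s x - f x) g"
      using F G fg by (simp add: ip_left ip_right in_L2_intros)
    moreover have "\<bar>ip \<Omega> (\<lambda>x. F s x - f x) (\<lambda>x. G s x - g x)\<bar>
        \<le> L2norm \<Omega> (\<lambda>x. F s x - f x) * L2norm \<Omega> (\<lambda>x. G s x - g x)"
      using F G fg by (intro ip_Cauchy_Schwarz in_L2_intros) auto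
    moreover have "\<bar>ip \<Omega> f (\<lambda>x. G s x - g x)\<bar> \<le> L2norm \<Omega> f * L2norm \<Omega> (\<lambda>x. G s x - g x)"
      using F G fg by (intro ip_Cauchy_Schwarz in_L2_intros) auto
    moreover have "\<bar>ip \<Omega> (\<lambda>x. F s x - f x) g\<bar> \<le> L2norm \<Omega> (\<lambda>x. F s x - f x) * L2norm \<Omega> g"
      using F G fg by (intro ip_Cauchy_Schwarz in_L2_intros) auto
    ultimately show ?thesis by (simp add: e_def)
  qed
  have "(e \<longlongrightarrow> 0 * 0 + L2norm \<Omega> f * 0 + 0 * L2norm \<Omega> g) N"
    unfolding e_def by (intro tendsto_intros limF limG)
  then have "(e \<longlongrightarrow> 0) N" by simp
  then have "((\<lambda>s. ip \<Omega> (F s) (G s) - ip \<Omega> f g) \<longlongrightarrow> 0) N"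
  proof (rule Lim_null_comparison[rotated])
    show "\<forall>\<^sub>F s in N. norm (ip \<Omega> (F s) (G s) - ip \<Omega> f g) \<le> e s"
      using FG by eventually_elim (rule bound)
  qed
  then show ?thesis by (simp add: LIM_zero_iff)
qed

section \<open>Smooth functions of one variable\<close>

lemma pd_eqI: "(f has_real_derivative d) (at x) \<Longrightarrow> pd 1 f x = d"
  unfolding pd_def has_field_derivative_def
  by (drule frechet_derivative_at) (metis mult.right_neutral)

lemma Ck_on_SucI:
  assumes "\<And>x::real. (f has_real_derivative f' x) (at x)" "Ck_on k UNIV f'"
  shows "Ck_on (Suc k) UNIV f"
proof -
  have "pd 1 f = f'" using pd_eqI assms(1) by blast
  moreover have "f differentiable_on UNIV"
    using assms(1) by (auto simp: differentiable_on_def has_field_derivative_def differentiable_def)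
  ultimately show ?thesis using assms(2) by simp
qed

lemma Ck_on_SucD:
  fixes f :: "real \<Rightarrow> real"
  assumes "Ck_on (Suc k) UNIV f"
  shows "(f has_real_derivative pd 1 f x) (at x)" "Ck_on k UNIV (pd 1 f)"
proof -
  have "f differentiable (at x)"
    using assms by (auto simp: differentiable_on_def)
  then obtain d where "(f has_real_derivative d) (at x)"
    using real_differentiable_def by blast
  then show "(f has_real_derivative pd 1 f x) (at x)" using pd_eqI by blast
  show "Ck_on k UNIV (pd 1 f)" using assms by simp
qed

lemma Ck_on_Suc_imp: "Ck_on (Suc k) UNIV f \<Longrightarrow> Ck_on k UNIV (f :: real \<Rightarrow> real)"
proof (induction k arbitrary: f)
  case 0
  then show ?case by (simp add: differentiable_imp_continuous_on)
next
  case (Suc k)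
  show ?case
    by (rule Ck_on_SucI[OF Ck_on_SucD(1)[OF Suc.prems] Suc.IH[OF Ck_on_SucD(2)[OF Suc.prems]]])
qed

lemma Ck_on_add:
  "Ck_on k UNIV f \<Longrightarrow> Ck_on k UNIV g \<Longrightarrow> Ck_on k UNIV (\<lambda>x::real. f x + g x)"
proof (induction k arbitrary: f g)
  case 0
  then show ?case by (simp add: continuous_on_add)
next
  case (Suc k)
  have "Ck_on k UNIV (\<lambda>x. pd 1 f x + pd 1 g x)"
    by (rule Suc.IH[OF Suc.prems[THEN Ck_on_SucD(2)]])
  moreover have "((\<lambda>x. f x + g x) has_real_derivative pd 1 f x + pd 1 g x) (at x)" for x
    by (rule DERIV_add[OF Suc.prems[THEN Ck_on_SucD(1)]])
  ultimately show ?case by (rule Ck_on_SucI[rotated])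
qed

lemma Ck_on_mult:
  "Ck_on k UNIV f \<Longrightarrow> Ck_on k UNIV g \<Longrightarrow> Ck_on k UNIV (\<lambda>x::real. f x * g x)"
proof (induction k arbitrary: f g)
  case 0
  then show ?case by (simp add: continuous_on_mult)
next
  case (Suc k)
  have "Ck_on k UNIV (\<lambda>x. pd 1 f x * g x + f x * pd 1 g x)"
    using Suc.prems[THEN Ck_on_SucD(2)] Suc.prems[THEN Ck_on_Suc_imp]
    by (intro Ck_on_add Suc.IH)
  moreover have "((\<lambda>x. f x * g x) has_real_derivative pd 1 f x * g x + f x * pd 1 g x) (at x)" for x
    using DERIV_mult[OF Ck_on_SucD(1)[OF Suc.prems(1)] Ck_on_SucD(1)[OF Suc.prems(2)], of x]
    by (simp add: mult.commute)
  ultimately show ?case by (rule Ck_on_SucI[rotated])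
qed

lemma Ck_on_const: "Ck_on k UNIV (\<lambda>x::real. c)"
proof (induction k arbitrary: c)
  case (Suc k)
  show ?case by (rule Ck_on_SucI[where f' = "\<lambda>x. 0"]) (use Suc in auto)
qed simp

lemma Ck_on_affine: "Ck_on k UNIV f \<Longrightarrow> Ck_on k UNIV (\<lambda>x::real. f (c * x + d))"
proof (induction k arbitrary: f)
  case 0
  then show ?case by (auto intro!: continuous_intros continuous_on_compose2[of UNIV f])
next
  case (Suc k)
  have "Ck_on k UNIV (\<lambda>x. c * pd 1 f (c * x + d))"
    by (intro Ck_on_mult Ck_on_const Suc.IH Ck_on_SucD(2) Suc.prems)
  moreover have "((\<lambda>x. f (c * x + d)) has_real_derivative c * pd 1 f (c * x + d)) (at x)" for x
  proof -
    have "((\<lambda>x. c * x + d) has_real_derivative c) (at x)"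
      by (auto intro!: derivative_eq_intros)
    from DERIV_chain2[OF Ck_on_SucD(1)[OF Suc.prems] this] show ?thesis
      by (simp add: mult.commute)
  qed
  ultimately show ?case by (rule Ck_on_SucI[rotated])
qed

text \<open>The factor \<open>x\<^bsup>-k\<^esup>\<close> makes this family closed, up to linear combinations, under
  differentiation.\<close>

definition flat_exp :: "nat \<Rightarrow> real \<Rightarrow> real" where
  "flat_exp k x = (if 0 < x then (1 / x) ^ k * exp (- (1 / x)) else 0)"

lemma flat_exp_tendsto_0: "(flat_exp k \<longlongrightarrow> 0) (at 0)"
proof -
  have "((\<lambda>x. (inverse x) ^ k / exp (inverse x)) \<longlongrightarrow> (0::real)) (at_right 0)"
    by (rule filterlim_compose[OF tendsto_power_div_exp_0 filterlim_inverse_at_top_right])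
  then have "(flat_exp k \<longlongrightarrow> 0) (at_right 0)"
    by (rule Lim_transform_eventually)
      (auto simp: eventually_at_filter flat_exp_def exp_minus field_simps)
  moreover have "(flat_exp k \<longlongrightarrow> 0) (at_left 0)"
    by (rule Lim_transform_eventually[OF tendsto_const])
      (auto simp: eventually_at_filter flat_exp_def)
  ultimately show ?thesis by (simp add: filterlim_split_at)
qed

lemma flat_exp_deriv:
  "(flat_exp k has_real_derivative flat_exp (k + 2) x + - real k * flat_exp (k + 1) x) (at x)"
proof -
  consider "x < 0" | "x = 0" | "0 < x" by linarith
  then show ?thesis
  proof cases
    case 1
    have "(flat_exp k has_real_derivative 0) (at x)"
      by (rule has_field_derivative_transform_within_open[where f = "\<lambda>x. 0" and S = "{..<0}"])
        (use 1 in \<open>auto simp: flat_exp_def\<close>)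
    then show ?thesis using 1 by (simp add: flat_exp_def)
  next
    case 2
    have "(\<lambda>h. (flat_exp k (0 + h) - flat_exp k 0) / h) = flat_exp (k + 1)"
      by (auto simp: flat_exp_def fun_eq_iff)
    then have "(flat_exp k has_real_derivative 0) (at 0)"
      using flat_exp_tendsto_0[of "k + 1"] by (simp add: DERIV_def)
    then show ?thesis using 2 by (simp add: flat_exp_def)
  next
    case 3
    have "((\<lambda>x. (1 / x) ^ k * exp (- (1 / x))) has_real_derivative
        flat_exp (k + 2) x + - real k * flat_exp (k + 1) x) (at x)"
    proof -
      have inv: "((\<lambda>x. 1 / x) has_real_derivative (- ((1 / x) ^ 2))) (at x)"
        using 3 by (auto intro!: derivative_eq_intros simp: power2_eq_square)
      have "((\<lambda>x. (1 / x) ^ k * exp (- (1 / x))) has_real_derivative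
          real k * ((1 / x) ^ (k - 1) * (- ((1 / x) ^ 2))) * exp (- (1 / x))
          + exp (- (1 / x)) * (1 / x) ^ 2 * (1 / x) ^ k) (at x)"
        using DERIV_mult[OF DERIV_power[OF inv, of k] DERIV_chain2[OF DERIV_exp DERIV_minus[OF inv]]]
        by (simp add: ac_simps)
      moreover have "real k * ((1 / x) ^ (k - 1) * (- ((1 / x) ^ 2))) * exp (- (1 / x))
          + exp (- (1 / x)) * (1 / x) ^ 2 * (1 / x) ^ k
          = flat_exp (k + 2) x + - real k * flat_exp (k + 1) x"
        using 3 by (cases k) (simp_all add: flat_exp_def power2_eq_square algebra_simps
            add_divide_distrib diff_divide_distrib)
      ultimately show ?thesis by simp
    qed
    then show ?thesis
      by (rule has_field_derivative_transform_within_open[where S = "{0<..}"])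
        (use 3 in \<open>auto simp: flat_exp_def\<close>)
  qed
qed

lemma Ck_on_flat_exp: "Ck_on j UNIV (flat_exp k)"
proof (induction j arbitrary: k)
  case 0
  then show ?case
    using DERIV_isCont[OF flat_exp_deriv] by (auto simp: continuous_on_eq_continuous_at)
next
  case (Suc j)
  show ?case
    by (rule Ck_on_SucI[OF flat_exp_deriv]) (intro Ck_on_add Ck_on_mult Ck_on_const Suc)
qed

text \<open>These bumps increase to the indicator function of \<open>(c,d)\<close> as \<open>n \<rightarrow> \<infinity>\<close>.\<close>

definition bump :: "real \<Rightarrow> real \<Rightarrow> nat \<Rightarrow> real \<Rightarrow> real" where
  "bump c d n x = flat_exp 0 (real (Suc n) * (x - c)) * flat_exp 0 (real (Suc n) * (d - x))"

lemma bump_eq_0: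
  assumes "x \<notin> {c..d}"
  shows "bump c d n x = 0"
proof -
  have "x - c < 0 \<or> d - x < 0" using assms by auto
  then have "real (Suc n) * (x - c) < 0 \<or> real (Suc n) * (d - x) < 0"
    by (simp only: mult_less_0_iff) auto
  then show ?thesis by (auto simp: bump_def flat_exp_def)
qed

lemma bump_test_fun:
  assumes "{c..d} \<subseteq> \<Omega>"
  shows "test_fun \<Omega> (bump c d n)"
proof -
  have eq: "bump c d n = (\<lambda>x. flat_exp 0 (real (Suc n) * x + - real (Suc n) * c)
      * flat_exp 0 (- real (Suc n) * x + real (Suc n) * d))"
    by (auto simp: fun_eq_iff bump_def algebra_simps)
  have "smooth_on UNIV (bump c d n)"
    unfolding smooth_on_def eq by (intro allI Ck_on_mult Ck_on_affine Ck_on_flat_exp)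
  then show ?thesis
    unfolding test_fun_def using assms bump_eq_0 by (metis compact_Icc)
qed

lemma bump_bounds: "0 \<le> bump c d n x" "bump c d n x \<le> 1"
proof -
  have "0 \<le> flat_exp 0 y" "flat_exp 0 y \<le> 1" for y by (auto simp: flat_exp_def)
  then show "0 \<le> bump c d n x" "bump c d n x \<le> 1"
    by (auto simp: bump_def intro: mult_le_one)
qed

lemma bump_tendsto:
  assumes "c < x" "x < d"
  shows "(\<lambda>n. bump c d n x) \<longlonglongrightarrow> 1"
proof -
  have lim: "(\<lambda>n. flat_exp 0 (real (Suc n) * y)) \<longlonglongrightarrow> 1" if "0 < y" for y
  proof -
    have "(\<lambda>n. exp (- (inverse (real (Suc n)) * (1 / y)))) \<longlonglongrightarrow> exp (- (0 * (1 / y)))"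
      by (intro tendsto_intros LIMSEQ_inverse_real_of_nat)
    then show ?thesis using that by (simp add: flat_exp_def inverse_eq_divide)
  qed
  have "(\<lambda>n. bump c d n x) \<longlonglongrightarrow> 1 * 1"
    unfolding bump_def using assms by (intro tendsto_mult lim) auto
  then show ?thesis by simp
qed

lemma test_fun_deriv:
  assumes "test_fun \<Omega> (\<phi> :: real \<Rightarrow> real)"
  shows "(\<phi> has_real_derivative pd 1 \<phi> x) (at x)"
  using assms Ck_on_SucD(1)[of 0 \<phi> x] unfolding test_fun_def smooth_on_def by metis

lemma test_fun_pd:
  assumes "test_fun \<Omega> (\<phi> :: real \<Rightarrow> real)"
  shows "test_fun \<Omega> (pd 1 \<phi>)"
proof -
  obtain K where K: "compact K" "K \<subseteq> \<Omega>" "\<And>x. x \<notin> K \<Longrightarrow> \<phi> x = 0"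
    using assms unfolding test_fun_def by auto
  have "pd 1 \<phi> x = 0" if "x \<notin> K" for x
  proof (rule pd_eqI)
    show "(\<phi> has_real_derivative 0) (at x)"
      by (rule has_field_derivative_transform_within_open[where f = "\<lambda>x. 0" and S = "- K"])
        (use K that in \<open>auto simp: compact_imp_closed open_Compl\<close>)
  qed
  moreover have "smooth_on UNIV (pd 1 \<phi>)"
    using assms Ck_on_SucD(2) unfolding test_fun_def smooth_on_def by blast
  ultimately show ?thesis unfolding test_fun_def using K by blast
qed

lemma test_fun_continuous: "test_fun \<Omega> (\<phi> :: real \<Rightarrow> real) \<Longrightarrow> continuous_on S \<phi>"
  unfolding test_fun_def smooth_on_def
  by (metis Ck_on.simps(1) continuous_on_subset subset_UNIV)

lemma test_fun_diff:
  assumes "test_fun \<Omega> (\<phi> :: real \<Rightarrow> real)" "test_fun \<Omega> \<psi>"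
  shows "test_fun \<Omega> (\<lambda>x. \<phi> x - \<psi> x)"
proof -
  obtain K where K: "compact K" "K \<subseteq> \<Omega>" "\<And>x. x \<notin> K \<Longrightarrow> \<phi> x = 0"
    using assms unfolding test_fun_def by auto
  obtain L where L: "compact L" "L \<subseteq> \<Omega>" "\<And>x. x \<notin> L \<Longrightarrow> \<psi> x = 0"
    using assms unfolding test_fun_def by auto
  have "smooth_on UNIV (\<lambda>x. \<phi> x + (- 1) * \<psi> x)"
    using assms unfolding test_fun_def smooth_on_def
    by (intro allI Ck_on_add Ck_on_mult Ck_on_const) auto
  then have "smooth_on UNIV (\<lambda>x. \<phi> x - \<psi> x)" by simp
  moreover have "compact (K \<union> L)" "K \<union> L \<subseteq> \<Omega>" "\<And>x. x \<notin> K \<union> L \<Longrightarrow> \<phi> x - \<psi> x = 0"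
    using K L by auto
  ultimately show ?thesis unfolding test_fun_def by blast
qed

lemma test_fun_scale:
  assumes "test_fun \<Omega> (\<phi> :: real \<Rightarrow> real)"
  shows "test_fun \<Omega> (\<lambda>x. c * \<phi> x)"
proof -
  have "smooth_on UNIV (\<lambda>x. c * \<phi> x)"
    using assms unfolding test_fun_def smooth_on_def
    by (intro allI Ck_on_mult Ck_on_const) auto
  then show ?thesis using assms unfolding test_fun_def by auto
qed

lemma test_fun_zero: "test_fun \<Omega> (\<lambda>x::real. 0)"
  unfolding test_fun_def smooth_on_def using Ck_on_const by blast

section \<open>The fundamental lemma of the calculus of variations\<close>

lemma integrable_lebesgue_on_subset:
  assumes "integrable (lebesgue_on S) f" "T \<subseteq> S" "S \<in> sets lebesgue" "T \<in> sets lebesgue"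
  shows "integrable (lebesgue_on T) (f :: 'a::euclidean_space \<Rightarrow> real)"
  using set_integrable_subset[of lebesgue S f T] assms
  by (simp add: integrable_restrict_space set_integrable_def)

lemma locally_integrable_mult_test_fun:
  fixes h :: "real \<Rightarrow> real"
  assumes h: "locally_integrable \<Omega> h" and \<phi>: "test_fun \<Omega> \<phi>" and \<Omega>: "\<Omega> \<in> sets lebesgue"
  shows "integrable (lebesgue_on \<Omega>) (\<lambda>x. h x * \<phi> x)"
proof -
  obtain K where K: "compact K" "K \<subseteq> \<Omega>" "\<And>x. x \<notin> K \<Longrightarrow> \<phi> x = 0"
    using \<phi> unfolding test_fun_def by auto
  have KL: "K \<in> sets lebesgue" using K(1) by (simp add: lmeasurable_compact fmeasurableD)
  have "compact (\<phi> ` K)"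
    using K(1) test_fun_continuous[OF \<phi>] by (rule compact_continuous_image[rotated])
  then obtain B where B: "\<And>x. x \<in> K \<Longrightarrow> \<bar>\<phi> x\<bar> \<le> B"
    by (meson bounded_real compact_imp_bounded imageI)
  have hK: "integrable (lebesgue_on K) h" using h K unfolding locally_integrable_def by blast
  have "integrable (lebesgue_on K) (\<lambda>x. h x * \<phi> x)"
  proof (rule Bochner_Integration.integrable_bound)
    show "integrable (lebesgue_on K) (\<lambda>x. B * \<bar>h x\<bar>)" using hK by auto
    have "\<phi> \<in> borel_measurable (lebesgue_on K)"
      using continuous_imp_measurable_on_sets_lebesgue[OF test_fun_continuous[OF \<phi>] KL] .
    then show "(\<lambda>x. h x * \<phi> x) \<in> borel_measurable (lebesgue_on K)"
      using hK by auto
    show "AE x in lebesgue_on K. norm (h x * \<phi> x) \<le> norm (B * \<bar>h x\<bar>)"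
    proof (rule AE_I2)
      fix x assume "x \<in> space (lebesgue_on K)"
      then have "\<bar>\<phi> x\<bar> \<le> \<bar>B\<bar>" using B[of x] by fastforce
      then show "norm (h x * \<phi> x) \<le> norm (B * \<bar>h x\<bar>)"
        using mult_right_mono[of "\<bar>\<phi> x\<bar>" "\<bar>B\<bar>" "\<bar>h x\<bar>"] by (simp add: abs_mult mult.commute)
    qed
  qed
  then have "integrable lebesgue (\<lambda>x. if x \<in> K then h x * \<phi> x else 0)"
    by (rule iffD2[OF Lebesgue_Measure.integrable_restrict_UNIV[OF KL]])
  also have "(\<lambda>x. if x \<in> K then h x * \<phi> x else 0) = (\<lambda>x. if x \<in> \<Omega> then h x * \<phi> x else 0)"
    using K(2,3) by (intro ext) (metis mult_zero_right subsetD)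
  finally show ?thesis
    by (rule iffD1[OF Lebesgue_Measure.integrable_restrict_UNIV[OF \<Omega>]])
qed

lemma AE_lebesgue_on_neq: "AE x in lebesgue_on S. x \<noteq> (c::real)" if "S \<in> sets lebesgue"
proof -
  have "AE x in lebesgue. x \<noteq> c"
    by (intro AE_completion AE_lborel_singleton)
  then have "AE x in lebesgue. x \<in> S \<longrightarrow> x \<noteq> c"
    by eventually_elim simp
  then show ?thesis using that by (simp add: AE_restrict_space_iff)
qed

text \<open>Testing with the bumps gives, by dominated convergence, a vanishing integral over every
  interval.\<close>

lemma integral_interval_eq_0_of_test_funs:
  fixes h :: "real \<Rightarrow> real"
  assumes h: "locally_integrable \<Omega> h" and \<Omega>: "\<Omega> \<in> sets lebesgue"
    and zero: "\<And>\<phi>. test_fun \<Omega> \<phi> \<Longrightarrow> (LINT x|lebesgue_on \<Omega>. h x * \<phi> x) = 0"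
    and cd: "{c..d} \<subseteq> \<Omega>"
  shows "(LINT x|lebesgue_on {c..d}. h x) = 0"
proof -
  let ?M = "lebesgue_on {c..d}"
  have hI: "integrable ?M h" using h cd unfolding locally_integrable_def by auto
  have L: "{c..d} \<in> sets lebesgue" by simp
  have meas: "(\<lambda>x. h x * bump c d n x) \<in> borel_measurable ?M" for n
  proof -
    have "bump c d n \<in> borel_measurable ?M"
      by (rule continuous_imp_measurable_on_sets_lebesgue[OF test_fun_continuous[OF bump_test_fun[OF cd]] L])
    then show ?thesis using hI by auto
  qed
  have "(\<lambda>n. LINT x|?M. h x * bump c d n x) \<longlonglongrightarrow> (LINT x|?M. h x)"
  proof (rule integral_dominated_convergence[where w = "\<lambda>x. \<bar>h x\<bar>"])
    show "AE x in ?M. (\<lambda>n. h x * bump c d n x) \<longlonglongrightarrow> h x"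
      using AE_lebesgue_on_neq[OF L, of c] AE_lebesgue_on_neq[OF L, of d] AE_space
    proof eventually_elim
      case (elim x)
      then have "(\<lambda>n. h x * bump c d n x) \<longlonglongrightarrow> h x * 1"
        by (intro tendsto_intros bump_tendsto) auto
      then show ?case by simp
    qed
    show "AE x in ?M. norm (h x * bump c d n x) \<le> \<bar>h x\<bar>" for n
      using bump_bounds[of c d n] by (intro AE_I2) (simp add: abs_mult mult_left_le)
  qed (use hI meas in auto)
  moreover have "(LINT x|?M. h x * bump c d n x) = 0" for n
  proof -
    have "(LINT x|?M. h x * bump c d n x)
        = (LINT x|lebesgue_on \<Omega>. (if x \<in> {c..d} then h x * bump c d n x else 0))"
      using integral_restrict[OF cd L \<Omega>, of "\<lambda>x. h x * bump c d n x"] by simp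
    also have "\<dots> = (LINT x|lebesgue_on \<Omega>. h x * bump c d n x)"
      by (rule Bochner_Integration.integral_cong) (auto simp: bump_eq_0)
    also have "\<dots> = 0" by (rule zero[OF bump_test_fun[OF cd]])
    finally show ?thesis .
  qed
  ultimately show ?thesis by (simp add: LIMSEQ_const_iff)
qed

text \<open>By Lebesgue's differentiation theorem, a function whose integrals over small intervals
  vanish is zero almost everywhere. The interval is exhausted by compact intervals on which the
  function is integrable.\<close>

lemma du_Bois_Reymond:
  fixes h :: "real \<Rightarrow> real"
  assumes h: "locally_integrable {0<..<1} h"
    and zero: "\<And>\<phi>. test_fun {0<..<1} \<phi> \<Longrightarrow> (LINT x|lebesgue_on {0<..<1}. h x * \<phi> x) = 0"
  shows "AE x in lebesgue_on {0<..<1}. h x = 0"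
proof -
  define J where "J n = {1 / real (n + 2) .. 1 - 1 / real (n + 2)}" for n
  have J: "J n \<subseteq> {0<..<1}" for n
  proof
    fix x assume x: "x \<in> J n"
    have "0 < 1 / real (n + 2)" by simp
    then show "x \<in> {0<..<1}" using x unfolding J_def by (simp only: atLeastAtMost_iff greaterThanLessThan_iff) linarith
  qed
  have "\<exists>N. negligible N \<and> (\<forall>x. x \<notin> N \<longrightarrow> x \<in> interior (J n) \<longrightarrow> h x = 0)" for n
  proof -
    define f where "f x = (if x \<in> J n then h x else 0)" for x
    have hJ: "integrable (lebesgue_on (J n)) h"
      using h J[of n] unfolding locally_integrable_def J_def by auto
    have "integrable lebesgue f"
      unfolding f_def using hJ by (subst Lebesgue_Measure.integrable_restrict_UNIV) (auto simp: J_def)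
    then have "f integrable_on UNIV" by (rule integrable_on_lebesgue)
    then have fi: "f integrable_on cbox a b" for a b
      using integrable_on_subcbox by blast
    obtain N where N: "negligible N" "\<And>x e. \<lbrakk>x \<notin> N; 0 < e\<rbrakk> \<Longrightarrow>
        \<exists>d>0. \<forall>k. 0 < k \<and> k < d \<longrightarrow>
          norm (integral (cbox x (x + k *\<^sub>R One)) f /\<^sub>R k ^ DIM(real) - f x) < e"
      using integrable_ccontinuous_explicit[of f] fi by blast
    have "h x = 0" if x: "x \<notin> N" "x \<in> interior (J n)" for x
    proof -
      obtain r where r: "0 < r" "ball x r \<subseteq> J n" using x(2) mem_interior by blast
      have "\<bar>h x\<bar> < e" if "0 < e" for e
      proof -
        obtain d where d: "0 < d" "\<forall>k. 0 < k \<and> k < d \<longrightarrow>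
            norm (integral (cbox x (x + k *\<^sub>R One)) f /\<^sub>R k ^ DIM(real) - f x) < e"
          using N(2)[OF x(1) \<open>0 < e\<close>] by blast
        define k where "k = min (d / 2) (r / 2)"
        have k: "0 < k" "k < d" "k < r" using d r by (auto simp: k_def)
        have sub: "{x..x + k} \<subseteq> J n"
          using r k by (auto simp: subset_eq dist_real_def)
        then have sub': "{x..x + k} \<subseteq> {0<..<1}" using J by blast
        have "integral (cbox x (x + k *\<^sub>R One)) f = integral {x..x + k} h"
          using sub by (auto simp: f_def intro!: Henstock_Kurzweil_Integration.integral_cong)
        also have "\<dots> = (LINT y|lebesgue_on {x..x + k}. h y)"
          by (rule lebesgue_integral_eq_integral[symmetric])
            (use h sub' in \<open>auto simp: locally_integrable_def\<close>)
        also have "\<dots> = 0"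
          by (rule integral_interval_eq_0_of_test_funs[OF h _ zero sub']) auto
        finally have "norm (0 - f x) < e" using d(2) k by fastforce
        moreover have "x \<in> J n" using x(2) interior_subset by blast
        ultimately show ?thesis by (simp add: f_def)
      qed
      from this[of "\<bar>h x\<bar>"] show ?thesis by (cases "h x = 0") auto
    qed
    then show ?thesis using N(1) by blast
  qed
  then obtain N where N: "\<And>n. negligible (N n)"
    "\<And>n x. x \<notin> N n \<Longrightarrow> x \<in> interior (J n) \<Longrightarrow> h x = 0" by metis
  have neg: "(\<Union>n. N n) \<in> null_sets lebesgue"
    using N(1) by (auto intro!: negligible_Union_nat simp: negligible_iff_null_sets[symmetric])
  have cover: "\<exists>n. x \<in> interior (J n)" if "0 < x" "x < 1" for x
  proof -
    obtain n where "0 < n" "inverse (real n) < min x (1 - x)"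
      using ex_inverse_of_nat_less[of "min x (1 - x)"] \<open>0 < x\<close> \<open>x < 1\<close>
      by (auto simp: min_less_iff_conj)
    moreover have "1 / real (n + 2) < inverse (real n)"
      using \<open>0 < n\<close> by (simp add: inverse_eq_divide field_simps)
    ultimately show ?thesis
      by (intro exI[of _ n]) (auto simp: J_def)
  qed
  have "AE x in lebesgue. x \<notin> (\<Union>n. N n)" by (rule AE_not_in[OF neg])
  then have "AE x in lebesgue. x \<in> {0<..<1} \<longrightarrow> h x = 0"
  proof eventually_elim
    case (elim x)
    then show ?case using N(2)[of x] cover[of x] by auto
  qed
  then show ?thesis by (simp add: AE_restrict_space_iff)
qed

section \<open>The Sobolev spaces of the unit interval\<close>

abbreviation (input) UI :: "real set" where "UI \<equiv> {0<..<1}"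

abbreviation (input) D :: "(real \<Rightarrow> real) \<Rightarrow> real \<Rightarrow> real" where "D \<equiv> wderiv UI 1"

lemma in_L2_UI_const: "in_L2 UI (\<lambda>x. c)"
proof -
  have "finite_measure (lebesgue_on UI)"
    by (rule finite_measure_lebesgue_on) simp
  then show ?thesis by (auto simp: in_L2_def finite_measure.integrable_const)
qed

lemma in_L2_locally_integrable:
  assumes "in_L2 UI f"
  shows "locally_integrable UI f"
  unfolding locally_integrable_def
proof (intro allI impI)
  fix K :: "real set" assume K: "compact K \<and> K \<subseteq> UI"
  have "integrable (lebesgue_on UI) f"
    using in_L2_mult_integrable[OF assms in_L2_UI_const[of 1]] by simp
  then show "integrable (lebesgue_on K) f"
    by (rule integrable_lebesgue_on_subset)
      (use K in \<open>auto simp: lmeasurable_compact fmeasurableD\<close>)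
qed

lemma weak_deriv_unique:
  assumes "weak_deriv UI 1 f h1" "weak_deriv UI 1 f h2"
  shows "AE x in lebesgue_on UI. h1 x = h2 x"
proof -
  have li: "locally_integrable UI h1" "locally_integrable UI h2"
    using assms by (auto simp: weak_deriv_def)
  have "AE x in lebesgue_on UI. h1 x - h2 x = 0"
  proof (rule du_Bois_Reymond)
    show "locally_integrable UI (\<lambda>x. h1 x - h2 x)"
      using li by (auto simp: locally_integrable_def)
    fix \<phi> :: "real \<Rightarrow> real" assume \<phi>: "test_fun UI \<phi>"
    have "(LINT x|lebesgue_on UI. h1 x * \<phi> x) = (LINT x|lebesgue_on UI. h2 x * \<phi> x)"
      using assms \<phi> by (simp add: weak_deriv_def)
    moreover have "integrable (lebesgue_on UI) (\<lambda>x. h1 x * \<phi> x)"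
      "integrable (lebesgue_on UI) (\<lambda>x. h2 x * \<phi> x)"
      using li \<phi> by (auto intro: locally_integrable_mult_test_fun)
    ultimately show "(LINT x|lebesgue_on UI. (h1 x - h2 x) * \<phi> x) = 0"
      by (simp add: left_diff_distrib)
  qed
  then show ?thesis by simp
qed

lemma borel_measurable_UI_AE:
  assumes h: "h \<in> borel_measurable (lebesgue_on UI)"
    and ae: "AE x in lebesgue_on UI. h x = (k x :: real)"
  shows "k \<in> borel_measurable (lebesgue_on UI)"
proof -
  have "(\<lambda>x. if x \<in> UI then h x else 0) \<in> borel_measurable lebesgue"
    by (rule iffD2[OF borel_measurable_if h]) simp
  moreover have "AE x in lebesgue. (if x \<in> UI then h x else 0) = (if x \<in> UI then k x else 0)"
    using ae by (auto simp: AE_restrict_space_iff elim: eventually_mono)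
  ultimately have "(\<lambda>x. if x \<in> UI then k x else 0) \<in> borel_measurable lebesgue"
    by (rule borel_measurable_AE)
  then show ?thesis
    by (rule iffD1[OF borel_measurable_if, rotated]) simp
qed

lemma in_L2_UI_AE:
  "in_L2 UI h \<Longrightarrow> AE x in lebesgue_on UI. h x = k x \<Longrightarrow> in_L2 UI k"
  using in_L2_cong_AE borel_measurable_UI_AE in_L2_measurable by blast

text \<open>If some weak derivative is square integrable, then so is the chosen representative, because
  the two agree almost everywhere.\<close>

lemma D_eqI:
  assumes "weak_deriv UI 1 f h" "in_L2 UI h"
  shows "AE x in lebesgue_on UI. D f x = h x" "in_L2 UI (D f)" "weak_deriv UI 1 f (D f)"
proof -
  show w: "weak_deriv UI 1 f (D f)"
    unfolding wderiv_def by (rule someI[of "weak_deriv UI 1 f"]) (rule assms(1))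
  show ae: "AE x in lebesgue_on UI. D f x = h x"
    by (rule weak_deriv_unique[OF w assms(1)])
  show "in_L2 UI (D f)"
    by (rule in_L2_UI_AE[OF assms(2)]) (use ae in \<open>auto elim: eventually_mono\<close>)
qed

lemma in_H1_L2: "in_H1 UI w \<Longrightarrow> in_L2 UI w"
  by (simp add: in_H1_def)

lemma in_H1_D:
  assumes "in_H1 UI w"
  shows "in_L2 UI (D w)" "weak_deriv UI 1 w (D w)"
  using assms D_eqI by (auto simp: in_H1_def)

lemma in_H1I: "in_L2 UI w \<Longrightarrow> in_L2 UI h \<Longrightarrow> weak_deriv UI 1 w h \<Longrightarrow> in_H1 UI w"
  by (auto simp: in_H1_def)

lemma weak_deriv_ip:
  assumes "weak_deriv UI 1 f h" "test_fun UI \<phi>"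
  shows "ip UI f (pd 1 \<phi>) = - ip UI h \<phi>"
  using assms by (simp add: weak_deriv_def ip_def)

lemma weak_derivI:
  assumes "in_L2 UI f" "in_L2 UI h"
    and "\<And>\<phi>. test_fun UI \<phi> \<Longrightarrow> ip UI f (pd 1 \<phi>) = - ip UI h \<phi>"
  shows "weak_deriv UI 1 f h"
  using assms by (simp add: weak_deriv_def ip_def in_L2_locally_integrable)

lemma test_fun_L2:
  assumes "test_fun UI \<phi>"
  shows "in_L2 UI \<phi>"
proof -
  have "\<phi> \<in> borel_measurable (lebesgue_on UI)"
    by (rule continuous_imp_measurable_on_sets_lebesgue[OF test_fun_continuous[OF assms]]) simp
  moreover have "integrable (lebesgue_on {0..1}) (\<lambda>x. (\<phi> x)\<^sup>2)"
    by (intro continuous_imp_integrable_real continuous_intros test_fun_continuous[OF assms])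
  then have "integrable (lebesgue_on UI) (\<lambda>x. (\<phi> x)\<^sup>2)"
    by (rule integrable_lebesgue_on_subset) auto
  ultimately show ?thesis by (simp add: in_L2_def)
qed

lemma weak_deriv_diff:
  assumes "in_L2 UI f" "in_L2 UI g" "in_L2 UI h" "in_L2 UI k"
    and "weak_deriv UI 1 f h" "weak_deriv UI 1 g k"
  shows "weak_deriv UI 1 (\<lambda>x. f x - g x) (\<lambda>x. h x - k x)"
proof (rule weak_derivI)
  fix \<phi> :: "real \<Rightarrow> real" assume \<phi>: "test_fun UI \<phi>"
  show "ip UI (\<lambda>x. f x - g x) (pd 1 \<phi>) = - ip UI (\<lambda>x. h x - k x) \<phi>"
    using assms \<phi> by (simp add: ip_diff_left test_fun_L2 test_fun_pd weak_deriv_ip)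
qed (use assms in \<open>auto intro: in_L2_diff\<close>)

lemma weak_deriv_scale:
  assumes "in_L2 UI f" "in_L2 UI h" "weak_deriv UI 1 f h"
  shows "weak_deriv UI 1 (\<lambda>x. c * f x) (\<lambda>x. c * h x)"
proof (rule weak_derivI)
  fix \<phi> :: "real \<Rightarrow> real" assume \<phi>: "test_fun UI \<phi>"
  show "ip UI (\<lambda>x. c * f x) (pd 1 \<phi>) = - ip UI (\<lambda>x. c * h x) \<phi>"
    using assms \<phi> by (simp add: ip_scale_left weak_deriv_ip)
qed (use assms in \<open>auto intro: in_L2_scale\<close>)

lemma weak_deriv_cong_AE:
  assumes "in_L2 UI f" "in_L2 UI h" "weak_deriv UI 1 f h"
    and "AE x in lebesgue_on UI. f x = g x" "AE x in lebesgue_on UI. h x = k x"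
  shows "weak_deriv UI 1 g k"
proof (rule weak_derivI)
  show L2: "in_L2 UI g" "in_L2 UI k"
    using in_L2_UI_AE[OF assms(1,4)] in_L2_UI_AE[OF assms(2,5)] by auto
  fix \<phi> :: "real \<Rightarrow> real" assume \<phi>: "test_fun UI \<phi>"
  have "ip UI g (pd 1 \<phi>) = ip UI f (pd 1 \<phi>)"
    using assms L2 test_fun_L2[OF test_fun_pd[OF \<phi>]]
    by (intro ip_cong_AE) (auto elim: eventually_mono)
  moreover have "ip UI k \<phi> = ip UI h \<phi>"
    using assms L2 test_fun_L2[OF \<phi>]
    by (intro ip_cong_AE) (auto elim: eventually_mono)
  ultimately show "ip UI g (pd 1 \<phi>) = - ip UI k \<phi>"
    using weak_deriv_ip[OF assms(3) \<phi>] by simp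
qed

lemma in_H1_diff:
  assumes "in_H1 UI f" "in_H1 UI g"
  shows "in_H1 UI (\<lambda>x. f x - g x)"
    and "AE x in lebesgue_on UI. D (\<lambda>x. f x - g x) x = D f x - D g x"
proof -
  have w: "weak_deriv UI 1 (\<lambda>x. f x - g x) (\<lambda>x. D f x - D g x)"
    using assms by (intro weak_deriv_diff in_H1_D in_H1_L2)
  have L: "in_L2 UI (\<lambda>x. D f x - D g x)" using assms by (intro in_L2_diff in_H1_D)
  show "in_H1 UI (\<lambda>x. f x - g x)"
    using assms by (intro in_H1I[OF _ L w] in_L2_diff in_H1_L2)
  show "AE x in lebesgue_on UI. D (\<lambda>x. f x - g x) x = D f x - D g x"
    by (rule D_eqI(1)[OF w L])
qed

lemma L2norm_D_diff:
  assumes "in_H1 UI f" "in_H1 UI g"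
  shows "L2norm UI (D (\<lambda>x. f x - g x)) = L2norm UI (\<lambda>x. D f x - D g x)"
  using in_H1_diff[OF assms] assms by (intro L2norm_cong_AE) (auto intro!: in_L2_diff in_H1_D)

lemma in_H1_scale:
  assumes "in_H1 UI f"
  shows "in_H1 UI (\<lambda>x. c * f x)"
    and "AE x in lebesgue_on UI. D (\<lambda>x. c * f x) x = c * D f x"
proof -
  have w: "weak_deriv UI 1 (\<lambda>x. c * f x) (\<lambda>x. c * D f x)"
    using assms by (intro weak_deriv_scale in_H1_D in_H1_L2)
  have L: "in_L2 UI (\<lambda>x. c * D f x)" using assms by (intro in_L2_scale in_H1_D)
  show "in_H1 UI (\<lambda>x. c * f x)"
    using assms by (intro in_H1I[OF _ L w] in_L2_scale in_H1_L2)
  show "AE x in lebesgue_on UI. D (\<lambda>x. c * f x) x = c * D f x"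
    by (rule D_eqI(1)[OF w L])
qed

lemma in_H1_cong_AE:
  assumes "in_H1 UI f" "AE x in lebesgue_on UI. f x = g x"
  shows "in_H1 UI g" "AE x in lebesgue_on UI. D g x = D f x"
proof -
  have w: "weak_deriv UI 1 g (D f)"
    by (rule weak_deriv_cong_AE[OF in_H1_L2[OF assms(1)] in_H1_D[OF assms(1)] assms(2)]) simp
  show "in_H1 UI g"
    by (rule in_H1I[OF in_L2_UI_AE[OF in_H1_L2[OF assms(1)] assms(2)] in_H1_D(1)[OF assms(1)] w])
  show "AE x in lebesgue_on UI. D g x = D f x"
    by (rule D_eqI(1)[OF w in_H1_D(1)[OF assms(1)]])
qed

lemma grad_sq_real: "grad_sq UI w x = (D w x)\<^sup>2"
  by (simp add: grad_sq_def)

lemma laplacian_real: "laplacian UI w = D (D w)"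
  by (simp add: laplacian_def fun_eq_iff)

lemma H1norm_real: "H1norm UI w = sqrt ((L2norm UI w)\<^sup>2 + (L2norm UI (D w))\<^sup>2)"
  by (simp add: H1norm_def)

lemma in_H2_real: "in_H2 UI w \<longleftrightarrow> in_H1 UI w \<and> in_H1 UI (D w)"
  by (simp add: in_H2_def)

lemma in_H2_diff:
  assumes "in_H2 UI f" "in_H2 UI g"
  shows "in_H2 UI (\<lambda>x. f x - g x)"
    and "AE x in lebesgue_on UI.
      laplacian UI (\<lambda>x. f x - g x) x = laplacian UI f x - laplacian UI g x"
proof -
  have H: "in_H1 UI f" "in_H1 UI g" "in_H1 UI (D f)" "in_H1 UI (D g)"
    using assms by (auto simp: in_H2_real)
  have ae: "AE x in lebesgue_on UI. D f x - D g x = D (\<lambda>x. f x - g x) x"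
    using in_H1_diff(2)[OF H(1,2)] by eventually_elim simp
  note 1 = in_H1_diff[OF H(3,4)]
  note 2 = in_H1_cong_AE[OF 1(1) ae]
  show "in_H2 UI (\<lambda>x. f x - g x)"
    using in_H1_diff(1)[OF H(1,2)] 2(1) by (simp add: in_H2_real)
  show "AE x in lebesgue_on UI.
      laplacian UI (\<lambda>x. f x - g x) x = laplacian UI f x - laplacian UI g x"
    using 1(2) 2(2) unfolding laplacian_real by eventually_elim simp
qed

lemma in_H2_scale:
  assumes "in_H2 UI f"
  shows "in_H2 UI (\<lambda>x. c * f x)"
    and "AE x in lebesgue_on UI. laplacian UI (\<lambda>x. c * f x) x = c * laplacian UI f x"
proof -
  have H: "in_H1 UI f" "in_H1 UI (D f)"
    using assms by (auto simp: in_H2_real)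
  have ae: "AE x in lebesgue_on UI. c * D f x = D (\<lambda>x. c * f x) x"
    using in_H1_scale(2)[OF H(1), of c] by eventually_elim simp
  note 1 = in_H1_scale[OF H(2), of c]
  note 2 = in_H1_cong_AE[OF 1(1) ae]
  show "in_H2 UI (\<lambda>x. c * f x)"
    using in_H1_scale(1)[OF H(1)] 2(1) by (simp add: in_H2_real)
  show "AE x in lebesgue_on UI. laplacian UI (\<lambda>x. c * f x) x = c * laplacian UI f x"
    using 1(2) 2(2) unfolding laplacian_real by eventually_elim simp
qed

lemma in_H2_laplacian_L2: "in_H2 UI z \<Longrightarrow> in_L2 UI (laplacian UI z)"
  by (simp add: in_H2_real laplacian_real in_H1_D)

lemma continuous_integrable_UI:
  fixes f :: "real \<Rightarrow> real"
  assumes "continuous_on {0..1} f"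
  shows "integrable (lebesgue_on UI) f" "(LINT x|lebesgue_on UI. f x) = integral {0..1} f"
proof -
  show "integrable (lebesgue_on UI) f"
    by (rule integrable_lebesgue_on_subset[OF continuous_imp_integrable_real[OF assms]]) auto
  then show "(LINT x|lebesgue_on UI. f x) = integral {0..1} f"
    by (simp add: lebesgue_integral_eq_integral integral_open_interval_real)
qed

lemma test_fun_boundary: "test_fun UI \<phi> \<Longrightarrow> \<phi> 0 = 0 \<and> \<phi> 1 = 0"
  unfolding test_fun_def by (metis greaterThanLessThan_iff less_irrefl subsetD)

text \<open>Integration by parts is the fundamental theorem of calculus for the product of two test
  functions, which vanishes at both end points.\<close>

lemma test_fun_weak_deriv:
  assumes \<phi>: "test_fun UI \<phi>"
  shows "weak_deriv UI 1 \<phi> (pd 1 \<phi>)"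
proof (rule weak_derivI)
  fix \<psi> :: "real \<Rightarrow> real" assume \<psi>: "test_fun UI \<psi>"
  have "((\<lambda>x. pd 1 \<phi> x * \<psi> x + pd 1 \<psi> x * \<phi> x) has_integral \<phi> 1 * \<psi> 1 - \<phi> 0 * \<psi> 0) {0..1}"
    using DERIV_mult[OF test_fun_deriv[OF \<phi>] test_fun_deriv[OF \<psi>]]
    by (intro fundamental_theorem_of_calculus)
      (auto simp: has_real_derivative_iff_has_vector_derivative[symmetric]
        intro: has_field_derivative_at_within)
  then have "integral {0..1} (\<lambda>x. pd 1 \<phi> x * \<psi> x + pd 1 \<psi> x * \<phi> x) = 0"
    using test_fun_boundary[OF \<phi>] by (simp add: integral_unique)
  moreover have "continuous_on {0..1} (\<lambda>x. pd 1 \<phi> x * \<psi> x + pd 1 \<psi> x * \<phi> x)"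
    by (intro continuous_intros test_fun_continuous[OF \<phi>] test_fun_continuous[OF \<psi>]
        test_fun_continuous[OF test_fun_pd[OF \<phi>]] test_fun_continuous[OF test_fun_pd[OF \<psi>]])
  ultimately have "(LINT x|lebesgue_on UI. pd 1 \<phi> x * \<psi> x + pd 1 \<psi> x * \<phi> x) = 0"
    using continuous_integrable_UI(2) by simp
  then show "ip UI \<phi> (pd 1 \<psi>) = - ip UI (pd 1 \<phi>) \<psi>"
    using in_L2_mult_integrable[OF test_fun_L2[OF test_fun_pd[OF \<phi>]] test_fun_L2[OF \<psi>]]
      in_L2_mult_integrable[OF test_fun_L2[OF test_fun_pd[OF \<psi>]] test_fun_L2[OF \<phi>]]
    by (simp add: ip_def mult.commute)
qed (use \<phi> in \<open>auto intro: test_fun_L2 test_fun_pd\<close>)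

lemma test_fun_D: "test_fun UI \<phi> \<Longrightarrow> AE x in lebesgue_on UI. D \<phi> x = pd 1 \<phi> x"
  by (intro D_eqI(1) test_fun_weak_deriv test_fun_L2 test_fun_pd)

lemma test_fun_H1: "test_fun UI \<phi> \<Longrightarrow> in_H1 UI \<phi>"
  by (intro in_H1I[where h = "pd 1 \<phi>"] test_fun_weak_deriv test_fun_L2 test_fun_pd)

lemma test_fun_H2:
  assumes "test_fun UI \<phi>"
  shows "in_H2 UI \<phi>"
proof -
  have "AE x in lebesgue_on UI. pd 1 \<phi> x = D \<phi> x"
    using test_fun_D[OF assms] by eventually_elim simp
  then have "in_H1 UI (D \<phi>)"
    by (rule in_H1_cong_AE(1)[OF test_fun_H1[OF test_fun_pd[OF assms]]])
  then show ?thesis using test_fun_H1[OF assms] by (simp add: in_H2_real)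
qed

lemma H1norm_tendsto_iff:
  "((\<lambda>n. H1norm UI (W n)) \<longlongrightarrow> 0) F
    \<longleftrightarrow> ((\<lambda>n. L2norm UI (W n)) \<longlongrightarrow> 0) F \<and> ((\<lambda>n. L2norm UI (D (W n))) \<longlongrightarrow> 0) F"
proof
  assume H: "((\<lambda>n. H1norm UI (W n)) \<longlongrightarrow> 0) F"
  have "L2norm UI w \<le> H1norm UI w" "L2norm UI (D w) \<le> H1norm UI w" for w
    by (auto simp: H1norm_real intro!: real_le_rsqrt)
  then have le: "\<forall>\<^sub>F n in F. L2norm UI (W n) \<le> H1norm UI (W n)"
    "\<forall>\<^sub>F n in F. L2norm UI (D (W n)) \<le> H1norm UI (W n)" by simp_all
  have ge: "\<forall>\<^sub>F n in F. 0 \<le> L2norm UI (W n)" "\<forall>\<^sub>F n in F. 0 \<le> L2norm UI (D (W n))"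
    by (simp_all add: L2norm_nonneg)
  show "((\<lambda>n. L2norm UI (W n)) \<longlongrightarrow> 0) F \<and> ((\<lambda>n. L2norm UI (D (W n))) \<longlongrightarrow> 0) F"
    using tendsto_sandwich[OF ge(1) le(1) tendsto_const H]
      tendsto_sandwich[OF ge(2) le(2) tendsto_const H] by simp
next
  assume "((\<lambda>n. L2norm UI (W n)) \<longlongrightarrow> 0) F \<and> ((\<lambda>n. L2norm UI (D (W n))) \<longlongrightarrow> 0) F"
  then have "((\<lambda>n. sqrt ((L2norm UI (W n))\<^sup>2 + (L2norm UI (D (W n)))\<^sup>2)) \<longlongrightarrow> sqrt (0\<^sup>2 + 0\<^sup>2)) F"
    by (intro tendsto_intros) auto
  then show "((\<lambda>n. H1norm UI (W n)) \<longlongrightarrow> 0) F" by (simp add: H1norm_real)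
qed

lemma in_H10_H1: "in_H10 UI w \<Longrightarrow> in_H1 UI w"
  by (simp add: in_H10_def)

lemma test_fun_H10:
  assumes "test_fun UI \<phi>"
  shows "in_H10 UI \<phi>"
proof -
  have "AE x in lebesgue_on UI. D (\<lambda>x. 0) x = 0"
    using test_fun_D[OF test_fun_zero] pd_eqI[OF DERIV_const[of 0]] by simp
  moreover have "in_L2 UI (D (\<lambda>x. 0))"
    using in_H1_D(1)[OF test_fun_H1[OF test_fun_zero]] .
  ultimately have "L2norm UI (D (\<lambda>x. 0)) = 0"
    using L2norm_cong_AE[of UI "D (\<lambda>x. 0)" "\<lambda>x. 0"] in_L2_zero L2norm_zero by metis
  then have "H1norm UI (\<lambda>x. \<phi> x - \<phi> x) = 0"
    by (simp add: H1norm_real L2norm_zero)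
  then show ?thesis
    unfolding in_H10_def using test_fun_H1[OF assms] assms by (intro conjI exI[of _ "\<lambda>n. \<phi>"]) auto
qed

lemma in_H10_approx:
  assumes "in_H10 UI w"
  obtains \<phi> :: "nat \<Rightarrow> real \<Rightarrow> real" where "\<And>n. test_fun UI (\<phi> n)"
    "(\<lambda>n. L2norm UI (\<lambda>x. \<phi> n x - w x)) \<longlonglongrightarrow> 0"
    "(\<lambda>n. L2norm UI (\<lambda>x. D (\<phi> n) x - D w x)) \<longlonglongrightarrow> 0"
proof -
  obtain \<phi> :: "nat \<Rightarrow> real \<Rightarrow> real" where \<phi>: "\<And>n. test_fun UI (\<phi> n)"
    "(\<lambda>n. H1norm UI (\<lambda>x. \<phi> n x - w x)) \<longlonglongrightarrow> 0"
    using assms unfolding in_H10_def by auto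
  have H: "in_H1 UI w" "\<And>n. in_H1 UI (\<phi> n)"
    using assms \<phi>(1) test_fun_H1 by (auto simp: in_H10_H1)
  have "L2norm UI (D (\<lambda>x. \<phi> n x - w x)) = L2norm UI (\<lambda>x. D (\<phi> n) x - D w x)" for n
    by (rule L2norm_D_diff[OF H(2,1)])
  then show thesis
    using that[of \<phi>, OF \<phi>(1)] \<phi>(2) H1norm_tendsto_iff[of "\<lambda>n x. \<phi> n x - w x" sequentially]
    by simp
qed

lemma in_H10_diff:
  assumes f: "in_H10 UI f" and g: "in_H10 UI g"
  shows "in_H10 UI (\<lambda>x. f x - g x)"
proof -
  obtain \<phi> :: "nat \<Rightarrow> real \<Rightarrow> real" where \<phi>: "\<And>n. test_fun UI (\<phi> n)"
    "(\<lambda>n. L2norm UI (\<lambda>x. \<phi> n x - f x)) \<longlonglongrightarrow> 0"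
    "(\<lambda>n. L2norm UI (\<lambda>x. D (\<phi> n) x - D f x)) \<longlonglongrightarrow> 0"
    using in_H10_approx[OF f] by blast
  obtain \<psi> :: "nat \<Rightarrow> real \<Rightarrow> real" where \<psi>: "\<And>n. test_fun UI (\<psi> n)"
    "(\<lambda>n. L2norm UI (\<lambda>x. \<psi> n x - g x)) \<longlonglongrightarrow> 0"
    "(\<lambda>n. L2norm UI (\<lambda>x. D (\<psi> n) x - D g x)) \<longlonglongrightarrow> 0"
    using in_H10_approx[OF g] by blast
  have H: "in_H1 UI f" "in_H1 UI g" "\<And>n. in_H1 UI (\<phi> n)" "\<And>n. in_H1 UI (\<psi> n)"
    using f g \<phi>(1) \<psi>(1) test_fun_H1 by (auto simp: in_H10_H1)
  have step: "L2norm UI (\<lambda>x. (p x - q x) - (r x - s x))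
      \<le> L2norm UI (\<lambda>x. p x - r x) + L2norm UI (\<lambda>x. q x - s x)"
    if "in_L2 UI p" "in_L2 UI q" "in_L2 UI r" "in_L2 UI s" for p q r s
  proof -
    have "L2norm UI (\<lambda>x. (p x - r x) + (s x - q x))
      \<le> L2norm UI (\<lambda>x. p x - r x) + L2norm UI (\<lambda>x. s x - q x)"
      using that by (intro L2norm_triangle in_L2_diff)
    then show ?thesis
      by (simp add: L2norm_minus_commute[of _ s q] algebra_simps)
  qed
  define W where "W n = (\<lambda>x. (\<phi> n x - \<psi> n x) - (f x - g x))" for n
  have "(\<lambda>n. L2norm UI (W n)) \<longlonglongrightarrow> 0"
  proof (rule tendsto_sandwich[OF always_eventually always_eventually tendsto_const])
    show "\<forall>n. L2norm UI (W n)
        \<le> L2norm UI (\<lambda>x. \<phi> n x - f x) + L2norm UI (\<lambda>x. \<psi> n x - g x)"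
      unfolding W_def using H in_H1_L2 by (auto intro!: step)
    show "(\<lambda>n. L2norm UI (\<lambda>x. \<phi> n x - f x) + L2norm UI (\<lambda>x. \<psi> n x - g x)) \<longlonglongrightarrow> 0"
      using tendsto_add[OF \<phi>(2) \<psi>(2)] by simp
  qed (simp add: L2norm_nonneg)
  moreover have "(\<lambda>n. L2norm UI (D (W n))) \<longlonglongrightarrow> 0"
  proof (rule tendsto_sandwich[OF always_eventually always_eventually tendsto_const])
    have "L2norm UI (D (W n)) \<le> L2norm UI (\<lambda>x. D (\<phi> n) x - D f x)
          + L2norm UI (\<lambda>x. D (\<psi> n) x - D g x)" for n
    proof -
      note 1 = in_H1_diff[OF H(3)[of n] H(4)[of n]] and 2 = in_H1_diff[OF H(1,2)]
      note 3 = in_H1_diff[OF 1(1) 2(1)]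
      have "AE x in lebesgue_on UI. D (W n) x = (D (\<phi> n) x - D (\<psi> n) x) - (D f x - D g x)"
        unfolding W_def using 1(2) 2(2) 3(2) by eventually_elim simp
      moreover have "in_L2 UI (D (W n))" unfolding W_def by (rule in_H1_D(1)[OF 3(1)])
      ultimately have "L2norm UI (D (W n))
          = L2norm UI (\<lambda>x. (D (\<phi> n) x - D (\<psi> n) x) - (D f x - D g x))"
        using H by (intro L2norm_cong_AE) (auto intro!: in_L2_diff in_H1_D)
      also have "\<dots> \<le> L2norm UI (\<lambda>x. D (\<phi> n) x - D f x) + L2norm UI (\<lambda>x. D (\<psi> n) x - D g x)"
        using H by (intro step in_H1_D)
      finally show ?thesis .
    qed
    then show "\<forall>n. L2norm UI (D (W n)) \<le> L2norm UI (\<lambda>x. D (\<phi> n) x - D f x)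
          + L2norm UI (\<lambda>x. D (\<psi> n) x - D g x)" by blast
    show "(\<lambda>n. L2norm UI (\<lambda>x. D (\<phi> n) x - D f x) + L2norm UI (\<lambda>x. D (\<psi> n) x - D g x))
        \<longlonglongrightarrow> 0"
      using tendsto_add[OF \<phi>(3) \<psi>(3)] by simp
  qed (simp add: L2norm_nonneg)
  ultimately have "(\<lambda>n. H1norm UI (W n)) \<longlonglongrightarrow> 0"
    by (simp add: H1norm_tendsto_iff)
  then show ?thesis
    unfolding in_H10_def W_def using in_H1_diff(1)[OF H(1,2)] test_fun_diff[OF \<phi>(1) \<psi>(1)]
    by (intro conjI exI[of _ "\<lambda>n x. \<phi> n x - \<psi> n x"]) auto
qed

lemma in_H10_scale:
  assumes f: "in_H10 UI f"
  shows "in_H10 UI (\<lambda>x. c * f x)"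
proof -
  obtain \<phi> :: "nat \<Rightarrow> real \<Rightarrow> real" where \<phi>: "\<And>n. test_fun UI (\<phi> n)"
    "(\<lambda>n. L2norm UI (\<lambda>x. \<phi> n x - f x)) \<longlonglongrightarrow> 0"
    "(\<lambda>n. L2norm UI (\<lambda>x. D (\<phi> n) x - D f x)) \<longlonglongrightarrow> 0"
    using in_H10_approx[OF f] by blast
  have H: "in_H1 UI f" "\<And>n. in_H1 UI (\<phi> n)"
    using f \<phi>(1) test_fun_H1 by (auto simp: in_H10_H1)
  have D_eq: "L2norm UI (D (\<lambda>x. c * \<phi> n x - c * f x))
      = \<bar>c\<bar> * L2norm UI (\<lambda>x. D (\<phi> n) x - D f x)" for n
  proof -
    note 1 = in_H1_scale[OF H(2)[of n], of c] and 2 = in_H1_scale[OF H(1), of c]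
    note 3 = in_H1_diff[OF 1(1) 2(1)]
    have "AE x in lebesgue_on UI. D (\<lambda>x. c * \<phi> n x - c * f x) x = c * (D (\<phi> n) x - D f x)"
      using 1(2) 2(2) 3(2) by eventually_elim (simp add: algebra_simps)
    then have "L2norm UI (D (\<lambda>x. c * \<phi> n x - c * f x)) = L2norm UI (\<lambda>x. c * (D (\<phi> n) x - D f x))"
      using H in_H1_D(1)[OF 3(1)] by (intro L2norm_cong_AE) (auto intro!: in_L2_scale in_L2_diff in_H1_D)
    then show ?thesis by (simp add: L2norm_scale)
  qed
  have "L2norm UI (\<lambda>x. c * \<phi> n x - c * f x) = \<bar>c\<bar> * L2norm UI (\<lambda>x. \<phi> n x - f x)" for n
    using L2norm_scale[of UI c "\<lambda>x. \<phi> n x - f x"] by (simp add: algebra_simps)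
  then have "(\<lambda>n. H1norm UI (\<lambda>x. c * \<phi> n x - c * f x)) \<longlonglongrightarrow> 0"
    using tendsto_mult_left[OF \<phi>(2), of "\<bar>c\<bar>"] tendsto_mult_left[OF \<phi>(3), of "\<bar>c\<bar>"]
    by (simp add: H1norm_tendsto_iff D_eq)
  then show ?thesis
    unfolding in_H10_def using in_H1_scale(1)[OF H(1)] test_fun_scale[OF \<phi>(1)]
    by (intro conjI exI[of _ "\<lambda>n x. c * \<phi> n x"]) auto
qed

text \<open>Green's formula. It holds with a test function in place of \<open>w\<close> by the definition of the weak
  derivative of \<open>D z\<close>, and both sides are continuous in \<open>w\<close> for the norm of \<open>H\<^sup>1\<close>.\<close>

lemma green:
  assumes w: "in_H10 UI w" and z: "in_H2 UI z"
  shows "ip UI (D w) (D z) = - ip UI w (laplacian UI z)"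
proof -
  obtain \<phi> :: "nat \<Rightarrow> real \<Rightarrow> real" where \<phi>: "\<And>n. test_fun UI (\<phi> n)"
    "(\<lambda>n. L2norm UI (\<lambda>x. \<phi> n x - w x)) \<longlonglongrightarrow> 0"
    "(\<lambda>n. L2norm UI (\<lambda>x. D (\<phi> n) x - D w x)) \<longlonglongrightarrow> 0"
    using in_H10_approx[OF w] by blast
  have H: "in_H1 UI w" "\<And>n. in_H1 UI (\<phi> n)" "in_H1 UI z" "in_H1 UI (D z)"
    using w z \<phi>(1) test_fun_H1 by (auto simp: in_H10_H1 in_H2_real)
  have zero: "(\<lambda>n. L2norm UI (\<lambda>x. k x - k x)) \<longlonglongrightarrow> 0" for k
    by (simp add: L2norm_zero)
  have eq: "ip UI (D (\<phi> n)) (D z) = - ip UI (\<phi> n) (D (D z))" for n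
  proof -
    have "ip UI (D z) (D (\<phi> n)) = ip UI (D z) (pd 1 (\<phi> n))"
      using H \<phi>(1) test_fun_D[OF \<phi>(1)]
      by (intro ip_cong_AE) (auto intro: in_H1_D test_fun_L2 test_fun_pd)
    also have "\<dots> = - ip UI (D (D z)) (\<phi> n)"
      by (rule weak_deriv_ip[OF in_H1_D(2)[OF H(4)] \<phi>(1)])
    finally show ?thesis by (simp add: ip_commute)
  qed
  have "(\<lambda>n. ip UI (D (\<phi> n)) (D z)) \<longlonglongrightarrow> ip UI (D w) (D z)"
    using H by (intro ip_tendsto \<phi>(3) zero always_eventually allI in_H1_D)
  moreover have "(\<lambda>n. - ip UI (\<phi> n) (D (D z))) \<longlonglongrightarrow> - ip UI w (D (D z))"
    using H by (intro tendsto_minus ip_tendsto \<phi>(2) zero always_eventually allI in_H1_D in_H1_L2)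
  ultimately show ?thesis
    unfolding laplacian_real eq using LIMSEQ_unique by blast
qed

text \<open>Agmon's inequality. The constant 1, instead of the 2 that one-sided integration would give, comes
  from integrating \<open>(\<phi>\<^sup>2)'\<close> from both end points towards \<open>x\<close> and averaging; it leaves the room
  that is needed to reach the constant 4 of the final estimate.\<close>

lemma test_fun_sup_bound:
  assumes \<phi>: "test_fun UI \<phi>" and x: "x \<in> UI"
  shows "(\<phi> x)\<^sup>2 \<le> L2norm UI \<phi> * L2norm UI (D \<phi>)"
proof -
  define F where "F y = 2 * (\<phi> y * pd 1 \<phi> y)" for y
  have cont: "continuous_on S F" for S
    unfolding F_def by (intro continuous_intros test_fun_continuous[OF \<phi>]
        test_fun_continuous[OF test_fun_pd[OF \<phi>]])
  have FTC: "(F has_integral (\<phi> d)\<^sup>2 - (\<phi> c)\<^sup>2) {c..d}" if "c \<le> d" for c d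
    unfolding F_def using DERIV_power[OF test_fun_deriv[OF \<phi>], of 2] that
    by (intro fundamental_theorem_of_calculus)
      (auto simp: has_real_derivative_iff_has_vector_derivative[symmetric] algebra_simps
        intro: has_field_derivative_at_within)
  have int_abs: "(\<lambda>y. \<bar>F y\<bar>) integrable_on {c..d}" for c d
    by (intro integrable_continuous_real continuous_intros cont)
  have le: "\<bar>(\<phi> d)\<^sup>2 - (\<phi> c)\<^sup>2\<bar> \<le> integral {c..d} (\<lambda>y. \<bar>F y\<bar>)" if "c \<le> d" for c d
    using integral_norm_bound_integral[of F "{c..d}" "\<lambda>y. \<bar>F y\<bar>"] FTC[OF that] int_abs
    by (auto simp: integral_unique has_integral_integrable)
  have "2 * (\<phi> x)\<^sup>2 \<le> integral {0..x} (\<lambda>y. \<bar>F y\<bar>) + integral {x..1} (\<lambda>y. \<bar>F y\<bar>)"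
    using le[of 0 x] le[of x 1] x test_fun_boundary[OF \<phi>] by auto
  also have "\<dots> = integral {0..1} (\<lambda>y. \<bar>F y\<bar>)"
    using x int_abs by (intro Henstock_Kurzweil_Integration.integral_combine) auto
  also have "\<dots> = 2 * ip UI (\<lambda>y. \<bar>\<phi> y\<bar>) (\<lambda>y. \<bar>pd 1 \<phi> y\<bar>)"
    using continuous_integrable_UI(2)[OF continuous_on_rabs[OF cont]]
    by (simp add: F_def ip_def abs_mult)
  also have "\<dots> \<le> 2 * (L2norm UI \<phi> * L2norm UI (D \<phi>))"
  proof -
    have L: "in_L2 UI (\<lambda>y. \<bar>\<phi> y\<bar>)" "in_L2 UI (\<lambda>y. \<bar>pd 1 \<phi> y\<bar>)"
      using test_fun_L2[OF \<phi>] test_fun_L2[OF test_fun_pd[OF \<phi>]] by (auto simp: in_L2_def)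
    have "L2norm UI (D \<phi>) = L2norm UI (pd 1 \<phi>)"
      using test_fun_D[OF \<phi>] test_fun_H1[OF \<phi>] test_fun_pd[OF \<phi>]
      by (intro L2norm_cong_AE) (auto intro: in_H1_D test_fun_L2)
    then show ?thesis using ip_Cauchy_Schwarz[OF L] by (simp add: L2norm_def)
  qed
  finally show ?thesis by simp
qed

text \<open>The bound passes to the closure of the test functions: the part of \<open>\<bar>w\<bar>\<close> that exceeds the
  bound has norm at most the distance to an approximating test function plus the difference of
  the bounds.\<close>

lemma in_H10_sup_bound:
  assumes w: "in_H10 UI w"
  shows "AE x in lebesgue_on UI. (w x)\<^sup>2 \<le> L2norm UI w * L2norm UI (D w)"
proof -
  obtain \<phi> :: "nat \<Rightarrow> real \<Rightarrow> real" where \<phi>: "\<And>n. test_fun UI (\<phi> n)"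
    "(\<lambda>n. L2norm UI (\<lambda>x. \<phi> n x - w x)) \<longlonglongrightarrow> 0"
    "(\<lambda>n. L2norm UI (\<lambda>x. D (\<phi> n) x - D w x)) \<longlonglongrightarrow> 0"
    using in_H10_approx[OF w] by blast
  have H: "in_H1 UI w" "\<And>n. in_H1 UI (\<phi> n)"
    using w \<phi>(1) test_fun_H1 by (auto simp: in_H10_H1)
  have L: "in_L2 UI w" "\<And>n. in_L2 UI (\<phi> n)" "in_L2 UI (D w)" "\<And>n. in_L2 UI (D (\<phi> n))"
    using H in_H1_L2 in_H1_D(1) by auto
  have norm_lim: "(\<lambda>n. L2norm UI (F n)) \<longlonglongrightarrow> L2norm UI f"
    if "\<And>n. in_L2 UI (F n)" "in_L2 UI f" "(\<lambda>n. L2norm UI (\<lambda>x. F n x - f x)) \<longlonglongrightarrow> 0" for F f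
  proof -
    have "(\<lambda>n. L2norm UI (F n) - L2norm UI f) \<longlonglongrightarrow> 0"
      by (rule Lim_null_comparison[OF always_eventually that(3)])
        (use L2norm_diff_lower[OF that(1,2)] in auto)
    then show ?thesis by (simp add: LIM_zero_iff)
  qed
  define c where "c = sqrt (L2norm UI w * L2norm UI (D w))"
  define cn where "cn n = sqrt (L2norm UI (\<phi> n) * L2norm UI (D (\<phi> n)))" for n
  have cn: "cn \<longlonglongrightarrow> c"
    unfolding c_def cn_def using norm_lim[OF L(2,1) \<phi>(2)] norm_lim[OF L(4,3) \<phi>(3)]
    by (intro tendsto_intros)
  define e where "e x = max 0 (\<bar>w x\<bar> - c)" for x
  define k where "k n = (\<lambda>x. \<bar>\<phi> n x - w x\<bar> + \<bar>cn n - c\<bar>)" for n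
  have \<phi>_le: "\<bar>\<phi> n x\<bar> \<le> cn n" if "x \<in> UI" for n x
    unfolding cn_def using test_fun_sup_bound[OF \<phi>(1) that] by (simp add: real_le_rsqrt)
  have e_le: "AE x in lebesgue_on UI. \<bar>e x\<bar> \<le> \<bar>k n x\<bar>" for n
  proof (rule AE_I2)
    fix x assume "x \<in> space (lebesgue_on UI)"
    then have "\<bar>\<phi> n x\<bar> \<le> cn n" by (intro \<phi>_le) simp
    then show "\<bar>e x\<bar> \<le> \<bar>k n x\<bar>" unfolding e_def k_def by linarith
  qed
  have labs: "in_L2 UI (\<lambda>x. \<bar>\<phi> n x - w x\<bar>)" for n
    using in_L2_diff[OF L(2)[of n] L(1)] by (auto simp: in_L2_def)
  have kL: "in_L2 UI (k n)" for n
    unfolding k_def by (intro in_L2_add labs in_L2_UI_const)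
  have em: "e \<in> borel_measurable (lebesgue_on UI)"
    unfolding e_def using in_L2_measurable[OF L(1)] by auto
  have bound: "L2norm UI e \<le> L2norm UI (\<lambda>x. \<phi> n x - w x) + \<bar>cn n - c\<bar> * L2norm UI (\<lambda>x. 1)" for n
  proof -
    have "L2norm UI e \<le> L2norm UI (k n)" by (rule L2norm_mono_AE(2)[OF kL em e_le])
    also have "\<dots> \<le> L2norm UI (\<lambda>x. \<bar>\<phi> n x - w x\<bar>) + L2norm UI (\<lambda>x. \<bar>cn n - c\<bar>)"
      unfolding k_def by (rule L2norm_triangle[OF labs in_L2_UI_const])
    also have "\<dots> = L2norm UI (\<lambda>x. \<phi> n x - w x) + \<bar>cn n - c\<bar> * L2norm UI (\<lambda>x. 1)"
      using L2norm_scale[of UI "\<bar>cn n - c\<bar>" "\<lambda>x. 1"] by (simp add: L2norm_def)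
    finally show ?thesis .
  qed
  have "(\<lambda>n. L2norm UI (\<lambda>x. \<phi> n x - w x) + \<bar>cn n - c\<bar> * L2norm UI (\<lambda>x. 1))
      \<longlonglongrightarrow> 0 + \<bar>c - c\<bar> * L2norm UI (\<lambda>x. 1)"
    by (intro tendsto_intros \<phi>(2) cn)
  then have "L2norm UI e \<le> 0"
    using bound by (intro LIMSEQ_le_const) auto
  then have "L2norm UI e = 0" using L2norm_nonneg[of UI e] by simp
  moreover have "in_L2 UI e" by (rule L2norm_mono_AE(1)[OF kL em e_le])
  ultimately have "AE x in lebesgue_on UI. e x = 0" by (rule L2norm_eq_0_AE[rotated])
  then show ?thesis
  proof eventually_elim
    case (elim x)
    then have "\<bar>w x\<bar> \<le> c" by (simp add: e_def max_def split: if_splits)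
    then have "\<bar>w x\<bar>\<^sup>2 \<le> c\<^sup>2" by (rule power_mono) simp
    then show ?case by (simp add: c_def L2norm_nonneg)
  qed
qed

section \<open>Strong time derivatives\<close>

lemma eventually_half_line:
  "\<forall>\<^sub>F s in at (t::real) within {0..}. 0 \<le> s \<and> s \<noteq> t"
  by (simp add: eventually_at_filter)

lemma tdifferentiableD: "tdifferentiable \<Omega> u \<Longrightarrow> 0 \<le> t \<Longrightarrow> has_tderiv \<Omega> u (tderiv \<Omega> u t) t"
  unfolding tdifferentiable_def tderiv_def
  by (rule someI_ex[of "\<lambda>w. has_tderiv \<Omega> u w t"]) simp

lemma has_tderiv_L2: "has_tderiv \<Omega> u w t \<Longrightarrow> in_L2 \<Omega> w" "has_tderiv \<Omega> u w t \<Longrightarrow> 0 \<le> s \<Longrightarrow> in_L2 \<Omega> (u s)"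
  by (auto simp: has_tderiv_def)

lemma has_tderiv_lim:
  "has_tderiv \<Omega> u w t \<Longrightarrow>
    ((\<lambda>s. L2norm \<Omega> (\<lambda>x. (u s x - u t x) / (s - t) - w x)) \<longlongrightarrow> 0) (at t within {0..})"
  by (simp add: has_tderiv_def)

lemma eventually_half_lineI:
  assumes "\<And>s. 0 \<le> s \<Longrightarrow> s \<noteq> t \<Longrightarrow> P s"
  shows "\<forall>\<^sub>F s in at (t::real) within {0..}. P s"
  using eventually_half_line by eventually_elim (use assms in auto)

lemma has_tderiv_continuous:
  assumes u: "has_tderiv \<Omega> u w t" and t: "0 \<le> t"
  shows "((\<lambda>s. L2norm \<Omega> (\<lambda>x. u s x - u t x)) \<longlongrightarrow> 0) (at t within {0..})"
proof -
  let ?F = "at t within {0..}"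
  let ?q = "\<lambda>s. L2norm \<Omega> (\<lambda>x. (u s x - u t x) / (s - t) - w x)"
  have "\<forall>\<^sub>F s in ?F. norm (L2norm \<Omega> (\<lambda>x. u s x - u t x)) \<le> \<bar>s - t\<bar> * (?q s + L2norm \<Omega> w)"
    using eventually_half_line
  proof eventually_elim
    case (elim s)
    have eq: "L2norm \<Omega> (\<lambda>x. u s x - u t x) = \<bar>s - t\<bar> * L2norm \<Omega> (\<lambda>x. (u s x - u t x) / (s - t))"
      using elim by (simp add: L2norm_divide)
    have "L2norm \<Omega> (\<lambda>x. (u s x - u t x) / (s - t)) \<le> ?q s + L2norm \<Omega> w"
      using L2norm_triangle[of \<Omega> "\<lambda>x. (u s x - u t x) / (s - t) - w x" w] elim t
        has_tderiv_L2[OF u] by (simp add: in_L2_intros)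
    then have "L2norm \<Omega> (\<lambda>x. u s x - u t x) \<le> \<bar>s - t\<bar> * (?q s + L2norm \<Omega> w)"
      unfolding eq by (rule mult_left_mono) simp
    then show ?case by (simp add: abs_of_nonneg[OF L2norm_nonneg])
  qed
  moreover have "((\<lambda>s. \<bar>s - t\<bar> * (?q s + L2norm \<Omega> w)) \<longlongrightarrow> \<bar>t - t\<bar> * (0 + L2norm \<Omega> w)) ?F"
    by (intro tendsto_mult tendsto_add tendsto_rabs tendsto_diff tendsto_ident_at tendsto_const
        has_tderiv_lim[OF u])
  then have "((\<lambda>s. \<bar>s - t\<bar> * (?q s + L2norm \<Omega> w)) \<longlongrightarrow> 0) ?F" by simp
  ultimately show ?thesis by (rule Lim_null_comparison)
qed

text \<open>The product rule: the difference quotient of the inner product is the sum of the inner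
  products of the difference quotients with the curves, which converge in norm.\<close>

lemma has_tderiv_ip:
  assumes u: "has_tderiv \<Omega> u u' t" and w: "has_tderiv \<Omega> w w' t" and t: "0 \<le> t"
  shows "((\<lambda>s. ip \<Omega> (u s) (w s)) has_real_derivative ip \<Omega> u' (w t) + ip \<Omega> (u t) w')
    (at t within {0..})"
proof -
  let ?F = "at t within {0..}"
  let ?q = "\<lambda>v s x. (v s x - v t x) / (s - t)"
  note L = has_tderiv_L2[OF u] has_tderiv_L2[OF w]
  have qL: "\<forall>\<^sub>F s in ?F. in_L2 \<Omega> (?q u s)" "\<forall>\<^sub>F s in ?F. in_L2 \<Omega> (?q w s)"
    "\<forall>\<^sub>F s in ?F. in_L2 \<Omega> (w s)"
    using L t by (auto intro!: eventually_half_lineI in_L2_intros)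
  have "((\<lambda>s. ip \<Omega> (?q u s) (w s) + ip \<Omega> (u t) (?q w s))
      \<longlongrightarrow> ip \<Omega> u' (w t) + ip \<Omega> (u t) w') ?F"
    using L t
    by (intro tendsto_add ip_tendsto qL has_tderiv_lim[OF u] has_tderiv_lim[OF w]
        has_tderiv_continuous[OF w]) (auto simp: L2norm_zero)
  then have "((\<lambda>s. (ip \<Omega> (u s) (w s) - ip \<Omega> (u t) (w t)) / (s - t))
      \<longlongrightarrow> ip \<Omega> u' (w t) + ip \<Omega> (u t) w') ?F"
  proof (rule Lim_transform_eventually)
    show "\<forall>\<^sub>F s in ?F. ip \<Omega> (?q u s) (w s) + ip \<Omega> (u t) (?q w s)
        = (ip \<Omega> (u s) (w s) - ip \<Omega> (u t) (w t)) / (s - t)"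
      using eventually_half_line
      by eventually_elim
        (use L t in \<open>simp add: ip_left ip_right in_L2_intros diff_divide_distrib\<close>)
  qed
  then show ?thesis by (simp add: has_field_derivative_iff)
qed

lemma has_tderiv_const: "in_L2 \<Omega> z \<Longrightarrow> has_tderiv \<Omega> (\<lambda>s. z) (\<lambda>x. 0) t"
  by (simp add: has_tderiv_def in_L2_zero L2norm_zero)

lemma has_tderiv_bounded_mult:
  assumes u: "has_tderiv \<Omega> u w t" and t: "0 \<le> t"
    and b: "b \<in> borel_measurable (lebesgue_on \<Omega>)"
      "AE x in lebesgue_on \<Omega>. \<bar>b x\<bar> \<le> B" "0 \<le> B"
  shows "has_tderiv \<Omega> (\<lambda>s x. b x * u s x) (\<lambda>x. b x * w x) t"
  unfolding has_tderiv_def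
proof (intro conjI allI impI)
  note L = has_tderiv_L2[OF u]
  show "in_L2 \<Omega> (\<lambda>x. b x * w x)" by (rule L2norm_bounded_mult(1)[OF L(1) b])
  show "in_L2 \<Omega> (\<lambda>x. b x * u s x)" if "0 \<le> s" for s
    by (rule L2norm_bounded_mult(1)[OF L(2)[OF that] b])
  have "\<forall>\<^sub>F s in at t within {0..}.
      norm (L2norm \<Omega> (\<lambda>x. (b x * u s x - b x * u t x) / (s - t) - b x * w x))
      \<le> B * L2norm \<Omega> (\<lambda>x. (u s x - u t x) / (s - t) - w x)"
    using eventually_half_line
  proof eventually_elim
    case (elim s)
    have "in_L2 \<Omega> (\<lambda>x. (u s x - u t x) / (s - t) - w x)"
      using L elim t by (intro in_L2_intros) auto
    from L2norm_bounded_mult(2)[OF this b] show ?case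
      by (simp add: L2norm_nonneg algebra_simps)
  qed
  moreover have "((\<lambda>s. B * L2norm \<Omega> (\<lambda>x. (u s x - u t x) / (s - t) - w x)) \<longlongrightarrow> 0)
      (at t within {0..})"
    using tendsto_mult_right_zero[OF has_tderiv_lim[OF u]] .
  ultimately show "((\<lambda>s. L2norm \<Omega> (\<lambda>x. (b x * u s x - b x * u t x) / (s - t) - b x * w x))
      \<longlongrightarrow> 0) (at t within {0..})"
    by (rule Lim_null_comparison)
qed

lemma tendsto_shift_half_line:
  fixes f :: "real \<Rightarrow> real"
  assumes f: "(f \<longlongrightarrow> l) (at (t + h) within {0..})" and h: "0 \<le> h"
  shows "((\<lambda>s. f (s + h)) \<longlongrightarrow> l) (at t within {0..})"
proof (rule filterlim_compose[OF f])
  show "filterlim (\<lambda>s. s + h) (at (t + h) within {0..}) (at t within {0..})"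
    unfolding filterlim_at using h eventually_half_line[of t]
    by (auto intro!: tendsto_intros elim: eventually_mono)
qed

definition dquot :: "real \<Rightarrow> (real \<Rightarrow> 'a \<Rightarrow> real) \<Rightarrow> real \<Rightarrow> 'a \<Rightarrow> real" where
  "dquot h u t x = (u (t + h) x - u t x) / h"

lemma dquot_L2:
  assumes "\<And>s. 0 \<le> s \<Longrightarrow> in_L2 \<Omega> (u s)" "0 \<le> t" "0 \<le> h"
  shows "in_L2 \<Omega> (dquot h u t)"
  unfolding dquot_def using assms by (intro in_L2_intros) auto

lemma has_tderiv_dquot:
  assumes u: "has_tderiv \<Omega> u (w (t + h)) (t + h)" "has_tderiv \<Omega> u (w t) t"
    and t: "0 \<le> t" and h: "0 < h"
  shows "has_tderiv \<Omega> (dquot h u) (dquot h w t) t"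
  unfolding has_tderiv_def
proof (intro conjI allI impI)
  note L = has_tderiv_L2[OF u(1)] has_tderiv_L2[OF u(2)]
  show "in_L2 \<Omega> (dquot h w t)" unfolding dquot_def using L by (intro in_L2_intros) auto
  show "in_L2 \<Omega> (dquot h u s)" if "0 \<le> s" for s
    using L that h by (intro dquot_L2) auto
  let ?q = "\<lambda>r s. L2norm \<Omega> (\<lambda>x. (u s x - u r x) / (s - r) - w r x)"
  have "\<forall>\<^sub>F s in at t within {0..}.
      norm (L2norm \<Omega> (\<lambda>x. (dquot h u s x - dquot h u t x) / (s - t) - dquot h w t x))
      \<le> (?q (t + h) (s + h) + ?q t s) / h"
    using eventually_half_line
  proof eventually_elim
    case (elim s)
    let ?A = "\<lambda>x. (u (s + h) x - u (t + h) x) / ((s + h) - (t + h)) - w (t + h) x"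
    let ?B = "\<lambda>x. (u s x - u t x) / (s - t) - w t x"
    have AB: "in_L2 \<Omega> ?A" "in_L2 \<Omega> ?B"
      using L elim t h by (auto intro!: in_L2_intros)
    have "(\<lambda>x. (dquot h u s x - dquot h u t x) / (s - t) - dquot h w t x) = (\<lambda>x. (?A x - ?B x) / h)"
      by (simp add: fun_eq_iff dquot_def diff_divide_distrib mult.commute)
    then have "L2norm \<Omega> (\<lambda>x. (dquot h u s x - dquot h u t x) / (s - t) - dquot h w t x)
        = L2norm \<Omega> (\<lambda>x. ?A x - ?B x) / h"
      using h by (simp add: L2norm_divide)
    also have "\<dots> \<le> (L2norm \<Omega> ?A + L2norm \<Omega> ?B) / h"
    proof (rule divide_right_mono)
      show "L2norm \<Omega> (\<lambda>x. ?A x - ?B x) \<le> L2norm \<Omega> ?A + L2norm \<Omega> ?B"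
        using L2norm_triangle_diff[OF AB(1) in_L2_zero AB(2)]
        unfolding L2norm_minus_commute[of \<Omega> "\<lambda>x. 0" ?B] by (simp only: diff_zero)
    qed (use h in simp)
    finally show ?case by (simp add: L2norm_nonneg)
  qed
  moreover have "((\<lambda>s. (?q (t + h) (s + h) + ?q t s) / h) \<longlongrightarrow> (0 + 0) / h) (at t within {0..})"
    using tendsto_shift_half_line[OF has_tderiv_lim[OF u(1)]] has_tderiv_lim[OF u(2)] h
    by (intro tendsto_intros) auto
  then have "((\<lambda>s. (?q (t + h) (s + h) + ?q t s) / h) \<longlongrightarrow> 0) (at t within {0..})" by simp
  ultimately show "((\<lambda>s. L2norm \<Omega> (\<lambda>x. (dquot h u s x - dquot h u t x) / (s - t) - dquot h w t x))
      \<longlongrightarrow> 0) (at t within {0..})"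
    by (rule Lim_null_comparison)
qed

lemma tendsto_at_right_0_half_line:
  fixes f :: "real \<Rightarrow> real"
  assumes f: "(f \<longlongrightarrow> l) (at t within {0..})" and t: "0 \<le> t"
  shows "((\<lambda>h. f (t + h)) \<longlongrightarrow> l) (at_right 0)"
proof (rule filterlim_compose[OF f])
  show "filterlim (\<lambda>h. t + h) (at t within {0..}) (at_right 0)"
    unfolding filterlim_at using t
    by (auto intro!: tendsto_eq_intros simp: eventually_at_filter)
qed

lemma dquot_tendsto:
  assumes u: "has_tderiv \<Omega> u w t" and t: "0 \<le> t"
  shows "((\<lambda>h. L2norm \<Omega> (\<lambda>x. dquot h u t x - w x)) \<longlongrightarrow> 0) (at_right 0)"
  using tendsto_at_right_0_half_line[OF has_tderiv_lim[OF u] t] by (simp add: dquot_def)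

section \<open>The energy identity\<close>

text \<open>The gradient energy is differentiable in time although the gradient of the velocity does
  not occur in its derivative: by Green's formula the increment of \<open>\<parallel>D u\<parallel>\<^sup>2\<close> from \<open>t\<close> to \<open>s\<close>
  pairs \<open>u s - u t\<close> with the Laplacian of \<open>u s + u t\<close>.\<close>

lemma gradient_energy_deriv:
  assumes u: "has_tderiv UI u w t" and t: "0 \<le> t"
    and reg: "\<And>s. 0 \<le> s \<Longrightarrow> in_H10 UI (u s)" "\<And>s. 0 \<le> s \<Longrightarrow> in_H2 UI (u s)"
    and cont: "((\<lambda>s. L2norm UI (\<lambda>x. laplacian UI (u s) x - laplacian UI (u t) x)) \<longlongrightarrow> 0)
      (at t within {0..})"
  shows "((\<lambda>s. ip UI (D (u s)) (D (u s))) has_real_derivative - 2 * ip UI w (laplacian UI (u t)))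
    (at t within {0..})"
proof -
  let ?F = "at t within {0..}"
  let ?q = "\<lambda>s x. (u s x - u t x) / (s - t)"
  note L = has_tderiv_L2[OF u]
  have lapL: "in_L2 UI (laplacian UI (u s))" if "0 \<le> s" for s
    by (rule in_H2_laplacian_L2[OF reg(2)[OF that]])
  have qL: "\<forall>\<^sub>F s in ?F. in_L2 UI (?q s)"
    using L t by (auto intro!: eventually_half_lineI in_L2_intros)
  have lapev: "\<forall>\<^sub>F s in ?F. in_L2 UI (laplacian UI (u s))"
    using lapL by (auto intro!: eventually_half_lineI)
  have "((\<lambda>s. - ip UI (?q s) (laplacian UI (u s)) - ip UI (?q s) (laplacian UI (u t)))
      \<longlongrightarrow> - ip UI w (laplacian UI (u t)) - ip UI w (laplacian UI (u t))) ?F"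
    using L lapL t
    by (intro tendsto_diff tendsto_minus ip_tendsto qL lapev has_tderiv_lim[OF u] cont)
      (auto simp: L2norm_zero)
  then have "((\<lambda>s. - ip UI (?q s) (laplacian UI (u s)) - ip UI (?q s) (laplacian UI (u t)))
      \<longlongrightarrow> - 2 * ip UI w (laplacian UI (u t))) ?F" by simp
  then have "((\<lambda>s. (ip UI (D (u s)) (D (u s)) - ip UI (D (u t)) (D (u t))) / (s - t))
      \<longlongrightarrow> - 2 * ip UI w (laplacian UI (u t))) ?F"
  proof (rule Lim_transform_eventually)
    show "\<forall>\<^sub>F s in ?F. - ip UI (?q s) (laplacian UI (u s)) - ip UI (?q s) (laplacian UI (u t))
        = (ip UI (D (u s)) (D (u s)) - ip UI (D (u t)) (D (u t))) / (s - t)"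
      using eventually_half_line
    proof eventually_elim
      case (elim s)
      have sym: "ip UI (u s) (laplacian UI (u t)) = ip UI (u t) (laplacian UI (u s))"
        using green[OF reg(1) reg(2), of s t] green[OF reg(1) reg(2), of t s] elim t
        by (simp add: ip_commute)
      have "ip UI (D (u s)) (D (u s)) - ip UI (D (u t)) (D (u t))
          = - ip UI (u s) (laplacian UI (u s)) + ip UI (u t) (laplacian UI (u t))"
        using green[OF reg(1) reg(2), of s s] green[OF reg(1) reg(2), of t t] elim t by simp
      also have "\<dots> = - ip UI (\<lambda>x. u s x - u t x) (laplacian UI (u s))
          - ip UI (\<lambda>x. u s x - u t x) (laplacian UI (u t))"
        using L lapL elim t sym by (simp add: ip_diff_left)
      finally show ?case unfolding ip_divide_left by (simp add: diff_divide_distrib)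
    qed
  qed
  then show ?thesis by (simp add: has_field_derivative_iff)
qed

text \<open>The velocities are independent arguments, so that the energy identity also applies to difference
  quotients, whose velocities are given by explicit functions.\<close>

definition energy_state ::
  "(real \<Rightarrow> real) \<Rightarrow> (real \<Rightarrow> real) \<Rightarrow> (real \<Rightarrow> real) \<Rightarrow> (real \<Rightarrow> real) \<Rightarrow> (real \<Rightarrow> real) \<Rightarrow> real" where
  "energy_state b f g p q =
     1/2 * (LINT x|lebesgue_on UI. grad_sq UI f x + grad_sq UI g x + (p x)\<^sup>2 + (q x)\<^sup>2)
     + (LINT x|lebesgue_on UI. b x * f x * g x)"

lemma energy_eq_energy_state:
  "energy UI b u v t = energy_state b (u t) (v t) (tderiv UI u t) (tderiv UI v t)"
  by (simp add: energy_def energy_state_def)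

lemma energy_state_eq:
  assumes "in_H1 UI f" "in_H1 UI g" "in_L2 UI p" "in_L2 UI q"
  shows "energy_state b f g p q
    = 1/2 * (ip UI (D f) (D f) + ip UI (D g) (D g) + ip UI p p + ip UI q q)
      + ip UI (\<lambda>x. b x * f x) g"
proof -
  have "integrable (lebesgue_on UI) (\<lambda>x. (h x)\<^sup>2)" if "in_L2 UI h" for h
    using that by (simp add: in_L2_def)
  with assms show ?thesis
    by (simp add: energy_state_def ip_def grad_sq_real in_H1_D power2_eq_square[symmetric])
qed

text \<open>The coupling is subordinate to the Dirichlet energy when \<open>b\<close> is bounded by the reciprocal
  of the squared Poincare constant.\<close>

locale subcritical_coupling =
  fixes b :: "real \<Rightarrow> real" and B lam :: real
  assumes b_measurable: "b \<in> borel_measurable (lebesgue_on UI)"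
    and b_le: "AE x in lebesgue_on UI. \<bar>b x\<bar> \<le> B"
    and B_nonneg: "0 \<le> B"
    and poincare: "poincare_constant UI lam"
    and subcritical: "B * lam\<^sup>2 \<le> 1"
begin

lemma coupling_L2: "in_L2 UI f \<Longrightarrow> in_L2 UI (\<lambda>x. b x * f x)"
  by (rule L2norm_bounded_mult(1)[OF _ b_measurable b_le B_nonneg])

lemma coupling_bound:
  assumes "in_L2 UI f" "in_L2 UI g"
  shows "\<bar>ip UI (\<lambda>x. b x * f x) g\<bar> \<le> B * (L2norm UI f * L2norm UI g)"
proof -
  have "\<bar>ip UI (\<lambda>x. b x * f x) g\<bar> \<le> L2norm UI (\<lambda>x. b x * f x) * L2norm UI g"
    by (rule ip_Cauchy_Schwarz[OF coupling_L2[OF assms(1)] assms(2)])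
  also have "\<dots> \<le> (B * L2norm UI f) * L2norm UI g"
    using L2norm_bounded_mult(2)[OF assms(1) b_measurable b_le B_nonneg] L2norm_nonneg
    by (rule mult_right_mono)
  finally show ?thesis by simp
qed

lemma poincare_sq:
  assumes "in_H10 UI w"
  shows "(L2norm UI w)\<^sup>2 \<le> lam\<^sup>2 * (L2norm UI (D w))\<^sup>2"
proof -
  have "L2norm UI w \<le> lam * L2norm UI (D w)"
    using poincare assms by (simp add: poincare_constant_def L2norm_def grad_sq_real)
  then have "(L2norm UI w)\<^sup>2 \<le> (lam * L2norm UI (D w))\<^sup>2"
    using L2norm_nonneg by (intro power_mono) auto
  then show ?thesis by (simp add: power_mult_distrib)
qed

lemma energy_state_ge_kinetic:
  assumes f: "in_H10 UI f" and g: "in_H10 UI g" and "in_L2 UI p" "in_L2 UI q"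
  shows "ip UI p p + ip UI q q \<le> 2 * energy_state b f g p q"
proof -
  let ?F = "L2norm UI f" and ?G = "L2norm UI g"
  have H: "in_H1 UI f" "in_H1 UI g" using f g by (auto simp: in_H10_H1)
  have "\<bar>ip UI (\<lambda>x. b x * f x) g\<bar> \<le> B * (?F * ?G)"
    using H by (intro coupling_bound in_H1_L2)
  also have "\<dots> \<le> B * ((?F\<^sup>2 + ?G\<^sup>2) / 2)"
    using sum_squares_bound[of ?F ?G] B_nonneg by (intro mult_left_mono) auto
  also have "\<dots> \<le> B * (lam\<^sup>2 * ((L2norm UI (D f))\<^sup>2 + (L2norm UI (D g))\<^sup>2) / 2)"
    using poincare_sq[OF f] poincare_sq[OF g] B_nonneg
    by (intro mult_left_mono) (auto simp: algebra_simps)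
  also have "\<dots> = (B * lam\<^sup>2) * (((L2norm UI (D f))\<^sup>2 + (L2norm UI (D g))\<^sup>2) / 2)" by simp
  also have "\<dots> \<le> 1 * (((L2norm UI (D f))\<^sup>2 + (L2norm UI (D g))\<^sup>2) / 2)"
    by (intro mult_right_mono subcritical) auto
  finally show ?thesis
    using energy_state_eq[OF H assms(3,4), of b] abs_ge_minus_self[of "ip UI (\<lambda>x. b x * f x) g"]
    unfolding L2norm_sq by argo
qed

text \<open>Absorbing the coupling term into the gradients would cost a factor that blows up as \<open>B\<close>
  becomes critical. It is therefore kept as a multiple of the squared \<open>L\<^sup>2\<close> norms: applied to the
  velocities, these are bounded by the energy, which becomes small along a decaying solution.\<close>

lemma energy_state_ge_gradient:
  assumes f: "in_H10 UI f" and g: "in_H10 UI g" and "in_L2 UI p" "in_L2 UI q"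
  shows "(L2norm UI (D f))\<^sup>2
    \<le> 2 * energy_state b f g p q + B * (ip UI f f + ip UI g g)"
proof -
  let ?F = "L2norm UI f" and ?G = "L2norm UI g"
  have H: "in_H1 UI f" "in_H1 UI g" using f g by (auto simp: in_H10_H1)
  have "\<bar>ip UI (\<lambda>x. b x * f x) g\<bar> \<le> B * (?F * ?G)"
    using H by (intro coupling_bound in_H1_L2)
  also have "\<dots> \<le> B * ((?F\<^sup>2 + ?G\<^sup>2) / 2)"
    using sum_squares_bound[of ?F ?G] B_nonneg by (intro mult_left_mono) auto
  finally have "2 * \<bar>ip UI (\<lambda>x. b x * f x) g\<bar> \<le> B * (ip UI f f + ip UI g g)"
    by (simp add: L2norm_sq)
  then show ?thesis
    using energy_state_eq[OF H assms(3,4), of b] ip_self_nonneg[of UI "D g"]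
      ip_self_nonneg[of UI p] ip_self_nonneg[of UI q] abs_ge_minus_self[of "ip UI (\<lambda>x. b x * f x) g"]
    unfolding L2norm_sq by argo
qed

text \<open>In the derivative of the energy, each velocity is paired with the terms of the equation of its
  component; the symmetry of the coupling is used to distribute the derivative of
  \<open>\<integral> b u v\<close> to the two equations.\<close>

lemma energy_identity:
  assumes t: "0 \<le> t"
    and reg: "\<And>s. 0 \<le> s \<Longrightarrow> in_H10 UI (u s)" "\<And>s. 0 \<le> s \<Longrightarrow> in_H2 UI (u s)"
      "\<And>s. 0 \<le> s \<Longrightarrow> in_H10 UI (v s)" "\<And>s. 0 \<le> s \<Longrightarrow> in_H2 UI (v s)"
    and cont: "((\<lambda>s. L2norm UI (\<lambda>x. laplacian UI (u s) x - laplacian UI (u t) x)) \<longlongrightarrow> 0)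
        (at t within {0..})"
      "((\<lambda>s. L2norm UI (\<lambda>x. laplacian UI (v s) x - laplacian UI (v t) x)) \<longlongrightarrow> 0)
        (at t within {0..})"
    and der: "has_tderiv UI u (p t) t" "has_tderiv UI v (q t) t"
      "has_tderiv UI p r t" "has_tderiv UI q z t"
    and f: "in_L2 UI f"
    and eq1: "AE x in lebesgue_on UI. r x - laplacian UI (u t) x + b x * v t x + f x = 0"
    and eq2: "AE x in lebesgue_on UI. z x - laplacian UI (v t) x + b x * u t x = 0"
  shows "((\<lambda>s. energy_state b (u s) (v s) (p s) (q s)) has_real_derivative - ip UI f (p t))
    (at t within {0..})"
proof -
  note L = has_tderiv_L2[OF der(1)] has_tderiv_L2[OF der(2)]
    has_tderiv_L2[OF der(3)] has_tderiv_L2[OF der(4)]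
  have lapL: "in_L2 UI (laplacian UI (u t))" "in_L2 UI (laplacian UI (v t))"
    using reg t by (auto intro: in_H2_laplacian_L2)
  let ?E = "\<lambda>s. 1/2 * (ip UI (D (u s)) (D (u s)) + ip UI (D (v s)) (D (v s))
      + ip UI (p s) (p s) + ip UI (q s) (q s)) + ip UI (\<lambda>x. b x * u s x) (v s)"
  have "(?E has_real_derivative 1/2 * (- 2 * ip UI (p t) (laplacian UI (u t))
        + - 2 * ip UI (q t) (laplacian UI (v t)) + (ip UI r (p t) + ip UI (p t) r)
        + (ip UI z (q t) + ip UI (q t) z))
      + (ip UI (\<lambda>x. b x * p t x) (v t) + ip UI (\<lambda>x. b x * u t x) (q t))) (at t within {0..})"
    using t reg
    by (intro DERIV_add DERIV_cmult gradient_energy_deriv has_tderiv_ip der cont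
        has_tderiv_bounded_mult[OF _ _ b_measurable b_le B_nonneg])
  moreover have "ip UI (p t) r - ip UI (p t) (laplacian UI (u t)) + ip UI (p t) (\<lambda>x. b x * v t x) = - ip UI f (p t)"
  proof -
    have "ip UI (p t) (\<lambda>x. r x - laplacian UI (u t) x + b x * v t x) = ip UI (p t) (\<lambda>x. - f x)"
    proof (rule ip_cong_AE)
      show "AE x in lebesgue_on UI. r x - laplacian UI (u t) x + b x * v t x = - f x"
        using eq1 by eventually_elim simp
    qed (use L lapL f t coupling_L2 in \<open>auto intro!: in_L2_intros\<close>)
    moreover have "ip UI (p t) (\<lambda>x. r x - laplacian UI (u t) x + b x * v t x)
        = ip UI (p t) r - ip UI (p t) (laplacian UI (u t)) + ip UI (p t) (\<lambda>x. b x * v t x)"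
      using L lapL t coupling_L2 by (simp add: ip_add_right ip_diff_right in_L2_intros)
    ultimately show ?thesis by (simp add: ip_uminus_right ip_commute)
  qed
  moreover have "ip UI (q t) z - ip UI (q t) (laplacian UI (v t)) + ip UI (q t) (\<lambda>x. b x * u t x) = 0"
  proof -
    have "ip UI (q t) (\<lambda>x. z x - laplacian UI (v t) x + b x * u t x) = ip UI (q t) (\<lambda>x. 0)"
      by (rule ip_cong_AE[OF _ _ _ _ _ eq2])
        (use L lapL f t coupling_L2 in \<open>auto intro!: in_L2_intros\<close>)
    moreover have "ip UI (q t) (\<lambda>x. z x - laplacian UI (v t) x + b x * u t x)
        = ip UI (q t) z - ip UI (q t) (laplacian UI (v t)) + ip UI (q t) (\<lambda>x. b x * u t x)"
      using L lapL t coupling_L2 by (simp add: ip_add_right ip_diff_right in_L2_intros)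
    ultimately show ?thesis by (simp add: ip_def)
  qed
  moreover have "ip UI (\<lambda>x. b x * p t x) (v t) = ip UI (p t) (\<lambda>x. b x * v t x)"
    by (simp add: ip_def ac_simps)
  moreover have "ip UI r (p t) = ip UI (p t) r" "ip UI z (q t) = ip UI (q t) z"
    "ip UI (\<lambda>x. b x * u t x) (q t) = ip UI (q t) (\<lambda>x. b x * u t x)"
    by (rule ip_commute)+
  ultimately have "(?E has_real_derivative - ip UI f (p t)) (at t within {0..})"
    by (elim DERIV_cong) argo
  then show ?thesis
  proof (rule has_field_derivative_transform_within[where d = 1])
    fix s :: real assume "s \<in> {0..}" "dist s t < 1"
    then show "?E s = energy_state b (u s) (v s) (p s) (q s)"
      using L reg by (simp add: energy_state_eq in_H10_H1)
  qed (use t in auto)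
qed

end

section \<open>Difference quotients in time\<close>

lemma dquot_scale: "dquot h u t = (\<lambda>x. (1 / h) * (u (t + h) x - u t x))"
  by (simp add: dquot_def fun_eq_iff)

lemma dquot_H10:
  "in_H10 UI (u (t + h)) \<Longrightarrow> in_H10 UI (u t) \<Longrightarrow> in_H10 UI (dquot h u t)"
  unfolding dquot_scale by (intro in_H10_scale in_H10_diff)

lemma dquot_H2:
  assumes "in_H2 UI (u (t + h))" "in_H2 UI (u t)"
  shows "in_H2 UI (dquot h u t)"
    and "AE x in lebesgue_on UI. laplacian UI (dquot h u t) x
      = (laplacian UI (u (t + h)) x - laplacian UI (u t) x) / h"
proof -
  note 1 = in_H2_diff[OF assms]
  note 2 = in_H2_scale[OF 1(1), of "1 / h"]
  show "in_H2 UI (dquot h u t)" unfolding dquot_scale by (rule 2(1))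
  show "AE x in lebesgue_on UI. laplacian UI (dquot h u t) x
      = (laplacian UI (u (t + h)) x - laplacian UI (u t) x) / h"
    unfolding dquot_scale using 1(2) 2(2) by eventually_elim simp
qed

text \<open>A mean value inequality in the norm of \<open>H\<^sup>1\<^sub>0\<close>, although the curve \<open>u\<close> is only known to be
  differentiable in \<open>L\<^sup>2\<close>. Comparing the difference quotient with a test function \<open>\<phi>\<close> close to
  \<open>p t\<close>, the difference \<open>Z\<close> has a square integrable Laplacian, so that
  \<open>\<parallel>D Z\<parallel>\<^sup>2 = - \<langle>Z, \<Delta>Z\<rangle>\<close>; the mean value theorem for the scalar function \<open>s \<mapsto> \<langle>u s, \<Delta>Z\<rangle>\<close>
  replaces the difference quotient by some \<open>p \<xi>\<close> and leads back to gradients.\<close>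

lemma dquot_gradient_bound:
  assumes reg: "\<And>s. 0 \<le> s \<Longrightarrow> in_H10 UI (u s)" "\<And>s. 0 \<le> s \<Longrightarrow> in_H2 UI (u s)"
    and der: "\<And>s. 0 \<le> s \<Longrightarrow> has_tderiv UI u (p s) s"
    and pH: "\<And>s. 0 \<le> s \<Longrightarrow> in_H10 UI (p s)"
    and t: "0 \<le> t" and h: "0 < h"
    and e: "\<And>\<xi>. t < \<xi> \<Longrightarrow> \<xi> < t + h \<Longrightarrow> L2norm UI (\<lambda>x. D (p \<xi>) x - D (p t) x) \<le> e"
  shows "L2norm UI (\<lambda>x. D (dquot h u t) x - D (p t) x) \<le> e"
proof -
  obtain \<phi> :: "nat \<Rightarrow> real \<Rightarrow> real" where \<phi>: "\<And>n. test_fun UI (\<phi> n)"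
    "(\<lambda>n. L2norm UI (\<lambda>x. D (\<phi> n) x - D (p t) x)) \<longlonglongrightarrow> 0"
    using in_H10_approx[OF pH[OF t]] by blast
  define W where "W = dquot h u t"
  have W: "in_H10 UI W" "in_H2 UI W"
    unfolding W_def using reg t h by (auto intro!: dquot_H10 dquot_H2)
  have DL: "in_L2 UI (D W)" "\<And>n. in_L2 UI (D (\<phi> n))" "\<And>s. 0 \<le> s \<Longrightarrow> in_L2 UI (D (p s))"
    using W(1) pH test_fun_H1[OF \<phi>(1)] by (auto intro: in_H1_D in_H10_H1)
  have bound: "L2norm UI (\<lambda>x. D W x - D (p t) x)
      \<le> e + 2 * L2norm UI (\<lambda>x. D (\<phi> n) x - D (p t) x)" for n
  proof -
    define Z where "Z = (\<lambda>x. W x - \<phi> n x)"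
    define l where "l = laplacian UI Z"
    have Z: "in_H10 UI Z" "in_H2 UI Z"
      unfolding Z_def by (intro in_H10_diff in_H2_diff W test_fun_H10 test_fun_H2 \<phi>(1))+
    have lL: "in_L2 UI l" unfolding l_def by (rule in_H2_laplacian_L2[OF Z(2)])
    have uL: "in_L2 UI (u s)" if "0 \<le> s" for s
      using reg(1)[OF that] by (intro in_H1_L2 in_H10_H1)
    have "((\<lambda>s. ip UI (u s) l) has_derivative (\<lambda>k. ip UI (p s) l * k)) (at s within {t..t + h})"
      if "s \<in> {t..t + h}" for s
    proof -
      have s: "0 \<le> s" using that t by simp
      have "((\<lambda>s. ip UI (u s) l) has_real_derivative ip UI (p s) l) (at s within {0..})"
        using has_tderiv_ip[OF der[OF s] has_tderiv_const[OF lL] s] by (simp add: ip_def)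
      then have "((\<lambda>s. ip UI (u s) l) has_real_derivative ip UI (p s) l) (at s within {t..t + h})"
        by (rule has_field_derivative_subset) (use t in auto)
      then show ?thesis by (simp add: has_field_derivative_def)
    qed
    then obtain \<xi> where \<xi>: "\<xi> \<in> {t<..<t + h}"
      "ip UI (u (t + h)) l - ip UI (u t) l = ip UI (p \<xi>) l * (t + h - t)"
      using mvt_simple[of t "t + h" "\<lambda>s. ip UI (u s) l" "\<lambda>s k. ip UI (p s) l * k"] h by auto
    have \<xi>0: "0 \<le> \<xi>" using \<xi>(1) t by simp
    have Wl: "ip UI W l = ip UI (p \<xi>) l"
      unfolding W_def dquot_def ip_divide_left
      using \<xi>(2) h t uL lL by (simp add: ip_diff_left)
    have P: "in_H10 UI (\<lambda>x. p \<xi> x - \<phi> n x)"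
      by (intro in_H10_diff pH \<xi>0 test_fun_H10 \<phi>(1))
    have L: "in_L2 UI W" "in_L2 UI (\<phi> n)" "in_L2 UI (p \<xi>)"
      using W(1) pH[OF \<xi>0] test_fun_L2[OF \<phi>(1)] by (auto intro: in_H1_L2 in_H10_H1)
    have "(L2norm UI (D Z))\<^sup>2 = - ip UI Z l"
      unfolding l_def L2norm_sq by (rule green[OF Z])
    also have "\<dots> = - ip UI (\<lambda>x. p \<xi> x - \<phi> n x) l"
      unfolding Z_def using L lL Wl by (simp add: ip_diff_left)
    also have "\<dots> = ip UI (D (\<lambda>x. p \<xi> x - \<phi> n x)) (D Z)"
      unfolding l_def by (rule green[OF P Z(2), symmetric])
    also have "\<dots> \<le> L2norm UI (D (\<lambda>x. p \<xi> x - \<phi> n x)) * L2norm UI (D Z)"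
      using ip_Cauchy_Schwarz[OF in_H1_D(1)[OF in_H10_H1[OF P]] in_H1_D(1)[OF in_H10_H1[OF Z(1)]]]
      by simp
    finally have "L2norm UI (D Z) * L2norm UI (D Z)
        \<le> L2norm UI (D (\<lambda>x. p \<xi> x - \<phi> n x)) * L2norm UI (D Z)"
      by (simp add: power2_eq_square)
    then have "L2norm UI (D Z) \<le> L2norm UI (D (\<lambda>x. p \<xi> x - \<phi> n x))"
      using L2norm_nonneg[of UI "D Z"] L2norm_nonneg[of UI "D (\<lambda>x. p \<xi> x - \<phi> n x)"]
      by (cases "L2norm UI (D Z) = 0") auto
    also have "\<dots> = L2norm UI (\<lambda>x. D (p \<xi>) x - D (\<phi> n) x)"
      by (rule L2norm_D_diff[OF in_H10_H1[OF pH[OF \<xi>0]] test_fun_H1[OF \<phi>(1)]])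
    also have "\<dots> \<le> L2norm UI (\<lambda>x. D (p \<xi>) x - D (p t) x) + L2norm UI (\<lambda>x. D (p t) x - D (\<phi> n) x)"
      by (intro L2norm_triangle_diff DL \<xi>0 t)
    also have "\<dots> \<le> e + L2norm UI (\<lambda>x. D (\<phi> n) x - D (p t) x)"
      using e[of \<xi>] \<xi>(1) by (simp add: L2norm_minus_commute[of UI "D (p t)"])
    finally have "L2norm UI (\<lambda>x. D W x - D (\<phi> n) x) \<le> e + L2norm UI (\<lambda>x. D (\<phi> n) x - D (p t) x)"
      unfolding Z_def using L2norm_D_diff[OF in_H10_H1[OF W(1)] test_fun_H1[OF \<phi>(1)]] by simp
    moreover have "L2norm UI (\<lambda>x. D W x - D (p t) x)
        \<le> L2norm UI (\<lambda>x. D W x - D (\<phi> n) x) + L2norm UI (\<lambda>x. D (\<phi> n) x - D (p t) x)"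
      by (intro L2norm_triangle_diff DL t)
    ultimately show ?thesis by simp
  qed
  have "(\<lambda>n. e + 2 * L2norm UI (\<lambda>x. D (\<phi> n) x - D (p t) x)) \<longlonglongrightarrow> e + 2 * 0"
    by (intro tendsto_add tendsto_mult tendsto_const \<phi>(2))
  then have "(\<lambda>n. e + 2 * L2norm UI (\<lambda>x. D (\<phi> n) x - D (p t) x)) \<longlonglongrightarrow> e" by simp
  then show ?thesis
    unfolding W_def[symmetric] by (rule LIMSEQ_le_const) (use bound in blast)
qed

lemma continuous_into_H10_gradient:
  assumes p: "continuous_into_H10 UI p" and t: "0 \<le> t"
  shows "((\<lambda>s. L2norm UI (\<lambda>x. D (p s) x - D (p t) x)) \<longlongrightarrow> 0) (at t within {0..})"
proof -
  have "((\<lambda>s. H1norm UI (\<lambda>x. p s x - p t x)) \<longlongrightarrow> 0) (at t within {0..})"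
    using p t by (simp add: continuous_into_H10_def)
  then have "((\<lambda>s. L2norm UI (D (\<lambda>x. p s x - p t x))) \<longlongrightarrow> 0) (at t within {0..})"
    by (simp add: H1norm_tendsto_iff)
  then show ?thesis
  proof (rule Lim_transform_eventually)
    show "\<forall>\<^sub>F s in at t within {0..}. L2norm UI (D (\<lambda>x. p s x - p t x))
        = L2norm UI (\<lambda>x. D (p s) x - D (p t) x)"
      using p t by (intro eventually_half_lineI L2norm_D_diff in_H10_H1)
        (auto simp: continuous_into_H10_def)
  qed
qed

lemma dquot_gradient_tendsto:
  assumes reg: "\<And>s. 0 \<le> s \<Longrightarrow> in_H10 UI (u s)" "\<And>s. 0 \<le> s \<Longrightarrow> in_H2 UI (u s)"
    and der: "\<And>s. 0 \<le> s \<Longrightarrow> has_tderiv UI u (p s) s"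
    and p: "continuous_into_H10 UI p" and t: "0 \<le> t"
  shows "((\<lambda>h. L2norm UI (\<lambda>x. D (dquot h u t) x - D (p t) x)) \<longlongrightarrow> 0) (at_right 0)"
proof (rule tendstoI)
  fix e :: real assume e: "0 < e"
  have "\<forall>\<^sub>F s in at t within {0..}. dist (L2norm UI (\<lambda>x. D (p s) x - D (p t) x)) 0 < e / 2"
    using tendstoD[OF continuous_into_H10_gradient[OF p t], of "e / 2"] e by simp
  then obtain d where d: "0 < d" "\<And>s. 0 \<le> s \<Longrightarrow> s \<noteq> t \<Longrightarrow> dist s t < d \<Longrightarrow>
      dist (L2norm UI (\<lambda>x. D (p s) x - D (p t) x)) 0 < e / 2"
    unfolding eventually_at by auto
  have "\<forall>\<^sub>F h in at_right 0. 0 < h \<and> h < d"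
    using d(1) by (auto simp: eventually_at_right_field)
  then show "\<forall>\<^sub>F h in at_right 0. dist (L2norm UI (\<lambda>x. D (dquot h u t) x - D (p t) x)) 0 < e"
  proof eventually_elim
    case (elim h)
    have "L2norm UI (\<lambda>x. D (dquot h u t) x - D (p t) x) \<le> e / 2"
    proof (rule dquot_gradient_bound[OF reg der _ t])
      fix \<xi> assume "t < \<xi>" "\<xi> < t + h"
      then have "dist (L2norm UI (\<lambda>x. D (p \<xi>) x - D (p t) x)) 0 < e / 2"
        using t elim by (intro d(2)) (auto simp: dist_real_def)
      then show "L2norm UI (\<lambda>x. D (p \<xi>) x - D (p t) x) \<le> e / 2"
        by (simp add: dist_real_def)
    qed (use p elim in \<open>auto simp: continuous_into_H10_def\<close>)
    then show ?case using e by (simp add: dist_real_def abs_of_nonneg[OF L2norm_nonneg])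
  qed
qed

lemma continuous_into_H10_H2_laplacian:
  assumes u: "continuous_into_H10_H2 UI u" and t: "0 \<le> t"
  shows "((\<lambda>s. L2norm UI (\<lambda>x. laplacian UI (u s) x - laplacian UI (u t) x)) \<longlongrightarrow> 0)
    (at t within {0..})"
proof -
  have H: "in_H2 UI (u s)" if "0 \<le> s" for s
    using u that by (simp add: continuous_into_H10_H2_def)
  have lim: "((\<lambda>s. H2norm UI (\<lambda>x. u s x - u t x)) \<longlongrightarrow> 0) (at t within {0..})"
    using u t by (simp add: continuous_into_H10_H2_def)
  have le: "L2norm UI (laplacian UI w) \<le> H2norm UI w" for w
    by (auto simp: H2norm_def H1norm_real laplacian_real intro!: real_le_rsqrt)
  show ?thesis
  proof (rule Lim_null_comparison[OF eventually_half_lineI lim])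
    fix s :: real assume s: "0 \<le> s"
    have "L2norm UI (\<lambda>x. laplacian UI (u s) x - laplacian UI (u t) x)
        = L2norm UI (laplacian UI (\<lambda>x. u s x - u t x))"
      using in_H2_diff[OF H[OF s] H[OF t]] H[OF s] H[OF t]
      by (intro L2norm_cong_AE) (auto intro!: in_L2_diff in_H2_laplacian_L2 elim: eventually_mono)
    then show "norm (L2norm UI (\<lambda>x. laplacian UI (u s) x - laplacian UI (u t) x))
        \<le> H2norm UI (\<lambda>x. u s x - u t x)"
      using le by (simp add: abs_of_nonneg[OF L2norm_nonneg])
  qed
qed

lemma dquot_laplacian_continuous:
  assumes u: "continuous_into_H10_H2 UI u" and t: "0 \<le> t" and h: "0 < h"
  shows "((\<lambda>s. L2norm UI (\<lambda>x. laplacian UI (dquot h u s) x - laplacian UI (dquot h u t) x)) \<longlongrightarrow> 0)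
    (at t within {0..})"
proof -
  let ?l = "\<lambda>s. laplacian UI (u s)"
  have H: "in_H2 UI (u s)" if "0 \<le> s" for s
    using u that by (simp add: continuous_into_H10_H2_def)
  have lL: "in_L2 UI (?l s)" if "0 \<le> s" for s by (rule in_H2_laplacian_L2[OF H[OF that]])
  let ?m = "\<lambda>r s. L2norm UI (\<lambda>x. ?l s x - ?l r x)"
  have "((\<lambda>s. (?m (t + h) (s + h) + ?m t s) / h) \<longlongrightarrow> (0 + 0) / h) (at t within {0..})"
    using h t continuous_into_H10_H2_laplacian[OF u t]
      tendsto_shift_half_line[OF continuous_into_H10_H2_laplacian[OF u, of "t + h"]]
    by (intro tendsto_divide tendsto_add tendsto_const) auto
  then have lim: "((\<lambda>s. (?m (t + h) (s + h) + ?m t s) / h) \<longlongrightarrow> 0) (at t within {0..})" by simp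
  show ?thesis
  proof (rule Lim_null_comparison[OF eventually_half_lineI lim])
    fix s :: real assume s: "0 \<le> s"
    let ?A = "\<lambda>x. ?l (s + h) x - ?l (t + h) x" and ?B = "\<lambda>x. ?l s x - ?l t x"
    have sh: "0 \<le> s + h" "0 \<le> t + h" using s t h by auto
    have AB: "in_L2 UI ?A" "in_L2 UI ?B"
      using s t h by (auto intro!: in_L2_diff lL)
    note 1 = dquot_H2[OF H[OF sh(1)] H[OF s]] and 2 = dquot_H2[OF H[OF sh(2)] H[OF t]]
    have "L2norm UI (\<lambda>x. laplacian UI (dquot h u s) x - laplacian UI (dquot h u t) x)
        = L2norm UI (\<lambda>x. (?A x - ?B x) / h)"
    proof (rule L2norm_cong_AE)
      show "AE x in lebesgue_on UI. laplacian UI (dquot h u s) x - laplacian UI (dquot h u t) x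
          = (?A x - ?B x) / h"
        using 1(2) 2(2) by eventually_elim (simp add: diff_divide_distrib)
    qed (intro in_L2_diff in_L2_divide in_H2_laplacian_L2 1(1) 2(1) AB)+
    also have "\<dots> = L2norm UI (\<lambda>x. ?A x - ?B x) / h" using h by (simp add: L2norm_divide)
    also have "\<dots> \<le> (L2norm UI ?A + L2norm UI ?B) / h"
    proof (rule divide_right_mono)
      show "L2norm UI (\<lambda>x. ?A x - ?B x) \<le> L2norm UI ?A + L2norm UI ?B"
        using L2norm_triangle_diff[OF AB(1) in_L2_zero AB(2)]
        unfolding L2norm_minus_commute[of UI "\<lambda>x. 0" ?B] by (simp only: diff_zero)
    qed (use h in simp)
    finally show "norm (L2norm UI (\<lambda>x. laplacian UI (dquot h u s) x - laplacian UI (dquot h u t) x))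
        \<le> (?m (t + h) (s + h) + ?m t s) / h"
      by (simp add: abs_of_nonneg[OF L2norm_nonneg])
  qed
qed

section \<open>Energies of the damped system\<close>

lemma nonincreasing_half_line:
  fixes f :: "real \<Rightarrow> real"
  assumes der: "\<And>x. s \<le> x \<Longrightarrow> x \<le> t \<Longrightarrow> (f has_real_derivative f' x) (at x within {0..})"
    and neg: "\<And>x. s \<le> x \<Longrightarrow> x \<le> t \<Longrightarrow> f' x \<le> 0" and st: "0 \<le> s" "s \<le> t"
  shows "f t \<le> f s"
proof (cases "s = t")
  case False
  have "\<exists>x\<in>{s<..<t}. f t - f s = f' x * (t - s)"
  proof (rule mvt_simple)
    fix x assume x: "s \<le> x" "x \<le> t"
    then have "(f has_real_derivative f' x) (at x within {s..t})"
      using st by (intro has_field_derivative_subset[OF der[OF x]]) auto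
    then show "(f has_derivative (\<lambda>k. f' x * k)) (at x within {s..t})"
      by (simp add: has_field_derivative_def)
  qed (use False st in auto)
  then obtain x where x: "x \<in> {s<..<t}" "f t - f s = f' x * (t - s)" by auto
  have "f' x * (t - s) \<le> 0"
    using neg[of x] x(1) st by (intro mult_nonpos_nonneg) auto
  then show ?thesis using x(2) by simp
qed simp

locale damped_system = subcritical_coupling +
  fixes g a :: "real \<Rightarrow> real" and A :: real and u0 v0 u1 v1 :: "real \<Rightarrow> real"
    and u v :: "real \<Rightarrow> real \<Rightarrow> real"
  assumes g_mono: "mono g" and g_zero: "g 0 = 0"
    and a_measurable: "a \<in> borel_measurable (lebesgue_on UI)"
    and a_bounds: "AE x in lebesgue_on UI. 0 \<le> a x \<and> a x \<le> A"
    and A_nonneg: "0 \<le> A"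
    and solution: "coupled_solution UI g a b u0 v0 u1 v1 u v"
begin

abbreviation p :: "real \<Rightarrow> real \<Rightarrow> real" where "p \<equiv> tderiv UI u"
abbreviation q :: "real \<Rightarrow> real \<Rightarrow> real" where "q \<equiv> tderiv UI v"
abbreviation r :: "real \<Rightarrow> real \<Rightarrow> real" where "r \<equiv> tderiv UI p"
abbreviation z :: "real \<Rightarrow> real \<Rightarrow> real" where "z \<equiv> tderiv UI q"
abbreviation damp :: "real \<Rightarrow> real \<Rightarrow> real" where "damp t x \<equiv> a x * g (p t x)"

lemma u_H2: "continuous_into_H10_H2 UI u" and v_H2: "continuous_into_H10_H2 UI v"
  and p_H10: "continuous_into_H10 UI p" and q_H10: "continuous_into_H10 UI q"
  using solution by (auto simp: coupled_solution_def)

lemma eq_u: "0 \<le> t \<Longrightarrow> AE x in lebesgue_on UI.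
    r t x - laplacian UI (u t) x + b x * v t x + damp t x = 0"
  and eq_v: "0 \<le> t \<Longrightarrow> AE x in lebesgue_on UI. z t x - laplacian UI (v t) x + b x * u t x = 0"
  using solution by (auto simp: coupled_solution_def)

lemma reg:
  assumes "0 \<le> t"
  shows "in_H10 UI (u t)" "in_H2 UI (u t)" "in_H10 UI (v t)" "in_H2 UI (v t)"
    "in_H10 UI (p t)" "in_H10 UI (q t)"
  using u_H2 v_H2 p_H10 q_H10 assms
  by (auto simp: continuous_into_H10_H2_def continuous_into_H10_def)

lemma tder:
  assumes "0 \<le> t"
  shows "has_tderiv UI u (p t) t" "has_tderiv UI v (q t) t"
    "has_tderiv UI p (r t) t" "has_tderiv UI q (z t) t"
  using solution assms by (auto simp: coupled_solution_def intro: tdifferentiableD)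

lemma L2:
  assumes "0 \<le> t"
  shows "in_L2 UI (u t)" "in_L2 UI (v t)" "in_L2 UI (p t)" "in_L2 UI (q t)"
    "in_L2 UI (r t)" "in_L2 UI (z t)"
  using tder[OF assms] assms by (auto simp: has_tderiv_def)

lemma damp_L2:
  assumes t: "0 \<le> t"
  shows "in_L2 UI (damp t)"
proof (rule in_L2_cong_AE)
  show "in_L2 UI (\<lambda>x. - (r t x - laplacian UI (u t) x + b x * v t x))"
    using t L2 reg by (intro in_L2_intros coupling_L2 in_H2_laplacian_L2) auto
  have "g \<in> borel_measurable borel" using g_mono by (rule borel_measurable_mono)
  then show "damp t \<in> borel_measurable (lebesgue_on UI)"
    using a_measurable in_L2_measurable[OF L2(3)[OF t]] by measurable
  show "AE x in lebesgue_on UI. - (r t x - laplacian UI (u t) x + b x * v t x) = damp t x"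
    using eq_u[OF t] by eventually_elim simp
qed

lemma g_mult_self_nonneg: "0 \<le> g y * y"
  using monoD[OF g_mono, of 0 y] monoD[OF g_mono, of y 0] g_zero
  by (cases "0 \<le> y") (auto simp: mult_nonpos_nonpos)

lemma damp_integrable: "0 \<le> t \<Longrightarrow> integrable (lebesgue_on UI) (\<lambda>x. damp t x * p t x)"
  by (intro in_L2_mult_integrable damp_L2 L2)

lemma damp_nonneg:
  assumes t: "0 \<le> t"
  shows "0 \<le> ip UI (damp t) (p t)"
  unfolding ip_def
proof (rule integral_nonneg_AE)
  show "AE x in lebesgue_on UI. 0 \<le> damp t x * p t x"
    using a_bounds by eventually_elim (simp add: mult.assoc g_mult_self_nonneg)
qed

text \<open>With the constant \<open>c\<close> of the growth of \<open>g\<close> this shows that the energy cannot vanish in finite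
  time; with \<open>c = k'(\<phi> t)\<close> it is the differential inequality of the comparison argument.\<close>

lemma damp_le:
  assumes t: "0 \<le> t" and c: "AE x in lebesgue_on UI. g (p t x) * p t x \<le> c * (p t x)\<^sup>2" "0 \<le> c"
  shows "ip UI (damp t) (p t) \<le> 2 * A * c * energy UI b u v t"
proof -
  have "ip UI (damp t) (p t) \<le> (LINT x|lebesgue_on UI. (A * c) * (p t x)\<^sup>2)"
    unfolding ip_def
  proof (rule integral_mono_AE[OF damp_integrable[OF t]])
    show "integrable (lebesgue_on UI) (\<lambda>x. (A * c) * (p t x)\<^sup>2)"
      using L2(3)[OF t] by (simp add: in_L2_def)
    show "AE x in lebesgue_on UI. damp t x * p t x \<le> (A * c) * (p t x)\<^sup>2"
      using a_bounds c(1)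
    proof eventually_elim
      case (elim x)
      then have "a x * (g (p t x) * p t x) \<le> A * (c * (p t x)\<^sup>2)"
        using g_mult_self_nonneg A_nonneg
          mult_mono[of "a x" A "g (p t x) * p t x" "c * (p t x)\<^sup>2"] by auto
      then show ?case by (simp add: mult.assoc)
    qed
  qed
  also have "\<dots> = A * c * ip UI (p t) (p t)"
    by (simp add: ip_def power2_eq_square)
  also have "\<dots> \<le> A * c * (2 * energy UI b u v t)"
  proof (rule mult_left_mono)
    show "ip UI (p t) (p t) \<le> 2 * energy UI b u v t"
      using energy_state_ge_kinetic[OF reg(1,3)[OF t] L2(3,4)[OF t]] ip_self_nonneg[of UI "q t"]
      unfolding energy_eq_energy_state by linarith
  qed (use c(2) A_nonneg in simp)
  finally show ?thesis by (simp add: ac_simps)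
qed

lemma energy_deriv:
  assumes t: "0 \<le> t"
  shows "(energy UI b u v has_real_derivative - ip UI (damp t) (p t)) (at t within {0..})"
  unfolding energy_eq_energy_state[abs_def]
  using t by (intro energy_identity[where r = "r t" and z = "z t"] reg tder damp_L2 eq_u eq_v
      continuous_into_H10_H2_laplacian u_H2 v_H2)

lemma energy_nonneg: "0 \<le> t \<Longrightarrow> 0 \<le> energy UI b u v t"
  using energy_state_ge_kinetic[OF reg(1,3) L2(3,4), of t t t t] ip_self_nonneg[of UI "p t"]
    ip_self_nonneg[of UI "q t"] unfolding energy_eq_energy_state by linarith

lemma energy_antimono: "0 \<le> s \<Longrightarrow> s \<le> t \<Longrightarrow> energy UI b u v t \<le> energy UI b u v s"
  by (rule nonincreasing_half_line[where f' = "\<lambda>t. - ip UI (damp t) (p t)"])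
    (auto intro: energy_deriv damp_nonneg)

text \<open>The difference of two time translates solves the same system with the damping replaced by a
  difference which is dissipative because \<open>g\<close> is monotone.\<close>

lemma dquot_energy_antimono:
  assumes h: "0 < h" and t: "0 \<le> t"
  shows "energy_state b (dquot h u t) (dquot h v t) (dquot h p t) (dquot h q t)
    \<le> energy_state b (dquot h u 0) (dquot h v 0) (dquot h p 0) (dquot h q 0)"
proof (rule nonincreasing_half_line[where f = "\<lambda>t. energy_state b (dquot h u t) (dquot h v t) (dquot h p t) (dquot h q t)"])
  let ?f = "\<lambda>t x. (damp (t + h) x - damp t x) / h"
  fix s :: real assume s: "0 \<le> s"
  have sh: "0 \<le> s + h" using h s by simp
  show "((\<lambda>t. energy_state b (dquot h u t) (dquot h v t) (dquot h p t) (dquot h q t))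
      has_real_derivative - ip UI (?f s) (dquot h p s)) (at s within {0..})"
  proof (rule energy_identity[OF s, where r = "dquot h r s" and z = "dquot h z s"])
    fix s' :: real assume "0 \<le> s'"
    then show "in_H10 UI (dquot h u s')" "in_H2 UI (dquot h u s')"
        "in_H10 UI (dquot h v s')" "in_H2 UI (dquot h v s')"
      using h reg by (auto intro!: dquot_H10 dquot_H2)
  next
    show "AE x in lebesgue_on UI. dquot h r s x - laplacian UI (dquot h u s) x
        + b x * dquot h v s x + ?f s x = 0"
      using eq_u[OF s] eq_u[OF sh] dquot_H2(2)[OF reg(2)[OF sh] reg(2)[OF s]]
    proof eventually_elim
      case (elim x)
      have "dquot h r s x - laplacian UI (dquot h u s) x + b x * dquot h v s x + ?f s x
          = ((r (s + h) x - laplacian UI (u (s + h)) x + b x * v (s + h) x + damp (s + h) x)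
            - (r s x - laplacian UI (u s) x + b x * v s x + damp s x)) / h"
        unfolding elim(3) dquot_def by (simp add: add_divide_distrib diff_divide_distrib algebra_simps)
      then show ?case unfolding elim(1,2) by simp
    qed
    show "AE x in lebesgue_on UI. dquot h z s x - laplacian UI (dquot h v s) x
        + b x * dquot h u s x = 0"
      using eq_v[OF s] eq_v[OF sh] dquot_H2(2)[OF reg(4)[OF sh] reg(4)[OF s]]
    proof eventually_elim
      case (elim x)
      have "dquot h z s x - laplacian UI (dquot h v s) x + b x * dquot h u s x
          = ((z (s + h) x - laplacian UI (v (s + h)) x + b x * u (s + h) x)
            - (z s x - laplacian UI (v s) x + b x * u s x)) / h"
        unfolding elim(3) dquot_def by (simp add: add_divide_distrib diff_divide_distrib algebra_simps)
      then show ?case unfolding elim(1,2) by simp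
    qed
    show "in_L2 UI (?f s)" using s sh by (intro in_L2_divide in_L2_diff damp_L2)
  qed (use s sh h in \<open>intro dquot_laplacian_continuous u_H2 v_H2 has_tderiv_dquot tder; simp\<close>)+
  have "0 \<le> ip UI (?f s) (dquot h p s)"
    unfolding ip_def
  proof (rule integral_nonneg_AE)
    show "AE x in lebesgue_on UI. 0 \<le> ?f s x * dquot h p s x"
      using a_bounds
    proof eventually_elim
      case (elim x)
      have "0 \<le> (g y - g w) * (y - w)" for y w
        using monoD[OF g_mono, of w y] monoD[OF g_mono, of y w]
        by (cases "w \<le> y") (auto simp: mult_nonpos_nonpos)
      then have "0 \<le> a x * ((g (p (s + h) x) - g (p s x)) * (p (s + h) x - p s x)) / (h * h)"
        using elim h by simp
      also have "\<dots> = ?f s x * dquot h p s x"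
        by (simp add: dquot_def algebra_simps add_divide_distrib diff_divide_distrib)
      finally show ?case .
    qed
  qed
  then show "- ip UI (?f s) (dquot h p s) \<le> 0" by simp
qed (use t in auto)

lemma dquot_energy_tendsto:
  assumes t: "0 \<le> t"
  shows "((\<lambda>h. energy_state b (dquot h u t) (dquot h v t) (dquot h p t) (dquot h q t))
    \<longlongrightarrow> energy UI b p q t) (at_right 0)"
proof -
  have H: "in_H1 UI (dquot h u t)" "in_H1 UI (dquot h v t)" "in_L2 UI (dquot h u t)" "in_L2 UI (dquot h v t)"
    "in_L2 UI (dquot h p t)" "in_L2 UI (dquot h q t)" if "0 < h" for h
    using that t reg L2 by (auto intro!: in_H10_H1 dquot_H10 dquot_L2)
  have pos: "\<forall>\<^sub>F h::real in at_right 0. 0 < h" by (simp add: eventually_at_filter)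
  have ev: "\<forall>\<^sub>F h in at_right 0. P h" if "\<And>h::real. 0 < h \<Longrightarrow> P h" for P
    using pos by eventually_elim (rule that)
  have pq: "in_H1 UI (p t)" "in_H1 UI (q t)" using reg[OF t] by (auto intro: in_H10_H1)
  note gu = dquot_gradient_tendsto[OF reg(1,2) tder(1) p_H10 t]
  note gv = dquot_gradient_tendsto[OF reg(3,4) tder(2) q_H10 t]
  note lims = dquot_tendsto[OF tder(1)[OF t] t] dquot_tendsto[OF tder(2)[OF t] t]
    dquot_tendsto[OF tder(3)[OF t] t] dquot_tendsto[OF tder(4)[OF t] t]
  have bu: "((\<lambda>h. L2norm UI (\<lambda>x. b x * dquot h u t x - b x * p t x)) \<longlongrightarrow> 0) (at_right 0)"
    using dquot_tendsto[OF has_tderiv_bounded_mult[OF tder(1)[OF t] t b_measurable b_le B_nonneg] t]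
    by (simp add: dquot_def algebra_simps)
  have "((\<lambda>h. 1/2 * (ip UI (D (dquot h u t)) (D (dquot h u t)) + ip UI (D (dquot h v t)) (D (dquot h v t))
        + ip UI (dquot h p t) (dquot h p t) + ip UI (dquot h q t) (dquot h q t))
      + ip UI (\<lambda>x. b x * dquot h u t x) (dquot h v t))
    \<longlongrightarrow> 1/2 * (ip UI (D (p t)) (D (p t)) + ip UI (D (q t)) (D (q t)) + ip UI (r t) (r t) + ip UI (z t) (z t))
      + ip UI (\<lambda>x. b x * p t x) (q t)) (at_right 0)"
    by (intro tendsto_add tendsto_mult tendsto_const ip_tendsto gu gv lims bu ev in_H1_D coupling_L2 H
        pq L2 t)
  then have "((\<lambda>h. energy_state b (dquot h u t) (dquot h v t) (dquot h p t) (dquot h q t))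
    \<longlongrightarrow> 1/2 * (ip UI (D (p t)) (D (p t)) + ip UI (D (q t)) (D (q t)) + ip UI (r t) (r t) + ip UI (z t) (z t))
      + ip UI (\<lambda>x. b x * p t x) (q t)) (at_right 0)"
  proof (rule Lim_transform_eventually)
  qed (intro ev, simp add: energy_state_eq H)
  then show ?thesis
    using L2[OF t] by (simp add: energy_eq_energy_state energy_state_eq pq)
qed

lemma velocity_energy_le_initial:
  assumes t: "0 \<le> t"
  shows "energy UI b p q t \<le> energy UI b p q 0"
proof (rule tendsto_le[OF _ dquot_energy_tendsto dquot_energy_tendsto[OF t]])
  have "\<forall>\<^sub>F h::real in at_right 0. 0 < h" by (simp add: eventually_at_filter)
  then show "\<forall>\<^sub>F h in at_right 0.
      energy_state b (dquot h u t) (dquot h v t) (dquot h p t) (dquot h q t)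
      \<le> energy_state b (dquot h u 0) (dquot h v 0) (dquot h p 0) (dquot h q 0)"
    by eventually_elim (rule dquot_energy_antimono[OF _ t])
qed auto

end

section \<open>The damping profile and the comparison equation\<close>

lemma hinv_square:
  assumes odd: "\<And>y. g (- y) = - g y"
  shows "hinv g (y\<^sup>2) = g y * y"
  by (cases "0 \<le> y") (simp_all add: hinv_def odd)

lemma hinv_mono:
  assumes g: "mono g" "g 0 = 0" and s: "0 \<le> s" "s \<le> s'"
  shows "0 \<le> hinv g s" "hinv g s \<le> hinv g s'"
proof -
  have "0 \<le> g (sqrt s)" using monoD[OF g(1), of 0 "sqrt s"] g(2) s by simp
  moreover have "g (sqrt s) \<le> g (sqrt s')" using monoD[OF g(1)] s by simp
  ultimately show "0 \<le> hinv g s" "hinv g s \<le> hinv g s'"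
    unfolding hinv_def using s by (auto intro!: mult_nonneg_nonneg mult_mono)
qed

text \<open>Since \<open>hinv g s / sqrt s = g (sqrt s)\<close> is nondecreasing, \<open>hinv g\<close> grows at least like the
  square root, wherever it is differentiable.\<close>

lemma hinv_deriv_lower:
  assumes g: "mono g" "g 0 = 0"
    and d: "(hinv g has_real_derivative d) (at s within {0..})" and s: "0 \<le> s"
  shows "hinv g s / 2 \<le> s * d"
proof (cases "s = 0")
  case False
  then have s0: "0 < s" using s by simp
  have le_filter: "at_right s \<le> at s within {0..}"
    using s by (intro at_le) auto
  have lim1: "((\<lambda>y. (hinv g y - hinv g s) / (y - s)) \<longlongrightarrow> d) (at_right s)"
    using d unfolding has_field_derivative_iff by (rule tendsto_mono[OF le_filter])
  have "(sqrt has_real_derivative inverse (sqrt s) / 2) (at s)"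
    by (rule DERIV_real_sqrt[OF s0])
  then have "((\<lambda>y. (sqrt y - sqrt s) / (y - s)) \<longlongrightarrow> inverse (sqrt s) / 2) (at s)"
    by (simp add: has_field_derivative_iff)
  then have lim2: "((\<lambda>y. g (sqrt s) * ((sqrt y - sqrt s) / (y - s)))
      \<longlongrightarrow> g (sqrt s) * (inverse (sqrt s) / 2)) (at_right s)"
    by (intro tendsto_mult tendsto_const) (rule tendsto_mono[OF at_le], auto)
  have "g (sqrt s) * (inverse (sqrt s) / 2) \<le> d"
  proof (rule tendsto_le[OF trivial_limit_at_right_real lim1 lim2])
    show "\<forall>\<^sub>F y in at_right s. g (sqrt s) * ((sqrt y - sqrt s) / (y - s))
        \<le> (hinv g y - hinv g s) / (y - s)"
      unfolding eventually_at_filter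
    proof (rule always_eventually, intro allI impI)
      fix y assume "y \<in> {s<..}"
      then have y: "s < y" by simp
      have "g (sqrt s) * sqrt y \<le> g (sqrt y) * sqrt y"
        using monoD[OF g(1), of "sqrt s" "sqrt y"] y s by (intro mult_right_mono) auto
      then have "g (sqrt s) * (sqrt y - sqrt s) \<le> hinv g y - hinv g s"
        by (simp add: hinv_def right_diff_distrib)
      then show "g (sqrt s) * ((sqrt y - sqrt s) / (y - s)) \<le> (hinv g y - hinv g s) / (y - s)"
        using y by (simp add: divide_right_mono)
    qed
  qed
  then have "s * (g (sqrt s) * (inverse (sqrt s) / 2)) \<le> s * d"
    using s by (rule mult_left_mono)
  moreover have "s * (g (sqrt s) * (inverse (sqrt s) / 2)) = hinv g s / 2"
    using s0 by (simp add: hinv_def inverse_eq_divide field_simps)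
  ultimately show ?thesis by simp
qed (simp add: hinv_def)

lemma comparison_solution_antimono:
  assumes g: "mono g" "g 0 = 0" and \<psi>: "comparison_solution A (hinv g) \<psi>" and A: "0 \<le> A"
    and st: "0 \<le> s" "s \<le> t"
  shows "\<psi> t \<le> \<psi> s"
proof -
  obtain d where d: "\<And>x. 0 \<le> x \<Longrightarrow> (hinv g has_real_derivative d x) (at (\<psi> x) within {0..})"
    "\<And>x. 0 \<le> x \<Longrightarrow> (\<psi> has_real_derivative - (A * \<psi> x * d x)) (at x within {0..})"
    "\<And>x. 0 \<le> x \<Longrightarrow> 0 \<le> \<psi> x"
    using \<psi> unfolding comparison_solution_def by metis
  have "0 \<le> A * (\<psi> x * d x)" if "0 \<le> x" for x
    using hinv_deriv_lower[OF g d(1)[OF that] d(3)[OF that]]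
      hinv_mono(1)[OF g d(3)[OF that] order_refl] A by simp
  then show ?thesis
    using st by (intro nonincreasing_half_line[OF d(2)]) (auto simp: mult.assoc)
qed

text \<open>As long as \<open>\<psi> \<ge> c\<close>, the solution decreases at least at the rate \<open>A (hinv g c) / 2\<close>, because
  \<open>\<psi> (hinv g)' \<psi> \<ge> (hinv g \<psi>) / 2\<close> and \<open>hinv g\<close> is monotone. As it stays nonnegative, it cannot remain
  above \<open>c\<close> for long.\<close>

lemma comparison_solution_drops:
  assumes g: "mono g" "g 0 = 0" and \<psi>: "comparison_solution A (hinv g) \<psi>" and A: "0 \<le> A"
    and c: "0 < c" and T: "\<psi> 0 < A * hinv g c / 2 * T" "0 \<le> T" "T \<le> t"
  shows "\<psi> t \<le> c"
proof (rule ccontr)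
  assume "\<not> \<psi> t \<le> c"
  then have ct: "c < \<psi> t" by simp
  obtain d where d: "\<And>x. 0 \<le> x \<Longrightarrow> (hinv g has_real_derivative d x) (at (\<psi> x) within {0..})"
    "\<And>x. 0 \<le> x \<Longrightarrow> (\<psi> has_real_derivative - (A * \<psi> x * d x)) (at x within {0..})"
    "\<And>x. 0 \<le> x \<Longrightarrow> 0 \<le> \<psi> x"
    using \<psi> unfolding comparison_solution_def by metis
  let ?k = "A * hinv g c / 2"
  have t: "0 \<le> t" using T by simp
  have "\<psi> t + ?k * t \<le> \<psi> 0 + ?k * 0"
  proof (rule nonincreasing_half_line[where f = "\<lambda>x. \<psi> x + ?k * x"])
    fix x assume x: "0 \<le> x" "x \<le> t"
    show "((\<lambda>x. \<psi> x + ?k * x) has_real_derivative - (A * \<psi> x * d x) + ?k * 1) (at x within {0..})"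
      by (intro DERIV_add d(2) x DERIV_cmult DERIV_ident)
    have "c \<le> \<psi> x"
      using comparison_solution_antimono[OF g \<psi> A x] ct by simp
    then have "hinv g c \<le> hinv g (\<psi> x)" using c by (intro hinv_mono(2)[OF g]) auto
    also have "\<dots> \<le> 2 * (\<psi> x * d x)"
      using hinv_deriv_lower[OF g d(1)[OF x(1)] d(3)[OF x(1)]] by simp
    finally have "A * hinv g c \<le> A * (2 * (\<psi> x * d x))" using A by (rule mult_left_mono)
    then show "- (A * \<psi> x * d x) + ?k * 1 \<le> 0" by (simp add: mult.assoc)
  qed (use t in auto)
  moreover have "?k * T \<le> ?k * t"
    using T A hinv_mono(1)[OF g, of c c] c by (intro mult_left_mono) auto
  ultimately have "\<psi> t \<le> \<psi> 0 - ?k * T" by simp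
  then show False using T(1) ct c by linarith
qed

lemma hinv_pos:
  assumes g: "mono g" "g 0 = 0" and conv: "strictly_convex_on {0<..r0} (hinv g)" "0 < r0"
    and s: "0 < s"
  shows "0 < hinv g s"
proof (rule ccontr)
  assume "\<not> 0 < hinv g s"
  then have "hinv g s = 0" using hinv_mono(1)[OF g, of s s] s by simp
  define x where "x = min s r0"
  have x: "0 < x" "x \<le> s" "x \<le> r0" using s conv(2) by (auto simp: x_def)
  have z: "hinv g y = 0" if "0 < y" "y \<le> x" for y
    using hinv_mono[OF g, of y s] that x \<open>hinv g s = 0\<close> by simp
  have "hinv g ((1 - 1/2) * x + 1/2 * (x / 2)) < (1 - 1/2) * hinv g x + 1/2 * hinv g (x / 2)"
    using conv(1) x unfolding strictly_convex_on_def
    by (elim conjE) (drule bspec[of _ _ x], simp, drule bspec[of _ _ "x / 2"], simp,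
        drule spec[of _ "1/2"], simp)
  then show False using z[of x] z[of "x / 2"] z[of "(1 - 1/2) * x + 1/2 * (x / 2)"] x by simp
qed

text \<open>Near zero the profile has a nondecreasing derivative: \<open>d1 \<ge> 0\<close> since \<open>hinv g\<close> is monotone,
  and then \<open>d1 s \<le> \<beta> s d2 s\<close> gives \<open>d2 \<ge> 0\<close>. Integrating from zero yields
  \<open>hinv g s \<le> s d1 s'\<close> for \<open>s \<le> s'\<close>.\<close>

lemma profile_convexity:
  assumes g: "mono g" "g 0 = 0" and prof: "profile_assumption (hinv g)"
  obtains r0 d1 where "0 < r0"
    "\<And>s. 0 < s \<Longrightarrow> s < r0 \<Longrightarrow> (hinv g has_real_derivative d1 s) (at s)"
    "\<And>s. 0 < s \<Longrightarrow> s < r0 \<Longrightarrow> 0 \<le> d1 s"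
    "\<And>s s'. 0 < s \<Longrightarrow> s \<le> s' \<Longrightarrow> s' < r0 \<Longrightarrow> d1 s \<le> d1 s'"
    "\<And>s s'. 0 < s \<Longrightarrow> s \<le> s' \<Longrightarrow> s' < r0 \<Longrightarrow> hinv g s \<le> s * d1 s'"
    "\<And>s. 0 < s \<Longrightarrow> 0 < hinv g s"
proof -
  obtain r0 d1 d2 \<beta> where r0: "0 < r0"
    and der: "\<And>s. s \<in> {0<..r0} \<Longrightarrow> (hinv g has_real_derivative d1 s) (at s within {0<..r0})"
      "\<And>s. s \<in> {0<..r0} \<Longrightarrow> (d1 has_real_derivative d2 s) (at s within {0<..r0})"
    and conv: "strictly_convex_on {0<..r0} (hinv g)"
    and lim: "(hinv g \<longlongrightarrow> 0) (at_right 0)"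
    and \<beta>: "1 < \<beta>" "\<And>s. s \<in> {0<..r0} \<Longrightarrow> d1 s \<le> \<beta> * s * d2 s"
    using prof unfolding profile_assumption_def by blast
  have at: "at s within {0<..r0} = at s" if "0 < s" "s < r0" for s
    by (rule at_within_interior, rule interiorI[of "{0<..<r0}"]) (use that in auto)
  have der1: "(hinv g has_real_derivative d1 s) (at s)" if "0 < s" "s < r0" for s
    using der(1)[of s] at[OF that] that by simp
  have der2: "(d1 has_real_derivative d2 s) (at s)" if "0 < s" "s < r0" for s
    using der(2)[of s] at[OF that] that by simp
  have d1_nonneg: "0 \<le> d1 s" if "0 < s" "s < r0" for s
  proof -
    have "hinv g s / 2 \<le> s * d1 s"
      using that by (intro hinv_deriv_lower[OF g has_field_derivative_at_within[OF der1[OF that]]]) simp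
    then have "0 \<le> s * d1 s" using hinv_mono(1)[OF g, of s s] that by simp
    then show ?thesis using that by (simp add: zero_le_mult_iff)
  qed
  have d2_nonneg: "0 \<le> d2 s" if "0 < s" "s < r0" for s
  proof -
    have "0 \<le> (\<beta> * s) * d2 s" using \<beta>(2)[of s] d1_nonneg[OF that] that by simp
    moreover have "0 < \<beta> * s" using \<beta>(1) that by simp
    ultimately show ?thesis by (simp only: zero_le_mult_iff) linarith
  qed
  have d1_mono: "d1 s \<le> d1 s'" if "0 < s" "s \<le> s'" "s' < r0" for s s'
  proof (rule DERIV_nonneg_imp_nondecreasing[OF that(2)])
    fix x assume "s \<le> x" "x \<le> s'"
    then have x: "0 < x" "x < r0" using that by auto
    show "\<exists>y. (d1 has_real_derivative y) (at x) \<and> 0 \<le> y"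
      using der2[OF x] d2_nonneg[OF x] by blast
  qed
  have below: "hinv g s \<le> s * d1 s'" if "0 < s" "s \<le> s'" "s' < r0" for s s'
  proof -
    have "((\<lambda>e. hinv g s - hinv g e) \<longlongrightarrow> hinv g s - 0) (at_right 0)"
      by (intro tendsto_diff tendsto_const lim)
    moreover have "((\<lambda>e. (s - e) * d1 s') \<longlongrightarrow> (s - 0) * d1 s') (at_right 0)"
      by (intro tendsto_intros)
    moreover have "\<forall>\<^sub>F e in at_right 0. hinv g s - hinv g e \<le> (s - e) * d1 s'"
    proof -
      have "\<forall>\<^sub>F e in at_right 0. 0 < e \<and> e < s"
        using that(1) by (auto simp: eventually_at_right_field)
      then show ?thesis
      proof eventually_elim
        case (elim e)
        have "(hinv g has_real_derivative d1 x) (at x)" if "e \<le> x" "x \<le> s" for x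
          using elim that \<open>s \<le> s'\<close> \<open>s' < r0\<close> by (intro der1) auto
        then obtain x where x: "e < x" "x < s" "hinv g s - hinv g e = (s - e) * d1 x"
          using MVT2[of e s "hinv g" d1] elim by auto
        then have "d1 x \<le> d1 s'" using d1_mono[of x s'] elim that by simp
        then show ?case unfolding x(3) using elim by (intro mult_left_mono) auto
      qed
    qed
    ultimately have "hinv g s - 0 \<le> (s - 0) * d1 s'"
      by (intro tendsto_le[OF trivial_limit_at_right_real])
    then show ?thesis by simp
  qed
  show thesis
    by (rule that[OF r0 der1 d1_nonneg d1_mono below hinv_pos[OF g conv r0]])
qed

lemma max_0_square_deriv:
  "((\<lambda>x::real. (max 0 x)\<^sup>2) has_real_derivative 2 * max 0 x) (at x)"
proof -
  consider "x < 0" | "x = 0" | "0 < x" by linarith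
  then show ?thesis
  proof cases
    case 1
    have "((\<lambda>x::real. (max 0 x)\<^sup>2) has_real_derivative 0) (at x)"
      by (rule has_field_derivative_transform_within_open[where f = "\<lambda>x. 0" and S = "{..<0}"])
        (use 1 in auto)
    then show ?thesis using 1 by simp
  next
    case 2
    have "((\<lambda>h::real. max 0 h) \<longlongrightarrow> max 0 0) (at 0)"
      by (intro tendsto_max tendsto_const tendsto_ident_at)
    then have "((\<lambda>h::real. max 0 h) \<longlongrightarrow> 0) (at 0)" by (simp only: max.idem)
    then have "((\<lambda>h::real. ((max 0 (0 + h))\<^sup>2 - (max 0 0)\<^sup>2) / h) \<longlongrightarrow> 0) (at 0)"
      by (rule Lim_transform_eventually)
        (auto simp: eventually_at_filter max_def power2_eq_square)
    then show ?thesis using 2 by (simp add: DERIV_def)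
  next
    case 3
    have "((\<lambda>x::real. x\<^sup>2) has_real_derivative 2 * x) (at x)"
      by (auto intro!: derivative_eq_intros)
    then have "((\<lambda>x::real. (max 0 x)\<^sup>2) has_real_derivative 2 * x) (at x)"
      by (rule has_field_derivative_transform_within_open[where S = "{0<..}"])
        (use 3 in auto)
    then show ?thesis using 3 by simp
  qed
qed

lemma lower_bound_of_comparison:
  assumes "0 < (E1::real)" "0 \<le> E" "0 \<le> y" "y \<le> 4 * sqrt (E1 * E)"
  shows "(y / (4 * sqrt E1))\<^sup>2 \<le> E"
proof -
  have "y / (4 * sqrt E1) \<le> sqrt E"
    using assms by (simp add: real_sqrt_mult field_simps)
  then have "(y / (4 * sqrt E1))\<^sup>2 \<le> (sqrt E)\<^sup>2"
    using assms by (intro power_mono) auto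
  then show ?thesis using assms by simp
qed

section \<open>Lower bound for the energy\<close>

context damped_system
begin

abbreviation E :: "real \<Rightarrow> real" where "E \<equiv> energy UI b u v"
abbreviation E1 :: real where "E1 \<equiv> energy UI b p q 0"

text \<open>By the growth bound on \<open>g\<close>, the energy decays at most exponentially; for \<open>A = 0\<close> it does not
  decay at all.\<close>

lemma energy_exp_mono:
  assumes c: "\<And>y. g y * y \<le> c * y\<^sup>2" "0 \<le> c" and st: "0 \<le> s" "s \<le> t"
  shows "E s * exp (2 * A * c * s) \<le> E t * exp (2 * A * c * t)"
proof -
  let ?k = "2 * A * c"
  have "- (E t * exp (?k * t)) \<le> - (E s * exp (?k * s))"
  proof (rule nonincreasing_half_line[where f = "\<lambda>x. - (E x * exp (?k * x))"])
    fix x assume x: "s \<le> x" "x \<le> t"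
    then have x0: "0 \<le> x" using st by simp
    show "((\<lambda>x. - (E x * exp (?k * x))) has_real_derivative
        - ((- ip UI (damp x) (p x) + ?k * E x) * exp (?k * x))) (at x within {0..})"
      by (rule derivative_eq_intros energy_deriv[OF x0] refl)+ (simp add: algebra_simps)
    have "ip UI (damp x) (p x) \<le> ?k * E x"
      using c by (intro damp_le x0) auto
    then show "- ((- ip UI (damp x) (p x) + ?k * E x) * exp (?k * x)) \<le> 0" by simp
  qed (use st in auto)
  then show ?thesis by simp
qed

text \<open>Agmon's inequality bounds \<open>(p t)\<^sup>2\<close> by \<open>\<parallel>p t\<parallel> \<parallel>D (p t)\<parallel>\<close>, where \<open>\<parallel>p t\<parallel>\<^sup>2 \<le> 2 E t\<close>. The gradient
  is controlled by the energy of the velocities, which never exceeds its initial value \<open>E1\<close>, up to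
  the coupling term \<open>2 B E t\<close>; once this term is at most \<open>E1\<close>, \<open>\<parallel>D (p t)\<parallel>\<^sup>2 \<le> 3 E1\<close> and
  \<open>sqrt (2 * 3) \<le> 4\<close>.\<close>

lemma velocity_sup_bound:
  assumes t: "0 \<le> t" and small: "2 * B * E t \<le> E1"
  shows "AE x in lebesgue_on UI. (p t x)\<^sup>2 \<le> 4 * sqrt (E1 * E t)"
proof -
  have kin: "ip UI (p t) (p t) + ip UI (q t) (q t) \<le> 2 * E t"
    using energy_state_ge_kinetic[OF reg(1,3)[OF t] L2(3,4)[OF t]]
    by (simp add: energy_eq_energy_state)
  then have 1: "(L2norm UI (p t))\<^sup>2 \<le> 2 * E t"
    using ip_self_nonneg[of UI "q t"] by (simp add: L2norm_sq)
  have "(L2norm UI (D (p t)))\<^sup>2 \<le> 2 * energy UI b p q t + B * (ip UI (p t) (p t) + ip UI (q t) (q t))"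
    using energy_state_ge_gradient[OF reg(5,6)[OF t] L2(5,6)[OF t]]
    by (simp add: energy_eq_energy_state)
  also have "\<dots> \<le> 2 * E1 + B * (2 * E t)"
    using velocity_energy_le_initial[OF t] kin B_nonneg by (intro add_mono mult_left_mono) auto
  finally have 2: "(L2norm UI (D (p t)))\<^sup>2 \<le> 3 * E1" using small by simp
  have E1: "0 \<le> E1" using 2 zero_le_power2[of "L2norm UI (D (p t))"] by linarith
  have "(L2norm UI (p t) * L2norm UI (D (p t)))\<^sup>2 \<le> (2 * E t) * (3 * E1)"
    unfolding power_mult_distrib using 1 2 energy_nonneg[OF t] by (intro mult_mono) auto
  also have "\<dots> \<le> 16 * (E1 * E t)" using E1 energy_nonneg[OF t] by simp
  finally have "L2norm UI (p t) * L2norm UI (D (p t)) \<le> sqrt (16 * (E1 * E t))"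
    by (rule real_le_rsqrt)
  also have "\<dots> = 4 * sqrt (E1 * E t)" by (simp add: real_sqrt_mult)
  finally have "L2norm UI (p t) * L2norm UI (D (p t)) \<le> 4 * sqrt (E1 * E t)" .
  then show ?thesis
    using in_H10_sup_bound[OF reg(5)[OF t]] by (auto elim: eventually_mono)
qed

text \<open>If the energy tends to zero, then from some time on \<open>\<phi> = 4 sqrt (E1 E)\<close> bounds the square
  of the velocity and lies in the range where the profile is convex, so that \<open>\<phi>\<close> is a
  supersolution of the comparison equation. The square of the positive part of \<open>\<psi> - \<phi>\<close> is then
  nonincreasing, because the nonlinearity of the equation is monotone.\<close>

lemma comparison_decaying:
  assumes odd: "\<And>y. g (- y) = - g y" and prof: "profile_assumption (hinv g)"
    and c: "\<And>y. g y * y \<le> c * y\<^sup>2" "0 \<le> c"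
    and E1: "0 < E1"
    and decay: "\<And>e. 0 < e \<Longrightarrow> \<exists>t\<ge>0. E t < e"
  obtains T where "0 < T" "\<And>\<psi> t. comparison_solution A (hinv g) \<psi> \<Longrightarrow> 0 < \<psi> 0 \<Longrightarrow>
    \<psi> 0 \<le> 4 * sqrt (E1 * E T) \<Longrightarrow> T \<le> t \<Longrightarrow> \<psi> t \<le> 4 * sqrt (E1 * E t)"
proof -
  obtain r0 d1 where r0: "0 < r0"
    and der: "\<And>s. 0 < s \<Longrightarrow> s < r0 \<Longrightarrow> (hinv g has_real_derivative d1 s) (at s)"
    and d1: "\<And>s. 0 < s \<Longrightarrow> s < r0 \<Longrightarrow> 0 \<le> d1 s"
      "\<And>s s'. 0 < s \<Longrightarrow> s \<le> s' \<Longrightarrow> s' < r0 \<Longrightarrow> d1 s \<le> d1 s'"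
    and below: "\<And>s s'. 0 < s \<Longrightarrow> s \<le> s' \<Longrightarrow> s' < r0 \<Longrightarrow> hinv g s \<le> s * d1 s'"
    by (rule profile_convexity[OF g_mono g_zero prof]) blast
  \<comment> \<open>The first bound makes \<open>2 B E\<close> at most \<open>E1\<close>, the second one makes \<open>\<phi>\<close> smaller than \<open>r0\<close>.\<close>
  define e where "e = min (E1 / (2 * B + 1)) ((r0 / 4)\<^sup>2 / E1)"
  have B1: "0 < 2 * B + 1" using B_nonneg by simp
  have e: "0 < e" unfolding e_def using E1 r0 B1 by simp
  obtain t0 where t0: "0 \<le> t0" "E t0 < e" using decay[OF e] by blast
  define T where "T = t0 + 1"
  have T: "0 < T" unfolding T_def using t0 by simp
  define \<phi> where "\<phi> t = 4 * sqrt (E1 * E t)" for t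
  have small: "2 * B * E t \<le> E1" "\<phi> t < r0" if t: "T \<le> t" for t
  proof -
    have t': "0 \<le> t" using t T by simp
    have Ee: "E t < e" using energy_antimono[of t0 t] t0 t by (simp add: T_def)
    then have "E t \<le> E1 / (2 * B + 1)" by (simp add: e_def)
    then have "(2 * B + 1) * E t \<le> E1" using B1 by (simp add: field_simps)
    then show "2 * B * E t \<le> E1" using energy_nonneg[OF t'] by (simp add: distrib_right)
    have "E t < (r0 / 4)\<^sup>2 / E1" using Ee by (simp add: e_def)
    then have "E1 * E t < (r0 / 4)\<^sup>2" using E1 by (simp add: field_simps)
    then have "sqrt (E1 * E t) < sqrt ((r0 / 4)\<^sup>2)" by (rule real_sqrt_less_mono)
    then show "\<phi> t < r0" using r0 by (simp add: \<phi>_def)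
  qed
  show thesis
  proof (rule that[OF T])
    fix \<psi> t
    assume \<psi>: "comparison_solution A (hinv g) \<psi>" and \<psi>0: "0 < \<psi> 0"
      "\<psi> 0 \<le> 4 * sqrt (E1 * E T)" and t: "T \<le> t"
    obtain d where d: "\<And>x. 0 \<le> x \<Longrightarrow> (hinv g has_real_derivative d x) (at (\<psi> x) within {0..})"
      "\<And>x. 0 \<le> x \<Longrightarrow> (\<psi> has_real_derivative - (A * \<psi> x * d x)) (at x within {0..})"
      "\<And>x. 0 \<le> x \<Longrightarrow> 0 \<le> \<psi> x"
      using \<psi> unfolding comparison_solution_def by metis
    have "0 < E1 * E T"
    proof -
      have "0 < sqrt (E1 * E T)" using \<psi>0 by linarith
      then show ?thesis by (simp only: real_sqrt_gt_0_iff)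
    qed
    then have ET: "0 < E T" using E1 by (simp add: zero_less_mult_iff)
    have Epos: "0 < E x" if "T \<le> x" for x
    proof -
      have "0 < E T * exp (2 * A * c * T)" using ET by simp
      also have "\<dots> \<le> E x * exp (2 * A * c * x)"
        using T that by (intro energy_exp_mono c) auto
      finally show ?thesis by (simp add: zero_less_mult_iff)
    qed
    have \<phi>pos: "0 < \<phi> x" if "T \<le> x" for x
      using Epos[OF that] E1 by (simp add: \<phi>_def)
    define \<phi>' where "\<phi>' x = 2 * E1 * (- ip UI (damp x) (p x)) / sqrt (E1 * E x)" for x
    have \<phi>der: "(\<phi> has_real_derivative \<phi>' x) (at x within {0..})" if x: "T \<le> x" for x
    proof -
      have x0: "0 \<le> x" using x T by simp
      have pos: "0 < E1 * E x" using Epos[OF x] E1 by simp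
      have "((\<lambda>x. E1 * E x) has_real_derivative E1 * (- ip UI (damp x) (p x))) (at x within {0..})"
        by (intro DERIV_cmult energy_deriv x0)
      from DERIV_chain2[OF DERIV_real_sqrt[OF pos] this]
      have "((\<lambda>x. 4 * sqrt (E1 * E x)) has_real_derivative
          4 * (inverse (sqrt (E1 * E x)) / 2 * (E1 * (- ip UI (damp x) (p x))))) (at x within {0..})"
        by (rule DERIV_cmult)
      then show ?thesis
        unfolding \<phi>_def[abs_def] \<phi>'_def by (rule DERIV_cong) (simp add: inverse_eq_divide)
    qed
    have \<phi>super: "- (A * (\<phi> x * d1 (\<phi> x))) \<le> \<phi>' x" if x: "T \<le> x" for x
    proof -
      have x0: "0 \<le> x" using x T by simp
      have "AE y in lebesgue_on UI. g (p x y) * p x y \<le> d1 (\<phi> x) * (p x y)\<^sup>2"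
        using velocity_sup_bound[OF x0 small(1)[OF x]]
      proof eventually_elim
        case (elim y)
        show ?case
        proof (cases "p x y = 0")
          case False
          then have "hinv g ((p x y)\<^sup>2) \<le> (p x y)\<^sup>2 * d1 (\<phi> x)"
            using elim small(2)[OF x] by (intro below) (auto simp: \<phi>_def)
          then show ?thesis by (simp add: hinv_square[of g, OF odd] mult.commute)
        qed simp
      qed
      then have "ip UI (damp x) (p x) \<le> 2 * A * d1 (\<phi> x) * E x"
        by (rule damp_le[OF x0]) (rule d1(1)[OF \<phi>pos[OF x] small(2)[OF x]])
      then have "2 * E1 * (- (2 * A * d1 (\<phi> x) * E x)) / sqrt (E1 * E x) \<le> \<phi>' x"
        unfolding \<phi>'_def using E1 Epos[OF x] by (intro divide_right_mono mult_left_mono) auto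
      moreover have "2 * E1 * (- (2 * A * d1 (\<phi> x) * E x)) / sqrt (E1 * E x)
          = - (A * (\<phi> x * d1 (\<phi> x)))"
      proof -
        have "2 * E1 * (- (2 * A * d1 (\<phi> x) * E x)) / sqrt (E1 * E x)
            = - (4 * A * d1 (\<phi> x)) * ((E1 * E x) / sqrt (E1 * E x))" by simp
        also have "(E1 * E x) / sqrt (E1 * E x) = sqrt (E1 * E x)"
          using E1 Epos[OF x] by (intro real_div_sqrt) simp
        finally show ?thesis by (simp add: \<phi>_def)
      qed
      ultimately show ?thesis by simp
    qed
    have \<psi>\<phi>T: "\<psi> x \<le> \<phi> T" if "0 \<le> x" for x
      using comparison_solution_antimono[OF g_mono g_zero \<psi> A_nonneg order_refl that] \<psi>0(2)
      by (simp add: \<phi>_def)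
    have "(max 0 (\<psi> t - \<phi> t))\<^sup>2 \<le> (max 0 (\<psi> T - \<phi> T))\<^sup>2"
    proof (rule nonincreasing_half_line[where f = "\<lambda>x. (max 0 (\<psi> x - \<phi> x))\<^sup>2"])
      fix x assume x: "T \<le> x" "x \<le> t"
      have x0: "0 \<le> x" using x T by simp
      show "((\<lambda>x. (max 0 (\<psi> x - \<phi> x))\<^sup>2) has_real_derivative
          2 * max 0 (\<psi> x - \<phi> x) * (- (A * \<psi> x * d x) - \<phi>' x)) (at x within {0..})"
        by (rule DERIV_chain2[OF max_0_square_deriv DERIV_diff[OF d(2)[OF x0] \<phi>der[OF x(1)]]])
      show "2 * max 0 (\<psi> x - \<phi> x) * (- (A * \<psi> x * d x) - \<phi>' x) \<le> 0"
      proof (cases "\<psi> x \<le> \<phi> x")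
        case False
        then have less: "\<phi> x < \<psi> x" by simp
        have \<psi>x: "0 < \<psi> x" "\<psi> x < r0"
          using \<phi>pos[OF x(1)] less \<psi>\<phi>T[OF x0] small(2)[OF order_refl] by linarith+
        have "at (\<psi> x) within {0..} = at (\<psi> x)"
          by (rule at_within_interior) (use \<psi>x in simp)
        then have "d x = d1 (\<psi> x)"
          using d(1)[OF x0] der[OF \<psi>x] DERIV_unique by metis
        moreover have "\<phi> x * d1 (\<phi> x) \<le> \<psi> x * d1 (\<psi> x)"
          using less \<phi>pos[OF x(1)] \<psi>x d1 by (intro mult_mono) auto
        then have "A * (\<phi> x * d1 (\<phi> x)) \<le> A * (\<psi> x * d1 (\<psi> x))"
          using A_nonneg by (rule mult_left_mono)
        ultimately have "- (A * \<psi> x * d x) - \<phi>' x \<le> 0"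
          using \<phi>super[OF x(1)] by (simp add: mult.assoc)
        then show ?thesis by (intro mult_nonneg_nonpos) auto
      qed simp
    qed (use T t in auto)
    also have "\<dots> = 0" using \<psi>\<phi>T[of T] T by simp
    finally show "\<psi> t \<le> 4 * sqrt (E1 * E t)"
      by (simp add: \<phi>_def)
  qed
qed

text \<open>If the energy stays above some \<open>e > 0\<close>, then every admissible \<open>\<psi>\<close> has dropped below
  \<open>4 sqrt (E1 e)\<close> after a time that depends only on \<open>E 0\<close>, unless \<open>A = 0\<close>, when both the
  energy and \<open>\<psi>\<close> are constant.\<close>

lemma comparison_not_decaying:
  assumes prof: "profile_assumption (hinv g)"
    and c: "\<And>y. g y * y \<le> c * y\<^sup>2" "0 \<le> c"
    and E1: "0 < E1" and e: "0 < e" "\<And>t. 0 \<le> t \<Longrightarrow> e \<le> E t"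
  obtains T where "0 < T" "\<And>\<psi> t. comparison_solution A (hinv g) \<psi> \<Longrightarrow>
    \<psi> 0 \<le> 4 * sqrt (E1 * E T) \<Longrightarrow> T \<le> t \<Longrightarrow> \<psi> t \<le> 4 * sqrt (E1 * E t)"
proof (cases "A = 0")
  case True
  show thesis
  proof (rule that[of 1])
    fix \<psi> t
    assume \<psi>: "comparison_solution A (hinv g) \<psi>" "\<psi> 0 \<le> 4 * sqrt (E1 * E 1)" and t: "1 \<le> (t::real)"
    have "\<psi> t \<le> \<psi> 0"
      using t by (intro comparison_solution_antimono[OF g_mono g_zero \<psi>(1) A_nonneg]) auto
    also have "\<dots> \<le> 4 * sqrt (E1 * E t)"
    proof -
      have "E 1 \<le> E t" using energy_exp_mono[OF c, of 1 t] t True by simp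
      then have "4 * sqrt (E1 * E 1) \<le> 4 * sqrt (E1 * E t)" using E1 by simp
      with \<psi>(2) show ?thesis by (rule order_trans)
    qed
    finally show "\<psi> t \<le> 4 * sqrt (E1 * E t)" .
  qed simp
next
  case False
  then have A: "0 < A" using A_nonneg by simp
  define k where "k = 4 * sqrt (E1 * e)"
  have k: "0 < k" using E1 e by (simp add: k_def)
  have hk: "0 < hinv g k"
    by (rule profile_convexity[OF g_mono g_zero prof]) (use k in blast)
  define C where "C = 4 * sqrt (E1 * E 0)"
  have C: "0 < C" using E1 e(1) e(2)[of 0] by (simp add: C_def)
  \<comment> \<open>Initially \<open>\<psi> \<le> C\<close>, and above \<open>k\<close> it loses at least \<open>A (hinv g k) / 2\<close> per unit of time.\<close>
  define T where "T = 2 * C / (A * hinv g k) + 1"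
  have T: "0 < T" unfolding T_def using C A hk by (intro add_nonneg_pos) auto
  have "A * hinv g k / 2 * T = C + A * hinv g k / 2"
    unfolding T_def using A hk by (simp add: field_simps)
  then have CT: "C < A * hinv g k / 2 * T" using A hk by simp
  show thesis
  proof (rule that[OF T])
    fix \<psi> t
    assume \<psi>: "comparison_solution A (hinv g) \<psi>" "\<psi> 0 \<le> 4 * sqrt (E1 * E T)" and t: "T \<le> t"
    have "4 * sqrt (E1 * E T) \<le> C"
      using energy_antimono[of 0 T] T E1 by (simp add: C_def)
    then have "\<psi> 0 < A * hinv g k / 2 * T" using \<psi>(2) CT by linarith
    then have "\<psi> t \<le> k"
      using T t by (intro comparison_solution_drops[OF g_mono g_zero \<psi>(1) A_nonneg k]) auto
    also have "\<dots> \<le> 4 * sqrt (E1 * E t)"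
      using e(2)[of t] T t E1 by (simp add: k_def)
    finally show "\<psi> t \<le> 4 * sqrt (E1 * E t)" .
  qed
qed

theorem energy_lower_bound:
  assumes odd: "\<And>y. g (- y) = - g y" and prof: "profile_assumption (hinv g)"
    and c: "\<And>y. g y * y \<le> c * y\<^sup>2" "0 \<le> c"
  shows "\<exists>T>0. \<forall>\<psi>. comparison_solution A (hinv g) \<psi> \<and> 0 < \<psi> 0 \<and> \<psi> 0 \<le> 4 * sqrt (E1 * E T)
    \<longrightarrow> (\<forall>t\<ge>T. (\<psi> t / (4 * sqrt E1))\<^sup>2 \<le> E t)"
proof (cases "0 < E1")
  case False
  have "E1 * E 1 \<le> 0" using False energy_nonneg[of 1] by (intro mult_nonpos_nonneg) auto
  then have "4 * sqrt (E1 * E 1) \<le> 0" by simp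
  then have "\<not> (0 < y \<and> y \<le> 4 * sqrt (E1 * E 1))" for y by linarith
  then show ?thesis by (intro exI[of _ 1] conjI zero_less_one allI impI) blast
next
  case True
  obtain T where T: "0 < T" "\<And>\<psi> t. comparison_solution A (hinv g) \<psi> \<Longrightarrow> 0 < \<psi> 0 \<Longrightarrow>
    \<psi> 0 \<le> 4 * sqrt (E1 * E T) \<Longrightarrow> T \<le> t \<Longrightarrow> \<psi> t \<le> 4 * sqrt (E1 * E t)"
  proof (cases "\<exists>e>0. \<forall>t\<ge>0. e \<le> E t")
    case True
    then obtain e where "0 < e" "\<And>t. 0 \<le> t \<Longrightarrow> e \<le> E t" by blast
    from comparison_not_decaying[OF prof c \<open>0 < E1\<close> this] show thesis using that by metis
  next
    case False
    then have "\<And>e. 0 < e \<Longrightarrow> \<exists>t\<ge>0. E t < e" by (meson not_le)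
    from comparison_decaying[OF odd prof c \<open>0 < E1\<close> this] show thesis using that by metis
  qed
  show ?thesis
  proof (intro exI[of _ T] conjI T(1) allI impI)
    fix \<psi> t
    assume "comparison_solution A (hinv g) \<psi> \<and> 0 < \<psi> 0 \<and> \<psi> 0 \<le> 4 * sqrt (E1 * E T)"
      and t: "T \<le> t"
    then have \<psi>: "comparison_solution A (hinv g) \<psi>" "0 < \<psi> 0" "\<psi> 0 \<le> 4 * sqrt (E1 * E T)" by auto
    have "0 \<le> t" using T(1) t by simp
    then show "(\<psi> t / (4 * sqrt E1))\<^sup>2 \<le> E t"
      using \<psi>(1) by (intro lower_bound_of_comparison True energy_nonneg T(2)[OF \<psi> t])
        (auto simp: comparison_solution_def)
  qed
qed

end

lemma smooth_on_UI_measurable: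
  assumes "smooth_on UI f"
  shows "f \<in> borel_measurable (lebesgue_on UI)"
proof -
  have "Ck_on 0 UI f" using assms unfolding smooth_on_def by blast
  then show ?thesis by (intro continuous_imp_measurable_on_sets_lebesgue) auto
qed

lemma Linf_norm_nonneg: "f \<in> borel_measurable (lebesgue_on UI) \<Longrightarrow> 0 \<le> Linf_norm UI f"
proof -
  assume f: "f \<in> borel_measurable (lebesgue_on UI)"
  have "emeasure (lebesgue_on UI) (space (lebesgue_on UI)) \<noteq> 0"
    by (simp add: emeasure_restrict_space)
  then have "(0::ereal) = esssup (lebesgue_on UI) (\<lambda>x. 0)" by (simp add: esssup_const)
  also have "\<dots> \<le> Linf_norm UI f"
    unfolding Linf_norm_def by (rule esssup_mono) auto
  finally show ?thesis .
qed

theorem proposition1: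
  fixes \<Omega> :: "real set"
    and g a b :: "real \<Rightarrow> real"
    and M0 m M M1 lam \<delta> :: real
    and u0 v0 u1 v1 :: "real \<Rightarrow> real"
    and u v :: "real \<Rightarrow> real \<Rightarrow> real"
  assumes Omega: "\<Omega> = {0<..<1}"
    and g_cont: "continuous_on UNIV g"
    and g_mono: "mono g"
    and g_zero: "g 0 = 0"
    and consts_pos: "0 < M0" "0 < m" "0 < M" "0 < M1"
    and g_small: "\<And>y. \<bar>y\<bar> < 1 \<Longrightarrow> g y * y \<le> M0 * y\<^sup>2"
    and g_large: "\<And>y. \<bar>y\<bar> \<ge> 1 \<Longrightarrow> m * y\<^sup>2 \<le> g y * y \<and> g y * y \<le> M * y\<^sup>2"
    and g_deriv: "\<exists>g'. weak_deriv UNIV 1 g g' \<and> Linf_norm UNIV g' \<le> ereal M1"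
    and g_odd: "\<And>y. g (- y) = - g y"
    and a_smooth: "smooth_on \<Omega> a" and b_smooth: "smooth_on \<Omega> b"
    and a_nonneg: "\<And>x. x \<in> \<Omega> \<Longrightarrow> 0 \<le> a x" and b_nonneg: "\<And>x. x \<in> \<Omega> \<Longrightarrow> 0 \<le> b x"
    and a_bounded: "Linf_norm \<Omega> a < \<infinity>"
    and lam: "poincare_constant \<Omega> lam"
    and delta: "0 < \<delta>"
    and b_bound: "Linf_norm \<Omega> b \<le> ereal ((1 - \<delta>) / lam\<^sup>2)"
    and A2: "profile_assumption (hinv g)"
    and GCC_a: "interval_GCC {x \<in> \<Omega>. a x > 0}"
    and GCC_b: "interval_GCC {x \<in> \<Omega>. b x > 0}"
    and A1: "unique_continuation \<Omega> a b"
    and data: "in_H10 \<Omega> u0" "in_H2 \<Omega> u0" "in_H10 \<Omega> v0" "in_H2 \<Omega> v0"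
              "in_H10 \<Omega> u1" "in_H10 \<Omega> v1"
    and sol: "coupled_solution \<Omega> g a b u0 v0 u1 v1 u v"
  shows "\<exists>T0>0. \<forall>\<psi>.
    comparison_solution (real_of_ereal (Linf_norm \<Omega> a)) (hinv g) \<psi> \<and>
    0 < \<psi> 0 \<and>
    \<psi> 0 \<le> 4 * sqrt (energy \<Omega> b (tderiv \<Omega> u) (tderiv \<Omega> v) 0 * energy \<Omega> b u v T0)
    \<longrightarrow> (\<forall>t\<ge>T0. energy \<Omega> b u v t
           \<ge> (\<psi> t / (4 * sqrt (energy \<Omega> b (tderiv \<Omega> u) (tderiv \<Omega> v) 0)))\<^sup>2)"
proof -
  note ms = a_smooth[unfolded Omega, THEN smooth_on_UI_measurable]
    b_smooth[unfolded Omega, THEN smooth_on_UI_measurable]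
  define B where "B = (1 - \<delta>) / lam\<^sup>2"
  define A where "A = real_of_ereal (Linf_norm UI a)"
  have "0 \<le> ereal B"
    unfolding B_def by (rule order_trans[OF Linf_norm_nonneg[OF ms(2)] b_bound[unfolded Omega]])
  then have B: "0 \<le> B" by simp
  have BL: "B * lam\<^sup>2 \<le> 1" using delta by (simp add: B_def)
  have La: "Linf_norm UI a = ereal A" "0 \<le> A"
    using Linf_norm_nonneg[OF ms(1)] a_bounded unfolding A_def Omega
    by (cases "Linf_norm UI a"; simp)+
  have b_le: "AE x in lebesgue_on UI. \<bar>b x\<bar> \<le> B"
    using esssup_AE[of "\<lambda>x. ereal \<bar>b x\<bar>" "lebesgue_on UI"]
  proof eventually_elim
    case (elim x)
    also have "esssup (lebesgue_on UI) (\<lambda>x. ereal \<bar>b x\<bar>) \<le> ereal B"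
      using b_bound by (simp add: Linf_norm_def Omega B_def)
    finally show ?case by simp
  qed
  have a_le: "AE x in lebesgue_on UI. 0 \<le> a x \<and> a x \<le> A"
    using esssup_AE[of "\<lambda>x. ereal \<bar>a x\<bar>" "lebesgue_on UI"] AE_space
  proof eventually_elim
    case (elim x)
    then have "ereal \<bar>a x\<bar> \<le> ereal A" using La(1) by (simp add: Linf_norm_def)
    then show ?case using a_nonneg[of x] elim by (simp add: Omega)
  qed
  interpret damped_system b B lam g a A u0 v0 u1 v1 u v
    by unfold_locales
      (use ms b_le B lam BL g_mono g_zero a_le La(2) sol in \<open>simp_all add: Omega\<close>)
  have growth: "g y * y \<le> max M0 M * y\<^sup>2" for y
  proof (cases "\<bar>y\<bar> < 1")
    case True
    then have "g y * y \<le> M0 * y\<^sup>2" by (rule g_small)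
    also have "\<dots> \<le> max M0 M * y\<^sup>2" by (intro mult_right_mono) auto
    finally show ?thesis .
  next
    case False
    then have "g y * y \<le> M * y\<^sup>2" using g_large by simp
    also have "\<dots> \<le> max M0 M * y\<^sup>2" by (intro mult_right_mono) auto
    finally show ?thesis .
  qed
  show ?thesis
    unfolding Omega La(1) real_of_ereal.simps
    using energy_lower_bound[OF g_odd A2 growth] consts_pos by simp
qed

end
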